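(* Suppose $z$ is an $n$-vertex with $n\ge5$. Then the $A$-module $M=b_1A+b_2A+b_3A$ has a rhombus filtration with four quotients. Explicitly, there is an exact sequence $$0\to b_1A+b_2A\to M\to\bar b_4b_3A\to0.$$
   Context: Tiling. Let $\mathrm p:\mathbb R^3\to\mathbb R^2$ be linear with $\mathrm p(\mathbf e_1)=(-\frac{\sqrt3}{2},-\frac12)$, $\mathrm p(\mathbf e_2)=(\frac{\sqrt3}{2},-\frac12)$, $\mathrm p(\mathbf e_3)=(0,1)$. For $\{i,j,k\}=\{1,2,3\}$ let $R_k=\{\lambda \mathrm p(\mathbf e_i)+\mu \mathrm p(\mathbf e_j):0\le\lambda,\mu\le1\}$. Let $\mathbf M=\begin{pmatrix}0&1&0\\0&0&1\\1&-1&-1\end{pmatrix}$ with columns $\mathbf c_1,\mathbf c_2,\mathbf c_3$. A pair $(z,k)$, $z\in\mathbb Z^3$, represents the rhombus $\mathrm p(z)+R_k$. Put $\mathcal P_0=\{(0,1),(0,2),(0,3)\}$ and $\mathcal P_{i+1}=\bigcup_{(z,k)\in\mathcal P_i}\mathcal R(z,k)$, where $\mathcal R(z,1)=\{(\mathbf Mz,3),(\mathbf Mz+\mathbf c_2,1),(\mathbf Mz+\mathbf c_3,2)\}$, $\mathcal R(z,2)=\{(\mathbf Mz,1)\}$, $\mathcal R(z,3)=\{(\mathbf Mz,2)\}$. Then $\mathcal P_i\subset\mathcal P_{i+1}$ and $\bigcup_i\mathcal P_i$ is a tiling of the plane by rhombi (the Rauzy tiling). Algebra $A$. Let $Q$ be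 the quiver whose vertices are the vertices of the Rauzy tiling, with each edge replaced by two arrows in opposite directions; $\bar b$ is the arrow opposite to $b$. Let $k$ be a field. Paths are composed left to right and modules are right modules. The Rauzy algebra is $A=kQ/I$, where $I$ is generated by: (1) a path of length two along two distinct edges that are not both edges of one rhombus is zero; (2) the two paths of length two joining opposite vertices of a rhombus (along its boundary) are equal; (3) for each vertex $z$, $s_1(z)D_1(z)=s_2(z)D_2(z)=s_3(z)D_3(z)$, where $D_a(z)=L_a^+(z)-L_a^-(z)$, $L_a^{\pm}(z)=g\bar g$ if there is an arrow $g:z\to z\pm\mathrm p(\mathbf e_a)$ and $L_a^\pm(z)=0$ otherwise, and $s_a(z)\in\{\pm1\}$ is a fixed choice of signs such that whenever $z,x$ are joined by an edge parallel to $\mathrm p(\mathbf e_a)$, $s_a(x)=-s_a(z)$ and $s_c(x)=s_c(z)$ for $c\ne a$ (such signs are determined by their values at one vertex). $S_z$ is the simple module at $z$. Local notation. An $n$-vertex is a vertex $z$ with exactly $n$ edges. Its neighbours are labelled $x_1,\dots,x_n$ counterclockwise (starting anywhere), and $b_j:z\to x_j$ is the corresponding arrow. Rhombus modules. For a rhombus of the tiling with opposite vertices $z,y$ and remaining vertices $u,v$, the rhombus module $R^y_z$ is the (unique up to isomorphism) $A$-module with top $S_y$, socle $S_z$ and $\mathrm{rad}/\mathrm{soc}\cong S_u\oplus S_v$; explicitly $R^y_z=pA$ with $p$ the path of length two from $z$ to $y$ around the rhombus. A module $M$ has a rhombus filtration (with $r$ quotients) if there are submodules $0=M_0\subset M_1\subset\dots\subset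 M_r=M$ with each $M_j/M_{j-1}$ a rhombus module. *)

theory Defs
  imports "HOL-Analysis.Analysis" "HOL-Algebra.QuotRing" "HOL-Library.Poly_Mapping"
begin

section \<open>The Rauzy tiling\<close>

definition proj :: "int^3 \<Rightarrow> real^2" where
  "proj w = of_int (w $ 1) *\<^sub>R vector [- sqrt 3 / 2, - 1 / 2]
          + of_int (w $ 2) *\<^sub>R vector [sqrt 3 / 2, - 1 / 2]
          + of_int (w $ 3) *\<^sub>R vector [0, 1]"

abbreviation unit3 :: "3 \<Rightarrow> int^3" where
  "unit3 a \<equiv> axis a 1"

definition Rauzy_matrix :: "int^3^3" where
  "Rauzy_matrix = vector [vector [0, 1, 0], vector [0, 0, 1], vector [1, -1, -1]]"

definition inflate :: "(int^3) \<times> 3 \<Rightarrow> ((int^3) \<times> 3) set" where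
  "inflate = (\<lambda>(w, k).
     let w' = Rauzy_matrix *v w in
     if k = 1 then {(w', 3), (w' + column 2 Rauzy_matrix, 1), (w' + column 3 Rauzy_matrix, 2)}
     else if k = 2 then {(w', 1)}
     else {(w', 2)})"

primrec patch :: "nat \<Rightarrow> ((int^3) \<times> 3) set" where
  "patch 0 = {(0, 1), (0, 2), (0, 3)}"
| "patch (Suc i) = (\<Union>t \<in> patch i. inflate t)"

definition Rauzy_tiles :: "((int^3) \<times> 3) set" where
  "Rauzy_tiles = (\<Union>i. patch i)"

text \<open>
  The pair \<open>(w, k)\<close> stands for the rhombus with corner \<open>proj w\<close> spanned by the projections of the two
  unit vectors other than the \<open>k\<close>-th. \<open>tile_corners a b c d\<close> says that \<open>a, b, c, d\<close> are the four corners
  of one tile, listed in one of the eight possible ways along its boundary. Thus \<open>a, c\<close> and \<open>b, d\<close>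
  are the pairs of opposite corners, and \<open>{a, b}\<close>, \<open>{b, c}\<close>, \<open>{c, d}\<close>, \<open>{d, a}\<close> are the sides.
\<close>

definition tile_corners :: "real^2 \<Rightarrow> real^2 \<Rightarrow> real^2 \<Rightarrow> real^2 \<Rightarrow> bool" where
  "tile_corners a b c d \<longleftrightarrow>
     (\<exists>w k i j r. (w, k) \<in> Rauzy_tiles \<and> {i, j, k} = UNIV \<and>
        [a, b, c, d] = rotate r [proj w, proj (w + unit3 i),
                                 proj (w + unit3 i + unit3 j), proj (w + unit3 j)])"

definition vertices :: "(real^2) set" where
  "vertices = {a. \<exists>b c d. tile_corners a b c d}"

definition edge :: "real^2 \<Rightarrow> real^2 \<Rightarrow> bool" where
  "edge a b \<longleftrightarrow> (\<exists>c d. tile_corners a b c d)"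

definition n_vertex :: "nat \<Rightarrow> real^2 \<Rightarrow> bool" where
  "n_vertex n z \<longleftrightarrow> z \<in> vertices \<and> finite {y. edge z y} \<and> card {y. edge z y} = n"

definition ccw_labelling :: "real^2 \<Rightarrow> nat \<Rightarrow> (nat \<Rightarrow> real^2) \<Rightarrow> bool" where
  "ccw_labelling z n x \<longleftrightarrow>
     bij_betw x {1..n} {y. edge z y} \<and>
     (\<exists>\<theta> t. strict_mono_on {1..n} t \<and>
        (\<forall>j\<in>{1..n}. t j \<in> {\<theta>..<\<theta> + 2 * pi} \<and>
           x j - z = norm (x j - z) *\<^sub>R vector [cos (t j), sin (t j)]))"


section \<open>Path algebras and ideals\<close>

text \<open>
  The quivers here have at most one arrow from one vertex to another, so a path is given by the nonempty
  list of the vertices it runs through: \<open>[v]\<close> is the trivial path at \<open>v\<close>, and \<open>[u, v]\<close> is the arrow from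
  \<open>u\<close> to \<open>v\<close>. Paths are composed from left to right.
\<close>

definition quiver_paths :: "'v set \<Rightarrow> ('v \<Rightarrow> 'v \<Rightarrow> bool) \<Rightarrow> 'v list set" where
  "quiver_paths V E = {q. q \<noteq> [] \<and> set q \<subseteq> V \<and> successively E q}"

definition path_mult :: "('v list \<Rightarrow>\<^sub>0 'k::field) \<Rightarrow> ('v list \<Rightarrow>\<^sub>0 'k) \<Rightarrow> ('v list \<Rightarrow>\<^sub>0 'k)" where
  "path_mult f g =
     (\<Sum>p \<in> Poly_Mapping.keys f. \<Sum>q \<in> Poly_Mapping.keys g.
        if last p = hd q
        then Poly_Mapping.single (p @ tl q) (Poly_Mapping.lookup f p * Poly_Mapping.lookup g q)
        else 0)"

text \<open>
  For a quiver with infinitely many vertices the path algebra has no identity element, only local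
  units. The field \<open>one\<close> of the record is therefore a dummy, and the library locales
  \<open>ring\<close> and \<open>ideal\<close> (hence \<open>genideal\<close>) do not apply.
\<close>

definition path_algebra :: "'v set \<Rightarrow> ('v \<Rightarrow> 'v \<Rightarrow> bool) \<Rightarrow> ('v list \<Rightarrow>\<^sub>0 'k::field) ring" where
  "path_algebra V E =
     \<lparr>carrier = {f. Poly_Mapping.keys f \<subseteq> quiver_paths V E},
      mult = path_mult, one = undefined, zero = 0, add = (+)\<rparr>"

definition two_sided_ideal :: "('a, 'b) ring_scheme \<Rightarrow> 'a set \<Rightarrow> bool" where
  "two_sided_ideal R J \<longleftrightarrow>
     additive_subgroup J R \<and>
     (\<forall>x\<in>J. \<forall>a\<in>carrier R. a \<otimes>\<^bsub>R\<^esub> x \<in> J \<and> x \<otimes>\<^bsub>R\<^esub> a \<in> J)"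

text \<open>
  In a path algebra closure under the scalars of \<open>k\<close> is automatic: on any given
  element a scalar acts as multiplication by a combination of trivial paths.
\<close>

definition generated_ideal :: "('a, 'b) ring_scheme \<Rightarrow> 'a set \<Rightarrow> 'a set" where
  "generated_ideal R S = \<Inter>{J. two_sided_ideal R J \<and> S \<subseteq> J}"


section \<open>Right modules\<close>

text \<open>
  As in the library's record \<open>module\<close>, only the additive part of \<open>ring\<close> is relevant;
  \<open>mult\<close> and \<open>one\<close> are not used.
\<close>

record ('a, 'm) right_module = "'m ring" +
  ract :: "'m \<Rightarrow> 'a \<Rightarrow> 'm"

definition regular_module :: "('a, 'b) ring_scheme \<Rightarrow> ('a, 'a) right_module" where
  "regular_module A =
     \<lparr>carrier = carrier A, mult = mult A, one = one A, zero = zero A, add = add A, ract = mult A\<rparr>"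

definition submodule :: "('a, 'b) ring_scheme \<Rightarrow> 'm set \<Rightarrow> ('a, 'm) right_module \<Rightarrow> bool" where
  "submodule A N M \<longleftrightarrow>
     additive_subgroup N M \<and> (\<forall>m\<in>N. \<forall>a\<in>carrier A. ract M m a \<in> N)"

definition quotient_module ::
    "('a, 'm) right_module \<Rightarrow> 'm set \<Rightarrow> ('a, 'm set) right_module" where
  "quotient_module M N =
     \<lparr>carrier = a_rcosets\<^bsub>M\<^esub> N, mult = undefined, one = undefined, zero = N, add = set_add M,
      ract = (\<lambda>X a. \<Union>x\<in>X. N +>\<^bsub>M\<^esub> ract M x a)\<rparr>"

definition module_hom ::
    "('a, 'b) ring_scheme \<Rightarrow> ('a, 'm) right_module \<Rightarrow> ('a, 'n) right_module \<Rightarrow> ('m \<Rightarrow> 'n) set" where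
  "module_hom A M N =
     {f \<in> carrier M \<rightarrow> carrier N.
        (\<forall>x\<in>carrier M. \<forall>y\<in>carrier M. f (x \<oplus>\<^bsub>M\<^esub> y) = f x \<oplus>\<^bsub>N\<^esub> f y) \<and>
        (\<forall>x\<in>carrier M. \<forall>a\<in>carrier A. f (ract M x a) = ract N (f x) a)}"

definition module_isomorphic ::
    "('a, 'b) ring_scheme \<Rightarrow> ('a, 'm) right_module \<Rightarrow> ('a, 'n) right_module \<Rightarrow> bool" where
  "module_isomorphic A M N \<longleftrightarrow> (\<exists>f \<in> module_hom A M N. bij_betw f (carrier M) (carrier N))"

definition short_exact ::
    "('a, 'b) ring_scheme \<Rightarrow> ('a, 'l) right_module \<Rightarrow> ('a, 'm) right_module \<Rightarrow> ('a, 'n) right_module \<Rightarrow>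
     ('l \<Rightarrow> 'm) \<Rightarrow> ('m \<Rightarrow> 'n) \<Rightarrow> bool" where
  "short_exact A L M N f g \<longleftrightarrow>
     f \<in> module_hom A L M \<and> g \<in> module_hom A M N \<and>
     inj_on f (carrier L) \<and> f ` carrier L = a_kernel M N g \<and> g ` carrier M = carrier N"


section \<open>The Rauzy algebra\<close>

definition sign_choice :: "(3 \<Rightarrow> real^2 \<Rightarrow> int) \<Rightarrow> bool" where
  "sign_choice s \<longleftrightarrow>
     (\<forall>z\<in>vertices. \<forall>a. s a z \<in> {1, -1}) \<and>
     (\<forall>z x a. edge z x \<and> (x = z + proj (unit3 a) \<or> x = z - proj (unit3 a)) \<longrightarrow>
        s a x = - s a z \<and> (\<forall>c. c \<noteq> a \<longrightarrow> s c x = s c z))"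

abbreviation path_elem :: "(real^2) list \<Rightarrow> ((real^2) list \<Rightarrow>\<^sub>0 'k::field)" where
  "path_elem q \<equiv> Poly_Mapping.single q 1"

definition loop :: "real^2 \<Rightarrow> real^2 \<Rightarrow> ((real^2) list \<Rightarrow>\<^sub>0 'k::field)" where
  "loop z x = (if edge z x then path_elem [z, x, z] else 0)"

definition signed_loops :: "(3 \<Rightarrow> real^2 \<Rightarrow> int) \<Rightarrow> 3 \<Rightarrow> real^2 \<Rightarrow> ((real^2) list \<Rightarrow>\<^sub>0 'k::field)" where
  "signed_loops s a z =
     (let D = loop z (z + proj (unit3 a)) - loop z (z - proj (unit3 a))
      in if s a z = 1 then D else - D)"

definition relations :: "(3 \<Rightarrow> real^2 \<Rightarrow> int) \<Rightarrow> ((real^2) list \<Rightarrow>\<^sub>0 'k::field) set" where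
  "relations s =
     {path_elem [x, y, w] |x y w. edge x y \<and> edge y w \<and> x \<noteq> w \<and> (\<nexists>d. tile_corners x y w d)} \<union>
     {path_elem [x, u, y] - path_elem [x, v, y] |x u y v. tile_corners x u y v} \<union>
     {signed_loops s a z - signed_loops s c z |a c z. z \<in> vertices}"

definition Rauzy_path_algebra :: "((real^2) list \<Rightarrow>\<^sub>0 'k::field) ring" where
  "Rauzy_path_algebra = path_algebra vertices edge"

definition Rauzy_ideal :: "(3 \<Rightarrow> real^2 \<Rightarrow> int) \<Rightarrow> ((real^2) list \<Rightarrow>\<^sub>0 'k::field) set" where
  "Rauzy_ideal s = generated_ideal Rauzy_path_algebra (relations s)"

definition Rauzy_algebra :: "(3 \<Rightarrow> real^2 \<Rightarrow> int) \<Rightarrow> ((real^2) list \<Rightarrow>\<^sub>0 'k::field) set ring" where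
  "Rauzy_algebra s = Rauzy_path_algebra Quot Rauzy_ideal s"

definition path_class ::
    "(3 \<Rightarrow> real^2 \<Rightarrow> int) \<Rightarrow> (real^2) list \<Rightarrow> ((real^2) list \<Rightarrow>\<^sub>0 'k::field) set" where
  "path_class s q = Rauzy_ideal s +>\<^bsub>Rauzy_path_algebra\<^esub> path_elem q"

definition right_ideal_module :: "'a ring \<Rightarrow> 'a set \<Rightarrow> ('a, 'a) right_module" where
  "right_ideal_module A N = (regular_module A)\<lparr>carrier := N\<rparr>"


section \<open>Rhombus modules and rhombus filtrations\<close>

text \<open>
  The rhombus module with socle at \<open>z\<close> and top at \<open>y\<close> is the right ideal generated by
  (the class of) the path \<open>[z, u, y]\<close> along the boundary of the rhombus.
\<close>

definition rhombus_module ::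
    "(3 \<Rightarrow> real^2 \<Rightarrow> int) \<Rightarrow> (((real^2) list \<Rightarrow>\<^sub>0 'k::field) set, 'm) right_module \<Rightarrow> bool" where
  "rhombus_module s N \<longleftrightarrow>
     (let A = Rauzy_algebra s in
      \<exists>z u y v. tile_corners z u y v \<and>
        module_isomorphic A N (right_ideal_module A (path_class s [z, u, y] <#\<^bsub>A\<^esub> carrier A)))"

definition has_rhombus_filtration ::
    "(3 \<Rightarrow> real^2 \<Rightarrow> int) \<Rightarrow> (((real^2) list \<Rightarrow>\<^sub>0 'k::field) set, 'm) right_module \<Rightarrow> nat \<Rightarrow> bool" where
  "has_rhombus_filtration s M r \<longleftrightarrow>
     (\<exists>F. F 0 = {\<zero>\<^bsub>M\<^esub>} \<and> F r = carrier M \<and>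
        (\<forall>j\<le>r. submodule (Rauzy_algebra s) (F j) M) \<and>
        (\<forall>j<r. F j \<subset> F (Suc j) \<and>
           rhombus_module s (quotient_module (M\<lparr>carrier := F (Suc j)\<rparr>) (F j))))"

end

theory Submission
  imports Defs
begin

text \<open>
  Give \<open>w \<in> \<int>\<^sup>3\<close> the height \<open>\<langle>len, w\<rangle>\<close>, where \<open>len\<close> is the left eigenvector of the Rauzy matrix for
  its contracting eigenvalue \<open>alpha\<close>. The substitution maps the discrete plane of all \<open>(w, k)\<close> with
  \<open>0 \<le> ht w < len k\<close> to itself, each of its tiles having exactly one parent, and being near each other is
  inherited by parents. Hence the Rauzy tiles contain every tile of the discrete plane that meets one of
  them in a corner, and the edges and tiles at a vertex can be read off from the height of the vertex:
  each edge is in two tiles, one on each side, and at a vertex with five or six edges consecutive edges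
  bound a tile.

  Left multiplication by \<open>\<bar>b\<^sub>4\<close> annihilates \<open>b\<^sub>1\<close> and \<open>b\<^sub>2\<close> and maps \<open>b\<^sub>3 A\<close> onto the rhombus module
  \<open>\<bar>b\<^sub>4 b\<^sub>3 A\<close>. Modulo the module generated by the path across the tile between \<open>b\<^sub>2\<close> and \<open>b\<^sub>3\<close>, which is
  contained in \<open>b\<^sub>2 A\<close>, the module \<open>b\<^sub>3 A\<close> is spanned by four paths, and their images in \<open>\<bar>b\<^sub>4 b\<^sub>3 A\<close> are
  linearly independent because there is a linear functional on the loops of length four at a vertex that
  vanishes on the relations but on no loop around a rhombus. This computes the kernel; the lower steps
  of the filtration arise in the same way from \<open>\<bar>b\<^sub>3\<close> and \<open>\<bar>b\<^sub>2\<close>.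
\<close>

section \<open>Path algebras\<close>

text \<open>The relations only give upper bounds: paths can be rewritten or shown to vanish, but
  none can be shown to survive. The functional closes this gap. Closed paths of length four suffice
  for it, since a path that should survive can be prolonged to a loop along the sides of a rhombus,
  where its value is plus or minus a product of signs and thus invertible in every characteristic.
  No basis of \<open>M\<close> is computed. If left multiplication by an arrow kills a submodule
  \<open>Y\<close> and its kernel on an arrow module lies in \<open>Y\<close>, then its kernel on
  the sum of both is \<open>Y\<close>. This one step serves three times; the fourth quotient, at the
  bottom, is the rhombus module of the tile between \<open>x_n\<close> and \<open>x_1\<close>. The
  bound \<open>n >= 5\<close> keeps \<open>x_4\<close> and \<open>x_1\<close> from sharing a tile at
  \<open>z\<close>. As the quiver is infinite, the algebra has only local units. Submodules are
  handled through their preimages, the right ideals of the path algebra that contain the ideal of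
  relations, where one computes with sums of paths.\<close>

lemma path_mult_superset:
  assumes "finite P" "finite Q" "Poly_Mapping.keys f \<subseteq> P" "Poly_Mapping.keys g \<subseteq> Q"
  shows "path_mult f g =
    (\<Sum>p\<in>P. \<Sum>q\<in>Q. if last p = hd q
        then Poly_Mapping.single (p @ tl q) (Poly_Mapping.lookup f p * Poly_Mapping.lookup g q) else 0)"
proof -
  have "(\<Sum>q \<in> Poly_Mapping.keys g. if last p = hd q
        then Poly_Mapping.single (p @ tl q) (Poly_Mapping.lookup f p * Poly_Mapping.lookup g q) else 0)
    = (\<Sum>q\<in>Q. if last p = hd q
        then Poly_Mapping.single (p @ tl q) (Poly_Mapping.lookup f p * Poly_Mapping.lookup g q) else 0)" for p
    using assms by (intro sum.mono_neutral_left) (auto simp: in_keys_iff)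
  then show ?thesis
    unfolding path_mult_def using assms
    by (simp only:) (intro sum.mono_neutral_left, auto simp: in_keys_iff intro!: sum.neutral)
qed

lemma path_mult_single:
  "path_mult (Poly_Mapping.single p c) (Poly_Mapping.single q d) =
    (if last p = hd q then Poly_Mapping.single (p @ tl q) (c * d) else 0)"
  by (subst path_mult_superset[of "{p}" "{q}"]) (auto simp: Poly_Mapping.keys_single)

lemma path_mult_add_left: "path_mult (f + g) h = path_mult f h + path_mult g h"
proof -
  let ?P = "Poly_Mapping.keys f \<union> Poly_Mapping.keys g" and ?Q = "Poly_Mapping.keys h"
  have k: "finite ?P" "finite ?Q" "Poly_Mapping.keys (f + g) \<subseteq> ?P" by (auto dest: Poly_Mapping.keys_add[THEN subsetD])
  show ?thesis
    unfolding path_mult_superset[OF k(1,2,3) subset_refl] path_mult_superset[OF k(1,2) Un_upper1 subset_refl]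
      path_mult_superset[OF k(1,2) Un_upper2 subset_refl]
    by (auto simp: sum.distrib[symmetric] lookup_add distrib_right single_add intro!: sum.cong)
qed

lemma path_mult_add_right: "path_mult h (f + g) = path_mult h f + path_mult h g"
proof -
  let ?P = "Poly_Mapping.keys f \<union> Poly_Mapping.keys g" and ?Q = "Poly_Mapping.keys h"
  have k: "finite ?Q" "finite ?P" "Poly_Mapping.keys (f + g) \<subseteq> ?P" by (auto dest: Poly_Mapping.keys_add[THEN subsetD])
  show ?thesis
    unfolding path_mult_superset[OF k(1,2) subset_refl k(3)] path_mult_superset[OF k(1,2) subset_refl Un_upper1]
      path_mult_superset[OF k(1,2) subset_refl Un_upper2]
    by (auto simp: sum.distrib[symmetric] lookup_add distrib_left single_add intro!: sum.cong)
qed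

lemma path_mult_zero [simp]: "path_mult 0 f = 0" "path_mult f 0 = 0"
  by (simp_all add: path_mult_def)

lemma path_mult_minus: "path_mult (- f) g = - path_mult f g" "path_mult f (- g) = - path_mult f g"
  using path_mult_add_left[of "- f" f g] path_mult_add_right[of f "- g" g] by (simp_all add: eq_neg_iff_add_eq_0)

lemma path_mult_diff: "path_mult (f - g) h = path_mult f h - path_mult g h"
  "path_mult h (f - g) = path_mult h f - path_mult h g"
  using path_mult_add_left[of f "- g" h] path_mult_add_right[of h f "- g"] by (simp_all add: path_mult_minus)

definition path_span :: "'v set \<Rightarrow> ('v \<Rightarrow> 'v \<Rightarrow> bool) \<Rightarrow> ('v list \<Rightarrow>\<^sub>0 'k::field) set" where
  "path_span V E = {f. Poly_Mapping.keys f \<subseteq> quiver_paths V E}"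

lemma path_algebra_simps:
  "carrier (path_algebra V E) = path_span V E" "mult (path_algebra V E) = path_mult"
  "zero (path_algebra V E) = 0" "add (path_algebra V E) = (+)"
  by (simp_all add: path_algebra_def path_span_def)

lemma path_span_zero [simp]: "0 \<in> path_span V E"
  by (simp add: path_span_def)

lemma path_span_add: "f \<in> path_span V E \<Longrightarrow> g \<in> path_span V E \<Longrightarrow> f + g \<in> path_span V E"
  using Poly_Mapping.keys_add[of f g] by (auto simp: path_span_def)

lemma path_span_minus: "f \<in> path_span V E \<Longrightarrow> - f \<in> path_span V E"
  by (simp add: path_span_def)

lemma path_span_diff: "f \<in> path_span V E \<Longrightarrow> g \<in> path_span V E \<Longrightarrow> f - g \<in> path_span V E"
  using path_span_add[OF _ path_span_minus] by force

lemma path_span_single: "q \<in> quiver_paths V E \<Longrightarrow> Poly_Mapping.single q c \<in> path_span V E"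
  by (auto simp: path_span_def Poly_Mapping.keys_single)

text \<open>An element is the finite sum of its monomials, so properties additive in an argument
  reduce to single paths with a coefficient.\<close>

lemma path_span_induct [consumes 1, case_names zero single add]:
  assumes "f \<in> path_span V E" and "P 0"
    and "\<And>q c. q \<in> quiver_paths V E \<Longrightarrow> P (Poly_Mapping.single q c)"
    and "\<And>f g. f \<in> path_span V E \<Longrightarrow> g \<in> path_span V E \<Longrightarrow> P f \<Longrightarrow> P g \<Longrightarrow> P (f + g)"
  shows "P f"
proof -
  have "(\<Sum>k\<in>S. Poly_Mapping.single k (Poly_Mapping.lookup f k)) \<in> path_span V E \<and>
      P (\<Sum>k\<in>S. Poly_Mapping.single k (Poly_Mapping.lookup f k))"
    if "finite S" "S \<subseteq> quiver_paths V E" for S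
    using that
  proof (induction S rule: finite_induct)
    case empty
    then show ?case using assms(2) by simp
  next
    case (insert q S)
    let ?s = "Poly_Mapping.single q (Poly_Mapping.lookup f q)"
    have q: "q \<in> quiver_paths V E" using insert.prems by simp
    have s: "?s \<in> path_span V E" "P ?s" using path_span_single[OF q] assms(3)[OF q] .
    have IH: "(\<Sum>k\<in>S. Poly_Mapping.single k (Poly_Mapping.lookup f k)) \<in> path_span V E"
      "P (\<Sum>k\<in>S. Poly_Mapping.single k (Poly_Mapping.lookup f k))"
      using insert.IH insert.prems by blast+
    show ?case
      unfolding sum.insert[OF insert.hyps]
      using path_span_add[OF s(1) IH(1)] assms(4)[OF s(1) IH(1) s(2) IH(2)] by (rule conjI)
  qed
  moreover have "(\<Sum>k\<in>Poly_Mapping.keys f. Poly_Mapping.single k (Poly_Mapping.lookup f k)) = f"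
    by (rule poly_mapping_eqI)
      (auto simp: lookup_sum lookup_single when_def in_keys_iff sum.delta)
  ultimately show ?thesis
    using assms(1) finite_keys[of f] unfolding path_span_def by (metis mem_Collect_eq)
qed

lemma quiver_paths_join:
  assumes "p \<in> quiver_paths V E" "q \<in> quiver_paths V E" "last p = hd q"
  shows "p @ tl q \<in> quiver_paths V E"
proof -
  obtain v q' where q: "q = v # q'" using assms(2) by (cases q) (auto simp: quiver_paths_def)
  show ?thesis using assms unfolding q quiver_paths_def
    by (cases q') (auto simp: successively_append_iff)
qed

lemma path_span_mult:
  assumes "f \<in> path_span V E" "g \<in> path_span V E" shows "path_mult f g \<in> path_span V E"
  using assms(1)
proof (induction rule: path_span_induct)
  case (single p c)
  show ?case using assms(2)
  proof (induction rule: path_span_induct)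
    case (single q d)
    show ?case using quiver_paths_join[OF \<open>p \<in> _\<close> single]
      by (auto simp: path_mult_single intro: path_span_single)
  qed (auto simp: path_mult_add_right intro: path_span_add)
qed (auto simp: path_mult_add_left intro: path_span_add)

text \<open>On single paths both sides are the same concatenation. The arguments are taken in the
  span because \<open>hd\<close> and \<open>last\<close> mark endpoints of nonempty lists
  only.\<close>

lemma path_mult_assoc:
  assumes "f \<in> path_span V E" "g \<in> path_span V E" "h \<in> path_span V E"
  shows "path_mult (path_mult f g) h = path_mult f (path_mult g h)"
  using assms(1)
proof (induction rule: path_span_induct)
  case (single p c)
  then have p: "p \<noteq> []" by (simp add: quiver_paths_def)
  show ?case using assms(2)
  proof (induction rule: path_span_induct)
    case (single q d)
    then have q: "q \<noteq> []" by (simp add: quiver_paths_def)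
    show ?case using assms(3)
    proof (induction rule: path_span_induct)
      case (single r e)
      then have r: "r \<noteq> []" by (simp add: quiver_paths_def)
      obtain q1 q2 where "q = q1 # q2" using q by (cases q) auto
      then have "last (p @ tl q) = last q" if "last p = hd q" using that p by (cases q2) auto
      moreover have "hd (q @ tl r) = hd q" "tl (q @ tl r) = tl q @ tl r" using q by auto
      ultimately show ?case by (simp add: path_mult_single mult.assoc)
    qed (auto simp: path_mult_add_right)
  qed (auto simp: path_mult_add_right path_mult_add_left)
qed (auto simp: path_mult_add_left)

lemma path_algebra_abelian_group: "abelian_group (path_algebra V E)"
proof (rule abelian_groupI)
  fix f assume "f \<in> carrier (path_algebra V E :: ('a list \<Rightarrow>\<^sub>0 'b::field) ring)"
  then show "\<exists>g\<in>carrier (path_algebra V E). g \<oplus>\<^bsub>path_algebra V E\<^esub> f = \<zero>\<^bsub>path_algebra V E\<^esub>"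
    using path_span_minus by (intro bexI[of _ "- f"]) (auto simp: path_algebra_simps)
qed (auto simp: path_algebra_simps path_span_add add.assoc add.commute)

lemma path_algebra_a_inv:
  assumes "f \<in> path_span V E" shows "\<ominus>\<^bsub>path_algebra V E\<^esub> f = - f"
proof -
  interpret abelian_group "path_algebra V E" by (rule path_algebra_abelian_group)
  show ?thesis using assms path_span_minus
    by (intro minus_equality) (auto simp: path_algebra_simps)
qed

section \<open>Modules\<close>

text \<open>The cosets of the kernel are the nonempty fibres of \<open>g\<close>, so
  \<open>g\<close> evaluated at an arbitrary element of a coset defines the isomorphism.\<close>

lemma first_isomorphism:
  assumes M: "abelian_group M" and K: "abelian_group K"
    and act: "\<And>x a. x \<in> carrier M \<Longrightarrow> a \<in> carrier A \<Longrightarrow> ract M x a \<in> carrier M"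
    and g: "g \<in> module_hom A M K" "g ` carrier M = carrier K"
    and N: "N = {m \<in> carrier M. g m = \<zero>\<^bsub>K\<^esub>}"
  shows "module_isomorphic A (quotient_module M N) K"
proof -
  interpret M: abelian_group M by fact
  interpret K: abelian_group K by fact
  have gc: "g m \<in> carrier K" if "m \<in> carrier M" for m using g(1) that by (auto simp: module_hom_def)
  have ga: "g (x \<oplus>\<^bsub>M\<^esub> y) = g x \<oplus>\<^bsub>K\<^esub> g y" if "x \<in> carrier M" "y \<in> carrier M" for x y
    using g(1) that by (auto simp: module_hom_def)
  have gr: "g (ract M x a) = ract K (g x) a" if "x \<in> carrier M" "a \<in> carrier A" for x a
    using g(1) that by (auto simp: module_hom_def)
  have cos: "N +>\<^bsub>M\<^esub> x = {m \<in> carrier M. g m = g x}" if x: "x \<in> carrier M" for x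
  proof (rule Set.set_eqI)
    fix m
    have "m \<in> N +>\<^bsub>M\<^esub> x \<longleftrightarrow> (\<exists>n\<in>N. m = n \<oplus>\<^bsub>M\<^esub> x)" by (auto simp: a_r_coset_def')
    also have "\<dots> \<longleftrightarrow> m \<in> {m \<in> carrier M. g m = g x}"
    proof
      assume "\<exists>n\<in>N. m = n \<oplus>\<^bsub>M\<^esub> x"
      then show "m \<in> {m \<in> carrier M. g m = g x}" using x ga gc by (auto simp: N)
    next
      assume m: "m \<in> {m \<in> carrier M. g m = g x}"
      have "g (m \<ominus>\<^bsub>M\<^esub> x) \<oplus>\<^bsub>K\<^esub> g x = g x"
        using m x ga[of "m \<ominus>\<^bsub>M\<^esub> x" x] by (simp add: M.minus_eq M.a_assoc M.l_neg)
      then have "g (m \<ominus>\<^bsub>M\<^esub> x) = \<zero>\<^bsub>K\<^esub>"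
        using m x gc K.add.l_cancel_one' by (metis (no_types, lifting) K.add.r_cancel_one M.minus_closed mem_Collect_eq)
      then show "\<exists>n\<in>N. m = n \<oplus>\<^bsub>M\<^esub> x"
        using m x by (intro bexI[of _ "m \<ominus>\<^bsub>M\<^esub> x"]) (auto simp: N M.minus_eq M.a_assoc M.l_neg)
    qed
    finally show "m \<in> N +>\<^bsub>M\<^esub> x \<longleftrightarrow> m \<in> {m \<in> carrier M. g m = g x}" .
  qed
  define f where "f X = g (SOME x. x \<in> X)" for X
  have fval: "f X = k" if "X \<noteq> {}" "\<And>x. x \<in> X \<Longrightarrow> g x = k" for X k
    unfolding f_def using that by (metis someI_ex ex_in_conv)
  have fc: "f (N +>\<^bsub>M\<^esub> x) = g x" if "x \<in> carrier M" for x
    by (rule fval) (use that cos[OF that] in auto)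
  have car: "carrier (quotient_module M N) = (\<lambda>x. N +>\<^bsub>M\<^esub> x) ` carrier M"
    by (auto simp: quotient_module_def A_RCOSETS_def')
  have "f \<in> module_hom A (quotient_module M N) K"
    unfolding module_hom_def
  proof (intro CollectI conjI ballI)
    show "f \<in> carrier (quotient_module M N) \<rightarrow> carrier K" unfolding car using fc gc by auto
  next
    fix X Y assume "X \<in> carrier (quotient_module M N)" "Y \<in> carrier (quotient_module M N)"
    then obtain x y where x: "x \<in> carrier M" "X = N +>\<^bsub>M\<^esub> x" and y: "y \<in> carrier M" "Y = N +>\<^bsub>M\<^esub> y"
      unfolding car by blast
    have "f (X <+>\<^bsub>M\<^esub> Y) = g x \<oplus>\<^bsub>K\<^esub> g y"
      by (rule fval) (use x y cos ga in \<open>auto simp: set_add_def'\<close>)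
    then show "f (X \<oplus>\<^bsub>quotient_module M N\<^esub> Y) = f X \<oplus>\<^bsub>K\<^esub> f Y"
      using x y fc by (simp add: quotient_module_def)
  next
    fix X a assume "X \<in> carrier (quotient_module M N)" and a: "a \<in> carrier A"
    then obtain x where x: "x \<in> carrier M" "X = N +>\<^bsub>M\<^esub> x" unfolding car by blast
    \<comment> \<open>The action on a coset is a union over its elements; \<open>g\<close> is
      constant on this nonempty union, which is all that \<open>fval\<close> asks for.\<close>
    have "f (\<Union>x\<in>X. N +>\<^bsub>M\<^esub> ract M x a) = ract K (g x) a"
    proof (rule fval)
      have "x \<in> X" using x cos by auto
      then show "(\<Union>x\<in>X. N +>\<^bsub>M\<^esub> ract M x a) \<noteq> {}" using cos act x(1) a by fastforce
    next
      fix m assume "m \<in> (\<Union>x\<in>X. N +>\<^bsub>M\<^esub> ract M x a)"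
      then obtain y where "y \<in> X" "m \<in> N +>\<^bsub>M\<^esub> ract M y a" by blast
      then show "g m = ract K (g x) a" using x cos act gr a by auto
    qed
    then show "f (ract (quotient_module M N) X a) = ract K (f X) a"
      using x fc by (simp add: quotient_module_def)
  qed
  moreover have "inj_on f (carrier (quotient_module M N))"
    unfolding car by (rule inj_onI) (use fc cos in auto)
  moreover have "f ` carrier (quotient_module M N) = carrier K"
    unfolding car image_image g(2)[symmetric] using fc by (intro image_cong) auto
  ultimately show ?thesis unfolding module_isomorphic_def bij_betw_def by blast
qed

section \<open>Quotients of path algebras\<close>

locale path_algebra_quotient =
  fixes V :: "'v set" and E :: "'v \<Rightarrow> 'v \<Rightarrow> bool" and I :: "('v list \<Rightarrow>\<^sub>0 'k::field) set"
  assumes ideal: "two_sided_ideal (path_algebra V E) I"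
begin

abbreviation C :: "('v list \<Rightarrow>\<^sub>0 'k) set" where "C \<equiv> path_span V E"
abbreviation PA :: "('v list \<Rightarrow>\<^sub>0 'k) ring" where "PA \<equiv> path_algebra V E"
abbreviation A :: "('v list \<Rightarrow>\<^sub>0 'k) set ring" where "A \<equiv> PA Quot I"
abbreviation pm :: "('v list \<Rightarrow>\<^sub>0 'k) \<Rightarrow> ('v list \<Rightarrow>\<^sub>0 'k) \<Rightarrow> ('v list \<Rightarrow>\<^sub>0 'k)" (infixl "\<star>" 70) where "pm \<equiv> path_mult"
definition cls :: "('v list \<Rightarrow>\<^sub>0 'k) \<Rightarrow> ('v list \<Rightarrow>\<^sub>0 'k) set" where "cls f = I +>\<^bsub>PA\<^esub> f"

lemma I_subset: "I \<subseteq> C"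
  using ideal unfolding two_sided_ideal_def by (metis additive_subgroup.a_subset path_algebra_simps(1))

lemma I_zero: "0 \<in> I"
  using ideal unfolding two_sided_ideal_def by (metis additive_subgroup.zero_closed path_algebra_simps(3))

lemma I_add: "f \<in> I \<Longrightarrow> g \<in> I \<Longrightarrow> f + g \<in> I"
  using ideal unfolding two_sided_ideal_def by (metis additive_subgroup.a_closed path_algebra_simps(4))

lemma I_mult: "f \<in> I \<Longrightarrow> a \<in> C \<Longrightarrow> a \<star> f \<in> I" "f \<in> I \<Longrightarrow> a \<in> C \<Longrightarrow> f \<star> a \<in> I"
  using ideal unfolding two_sided_ideal_def path_algebra_simps by blast+

lemma I_minus: assumes "f \<in> I" shows "- f \<in> I"
proof -
  have "subgroup I (add_monoid PA)"
    using ideal unfolding two_sided_ideal_def by (simp add: additive_subgroup_def)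
  then have "inv\<^bsub>add_monoid PA\<^esub> f \<in> I" using assms by (rule subgroup.m_inv_closed)
  moreover have "inv\<^bsub>add_monoid PA\<^esub> f = \<ominus>\<^bsub>PA\<^esub> f" by (simp add: a_inv_def)
  ultimately show ?thesis using assms I_subset path_algebra_a_inv[of f V E] by auto
qed

lemma I_diff: "f \<in> I \<Longrightarrow> g \<in> I \<Longrightarrow> f - g \<in> I"
  using I_add[OF _ I_minus] by force

lemma in_cls: "h \<in> cls f \<longleftrightarrow> h - f \<in> I"
proof -
  have "h \<in> cls f \<longleftrightarrow> (\<exists>i\<in>I. h = i + f)"
    unfolding cls_def a_r_coset_def' path_algebra_simps by blast
  also have "\<dots> \<longleftrightarrow> h - f \<in> I" by (metis add_diff_cancel diff_add_cancel)
  finally show ?thesis .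
qed

lemma cls_eq_iff: "cls f = cls g \<longleftrightarrow> f - g \<in> I"
proof
  assume "cls f = cls g"
  then have "f \<in> cls g" using in_cls I_zero by (metis diff_self)
  then show "f - g \<in> I" by (simp add: in_cls)
next
  assume fg: "f - g \<in> I"
  have "h - f \<in> I \<longleftrightarrow> h - g \<in> I" for h
    using I_add[OF _ fg, of "h - f"] I_diff[OF _ fg, of "h - g"] by auto
  then show "cls f = cls g" by (auto simp: in_cls)
qed

lemma carrier_A: "carrier A = cls ` C"
  by (auto simp: FactRing_def A_RCOSETS_def' path_algebra_simps cls_def)

lemma zero_A: "\<zero>\<^bsub>A\<^esub> = cls 0"
  using in_cls by (auto simp: FactRing_def)

lemma add_A: "cls f \<oplus>\<^bsub>A\<^esub> cls g = cls (f + g)"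
proof -
  have "h \<in> cls f <+>\<^bsub>PA\<^esub> cls g \<longleftrightarrow> h \<in> cls (f + g)" for h
  proof
    assume "h \<in> cls f <+>\<^bsub>PA\<^esub> cls g"
    then obtain u v where "u \<in> cls f" "v \<in> cls g" "h = u + v"
      unfolding set_add_def' path_algebra_simps by blast
    then show "h \<in> cls (f + g)" using I_add[of "u - f" "v - g"] by (simp add: in_cls algebra_simps)
  next
    assume h: "h \<in> cls (f + g)"
    have "h - g \<in> cls f" "g \<in> cls g" using h I_zero by (simp_all add: in_cls algebra_simps)
    moreover have "h = (h - g) + g" by simp
    ultimately show "h \<in> cls f <+>\<^bsub>PA\<^esub> cls g" unfolding set_add_def' path_algebra_simps by blast
  qed
  then show ?thesis by (auto simp: FactRing_def)
qed

text \<open>If \<open>u\<close>, \<open>v\<close> represent the classes of \<open>f\<close>,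
  \<open>g\<close>, then \<open>u v - f g = (u - f) v + f (v - g)\<close> lies in the ideal. The
  product of cosets, a union over representatives, is thus a single coset.\<close>

lemma mult_A:
  assumes "f \<in> C" "g \<in> C" shows "cls f \<otimes>\<^bsub>A\<^esub> cls g = cls (f \<star> g)"
proof -
  have "cls (u \<star> v) = cls (f \<star> g)" if "u \<in> cls f" "v \<in> cls g" for u v
  proof -
    have u: "u - f \<in> I" and v: "v - g \<in> I" using that in_cls by auto
    have "v \<in> C" using v I_subset path_span_add[of "v - g" V E g] assms(2) by auto
    then have "(u - f) \<star> v + f \<star> (v - g) \<in> I" using u v I_mult I_add assms(1) by blast
    then show ?thesis by (simp add: cls_eq_iff path_mult_diff)
  qed
  moreover have "f \<in> cls f" "g \<in> cls g" using in_cls I_zero by auto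
  ultimately have "(\<Union>u\<in>cls f. \<Union>v\<in>cls g. cls (u \<star> v)) = cls (f \<star> g)" by blast
  then show ?thesis by (simp add: FactRing_def rcoset_mult_def path_algebra_simps cls_def)
qed

text \<open>These are the preimages in the path algebra of the right ideals of the quotient.
  Containing \<open>I\<close> lets membership of a class be tested on any representative.\<close>

definition right_ideal :: "('v list \<Rightarrow>\<^sub>0 'k) set \<Rightarrow> bool" where
  "right_ideal X \<longleftrightarrow> I \<subseteq> X \<and> X \<subseteq> C \<and> (\<forall>f\<in>X. \<forall>g\<in>X. f + g \<in> X) \<and> (\<forall>f\<in>X. - f \<in> X) \<and>
     (\<forall>f\<in>X. \<forall>a\<in>C. f \<star> a \<in> X)"

lemma right_idealD:
  assumes "right_ideal X"
  shows "I \<subseteq> X" "X \<subseteq> C" "f \<in> X \<Longrightarrow> g \<in> X \<Longrightarrow> f + g \<in> X" "f \<in> X \<Longrightarrow> - f \<in> X"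
    "f \<in> X \<Longrightarrow> a \<in> C \<Longrightarrow> f \<star> a \<in> X" "f \<in> X \<Longrightarrow> g \<in> X \<Longrightarrow> f - g \<in> X"
proof -
  show 1: "I \<subseteq> X" "X \<subseteq> C" "f \<in> X \<Longrightarrow> g \<in> X \<Longrightarrow> f + g \<in> X" "f \<in> X \<Longrightarrow> - f \<in> X"
    "f \<in> X \<Longrightarrow> a \<in> C \<Longrightarrow> f \<star> a \<in> X" for f g a
    using assms unfolding right_ideal_def by blast+
  show "f \<in> X \<Longrightarrow> g \<in> X \<Longrightarrow> f - g \<in> X" using 1(3)[of f "- g"] 1(4)[of g] by simp
qed

lemma right_ideal_cls_iff:
  assumes "right_ideal X" shows "cls f \<in> cls ` X \<longleftrightarrow> f \<in> X"
proof
  assume "cls f \<in> cls ` X"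
  then obtain g where "g \<in> X" "f - g \<in> I" using cls_eq_iff by blast
  then show "f \<in> X" using right_idealD(1)[OF assms] right_idealD(3)[OF assms, of "f - g" g] by auto
qed (rule imageI)

lemma right_ideal_I: "right_ideal I"
  unfolding right_ideal_def by (intro conjI ballI subset_refl I_subset I_add I_minus I_mult)

text \<open>Working up to \<open>I\<close> makes this the full preimage of the right ideal generated
  by \<open>cls q\<close>, hence a \<open>right_ideal\<close>.\<close>

definition gen :: "('v list \<Rightarrow>\<^sub>0 'k) \<Rightarrow> ('v list \<Rightarrow>\<^sub>0 'k) set" where
  "gen q = {f \<in> C. \<exists>a\<in>C. f - q \<star> a \<in> I}"

lemma right_ideal_gen:
  assumes "q \<in> C" shows "right_ideal (gen q)"
  unfolding right_ideal_def
proof (intro conjI ballI)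
  show "I \<subseteq> gen q" using I_subset path_span_zero unfolding gen_def by (fastforce intro: bexI[of _ 0])
  show "gen q \<subseteq> C" by (auto simp: gen_def)
next
  fix f g assume "f \<in> gen q" "g \<in> gen q"
  then obtain a b where ab: "f \<in> C" "g \<in> C" "a \<in> C" "b \<in> C" "f - q \<star> a \<in> I" "g - q \<star> b \<in> I"
    unfolding gen_def by blast
  have "(f - q \<star> a) + (g - q \<star> b) = (f + g) - q \<star> (a + b)" by (simp add: path_mult_add_right)
  then show "f + g \<in> gen q" using ab I_add path_span_add unfolding gen_def by (metis (mono_tags, lifting) mem_Collect_eq)
next
  fix f assume "f \<in> gen q"
  then obtain a where ab: "f \<in> C" "a \<in> C" "f - q \<star> a \<in> I" unfolding gen_def by blast
  have "- (f - q \<star> a) = - f - q \<star> (- a)" by (simp add: path_mult_minus)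
  then show "- f \<in> gen q" using ab I_minus path_span_minus unfolding gen_def by (metis (mono_tags, lifting) mem_Collect_eq)
next
  fix f b assume "f \<in> gen q" and b: "b \<in> C"
  then obtain a where ab: "f \<in> C" "a \<in> C" "f - q \<star> a \<in> I" unfolding gen_def by blast
  have "(f - q \<star> a) \<star> b = f \<star> b - q \<star> (a \<star> b)"
    using path_mult_assoc[OF assms ab(2) b] by (simp add: path_mult_diff)
  then show "f \<star> b \<in> gen q" using ab b I_mult(2) path_span_mult unfolding gen_def
    by (metis (mono_tags, lifting) mem_Collect_eq)
qed

lemma gen_mult: "q \<in> C \<Longrightarrow> a \<in> C \<Longrightarrow> q \<star> a \<in> gen q"
  unfolding gen_def using path_span_mult I_zero by force

lemma cls_gen:
  assumes "q \<in> C" shows "cls ` gen q = cls q <#\<^bsub>A\<^esub> carrier A"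
proof -
  have "cls q <#\<^bsub>A\<^esub> carrier A = (\<lambda>a. cls q \<otimes>\<^bsub>A\<^esub> cls a) ` C"
    unfolding l_coset_def carrier_A by blast
  also have "\<dots> = (\<lambda>a. cls (q \<star> a)) ` C" using mult_A[OF assms] by (intro image_cong) auto
  also have "\<dots> = cls ` gen q"
    using gen_mult[OF assms] cls_eq_iff unfolding gen_def by (auto simp: image_iff)
  finally show ?thesis ..
qed

lemma gen_subset:
  assumes "right_ideal X" "q \<in> X" shows "gen q \<subseteq> X"
proof
  fix f assume "f \<in> gen q"
  then obtain a where a: "a \<in> C" "f - q \<star> a \<in> I" unfolding gen_def by blast
  then have "(f - q \<star> a) + q \<star> a \<in> X" using right_idealD(1,3,5)[OF assms(1)] assms(2) by blast
  then show "f \<in> X" by simp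
qed

definition plus_set :: "('v list \<Rightarrow>\<^sub>0 'k) set \<Rightarrow> ('v list \<Rightarrow>\<^sub>0 'k) set \<Rightarrow> ('v list \<Rightarrow>\<^sub>0 'k) set" where
  "plus_set X Y = {f + g |f g. f \<in> X \<and> g \<in> Y}"

lemma plus_setI: "f \<in> X \<Longrightarrow> g \<in> Y \<Longrightarrow> f + g \<in> plus_set X Y" by (auto simp: plus_set_def)

lemma cls_plus_set: "cls ` plus_set X Y = cls ` X <+>\<^bsub>A\<^esub> cls ` Y"
  unfolding set_add_def' plus_set_def using add_A by (auto simp: image_iff)

lemma plus_set_upper:
  assumes "right_ideal X" "right_ideal Y" shows "X \<subseteq> plus_set X Y" "Y \<subseteq> plus_set X Y"
  using right_idealD(1)[OF assms(1)] right_idealD(1)[OF assms(2)] I_zero plus_setI[of _ X 0 Y] plus_setI[of 0 X _ Y]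
  by auto

lemma right_ideal_plus:
  assumes X: "right_ideal X" and Y: "right_ideal Y" shows "right_ideal (plus_set X Y)"
  unfolding right_ideal_def
proof (intro conjI ballI)
  show "I \<subseteq> plus_set X Y" using plus_set_upper[OF assms] right_idealD(1)[OF X] by blast
  show "plus_set X Y \<subseteq> C" using right_idealD(2)[OF X] right_idealD(2)[OF Y] path_span_add
    unfolding plus_set_def by blast
next
  fix f g assume "f \<in> plus_set X Y" "g \<in> plus_set X Y"
  then obtain a b c d where f: "f = a + b" "g = c + d" "a \<in> X" "b \<in> Y" "c \<in> X" "d \<in> Y" unfolding plus_set_def by blast
  have "(a + c) + (b + d) \<in> plus_set X Y" using f right_idealD(3)[OF X] right_idealD(3)[OF Y] plus_setI by blast
  then show "f + g \<in> plus_set X Y" unfolding f by (simp add: ac_simps)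
next
  fix f assume "f \<in> plus_set X Y"
  then obtain a b where f: "f = a + b" "a \<in> X" "b \<in> Y" unfolding plus_set_def by blast
  have "(- a) + (- b) \<in> plus_set X Y" using f right_idealD(4)[OF X] right_idealD(4)[OF Y] plus_setI by blast
  then show "- f \<in> plus_set X Y" unfolding f by simp
next
  fix f c assume "f \<in> plus_set X Y" and c: "c \<in> C"
  then obtain a b where f: "f = a + b" "a \<in> X" "b \<in> Y" unfolding plus_set_def by blast
  have "a \<star> c + b \<star> c \<in> plus_set X Y" using f c right_idealD(5)[OF X] right_idealD(5)[OF Y] plus_setI by blast
  then show "f \<star> c \<in> plus_set X Y" unfolding f by (simp add: path_mult_add_left)
qed

section \<open>Modules given by right ideals that contain \<open>I\<close>\<close>

abbreviation module_of :: "('v list \<Rightarrow>\<^sub>0 'k) set \<Rightarrow> (('v list \<Rightarrow>\<^sub>0 'k) set, ('v list \<Rightarrow>\<^sub>0 'k) set) right_module" where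
  "module_of X \<equiv> right_ideal_module A (cls ` X)"

lemma module_of_simps:
  "carrier (module_of X) = cls ` X" "zero (module_of X) = cls 0" "add (module_of X) = add A"
  "ract (module_of X) = mult A" "(module_of X)\<lparr>carrier := cls ` Y\<rparr> = module_of Y"
  by (simp_all add: right_ideal_module_def regular_module_def zero_A)

lemma abelian_group_module_of:
  assumes "right_ideal X" shows "abelian_group (module_of X)"
proof (rule abelian_groupI)
  fix x assume "x \<in> carrier (module_of X)"
  then obtain f where "f \<in> X" "x = cls f" unfolding module_of_simps by blast
  then have "cls (- f) \<in> carrier (module_of X)" "cls (- f) \<oplus>\<^bsub>module_of X\<^esub> x = \<zero>\<^bsub>module_of X\<^esub>"
    using right_idealD(4)[OF assms] by (auto simp: module_of_simps add_A)
  then show "\<exists>y\<in>carrier (module_of X). y \<oplus>\<^bsub>module_of X\<^esub> x = \<zero>\<^bsub>module_of X\<^esub>" by blast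
qed (use right_idealD(3)[OF assms] right_idealD(1)[OF assms] I_zero in
      \<open>auto simp: module_of_simps add_A add_ac\<close>)

lemma submodule_module_of:
  assumes X: "right_ideal X" and Y: "right_ideal Y" and XY: "X \<subseteq> Y"
  shows "submodule A (cls ` X) (module_of Y)"
proof -
  interpret Y: abelian_group "module_of Y" by (rule abelian_group_module_of[OF Y])
  have "subgroup (cls ` X) (add_monoid (module_of Y))"
  proof (rule subgroup.intro)
    show "cls ` X \<subseteq> carrier (add_monoid (module_of Y))" using XY by (auto simp: module_of_simps)
    show "x \<otimes>\<^bsub>add_monoid (module_of Y)\<^esub> y \<in> cls ` X" if "x \<in> cls ` X" "y \<in> cls ` X" for x y
      using that right_idealD(3)[OF X] by (auto simp: module_of_simps add_A)
    show "\<one>\<^bsub>add_monoid (module_of Y)\<^esub> \<in> cls ` X"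
      using right_idealD(1)[OF X] I_zero by (auto simp: module_of_simps)
    show "inv\<^bsub>add_monoid (module_of Y)\<^esub> x \<in> cls ` X" if x: "x \<in> cls ` X" for x
    proof -
      obtain f where f: "f \<in> X" "x = cls f" using x by blast
      have m: "- f \<in> X" using right_idealD(4)[OF X] f by blast
      have "\<ominus>\<^bsub>module_of Y\<^esub> x = cls (- f)"
        by (rule Y.minus_equality) (use f m XY in \<open>auto simp: module_of_simps add_A\<close>)
      then show ?thesis using m by (simp add: a_inv_def)
    qed
  qed
  moreover have "ract (module_of Y) x a \<in> cls ` X" if "x \<in> cls ` X" "a \<in> carrier A" for x a
    using that right_idealD(2,5)[OF X] mult_A unfolding carrier_A module_of_simps by auto
  ultimately show ?thesis unfolding submodule_def additive_subgroup_def by blast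
qed

abbreviation lmul :: "('v list \<Rightarrow>\<^sub>0 'k) \<Rightarrow> ('v list \<Rightarrow>\<^sub>0 'k) set \<Rightarrow> ('v list \<Rightarrow>\<^sub>0 'k) set" where
  "lmul u \<equiv> (\<lambda>m. cls u \<otimes>\<^bsub>A\<^esub> m)"

lemma left_mult_hom:
  assumes X: "right_ideal X" and Y: "right_ideal Y" and u: "u \<in> C" and uX: "\<And>f. f \<in> X \<Longrightarrow> u \<star> f \<in> Y"
  shows "lmul u \<in> module_hom A (module_of X) (module_of Y)"
proof -
  have XC: "f \<in> C" if "f \<in> X" for f using right_idealD(2)[OF X] that by blast
  show ?thesis
    unfolding module_hom_def module_of_simps carrier_A
    using XC u uX by (auto simp: mult_A add_A path_mult_add_right path_mult_assoc path_span_add path_span_mult)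
qed

text \<open>A generator \<open>q\<close> congruent to \<open>u f0\<close> is enough: multiples of
  \<open>q\<close> then agree modulo \<open>I\<close> with images of multiples of
  \<open>f0\<close>.\<close>

lemma left_mult_image:
  assumes X: "right_ideal X" and u: "u \<in> C" and uX: "\<And>f. f \<in> X \<Longrightarrow> u \<star> f \<in> gen q"
    and q: "q \<in> C" "f0 \<in> X" "q - u \<star> f0 \<in> I"
  shows "lmul u ` cls ` X = cls ` gen q"
proof -
  have XC: "f \<in> C" if "f \<in> X" for f using right_idealD(2)[OF X] that by blast
  have 1: "lmul u ` cls ` X = (\<lambda>f. cls (u \<star> f)) ` X"
    unfolding image_image using XC u mult_A by (intro image_cong) auto
  show ?thesis
    unfolding 1
  proof (intro subset_antisym subsetI)
    fix x assume "x \<in> cls ` gen q"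
    then obtain a where a: "a \<in> C" "x = cls (q \<star> a)" unfolding gen_def using cls_eq_iff by auto
    have "(q - u \<star> f0) \<star> a \<in> I" using q a I_mult by blast
    then have "x = cls (u \<star> (f0 \<star> a))"
      using path_mult_assoc[OF u XC[OF q(2)] a(1)] by (simp add: a cls_eq_iff path_mult_diff)
    then show "x \<in> (\<lambda>f. cls (u \<star> f)) ` X" using right_idealD(5)[OF X q(2) a(1)] by blast
  qed (use uX in auto)
qed

text \<open>All conditions concern representatives in the path algebra; in this form each filtration
  quotient is identified with a rhombus module.\<close>

lemma quotient_isomorphic_gen:
  assumes X: "right_ideal X" and u: "u \<in> C" and uX: "\<And>f. f \<in> X \<Longrightarrow> u \<star> f \<in> gen q"
    and q: "q \<in> C" "f0 \<in> X" "q - u \<star> f0 \<in> I" and ker: "\<And>f. f \<in> X \<Longrightarrow> u \<star> f \<in> I \<longleftrightarrow> f \<in> Y" and YX: "Y \<subseteq> X"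
  shows "module_isomorphic A (quotient_module (module_of X) (cls ` Y)) (module_of (gen q))"
proof (rule first_isomorphism)
  have XC: "f \<in> C" if "f \<in> X" for f using right_idealD(2)[OF X] that by blast
  show "abelian_group (module_of X)" "abelian_group (module_of (gen q))"
    using abelian_group_module_of X right_ideal_gen q(1) by blast+
  show "lmul u \<in> module_hom A (module_of X) (module_of (gen q))"
    using left_mult_hom[OF X right_ideal_gen[OF q(1)] u uX] .
  show "lmul u ` carrier (module_of X) = carrier (module_of (gen q))"
    unfolding module_of_simps using left_mult_image[OF X u uX q] .
  show "ract (module_of X) x a \<in> carrier (module_of X)" if "x \<in> carrier (module_of X)" "a \<in> carrier A" for x a
    using that right_idealD(5)[OF X] XC unfolding carrier_A module_of_simps by (auto simp: mult_A)
  have "cls u \<otimes>\<^bsub>A\<^esub> cls f = cls 0 \<longleftrightarrow> f \<in> Y" if "f \<in> X" for f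
    using ker[OF that] mult_A[OF u XC[OF that]] by (simp add: cls_eq_iff)
  then show "cls ` Y = {m \<in> carrier (module_of X). cls u \<otimes>\<^bsub>A\<^esub> m = \<zero>\<^bsub>module_of (gen q)\<^esub>}"
    using YX unfolding module_of_simps by auto
qed

lemma short_exact_gen:
  assumes X: "right_ideal X" and u: "u \<in> C" and uX: "\<And>f. f \<in> X \<Longrightarrow> u \<star> f \<in> gen q"
    and q: "q \<in> C" "f0 \<in> X" "q - u \<star> f0 \<in> I" and ker: "\<And>f. f \<in> X \<Longrightarrow> u \<star> f \<in> I \<longleftrightarrow> f \<in> Y" and YX: "Y \<subseteq> X"
  shows "short_exact A (module_of Y) (module_of X) (module_of (gen q)) (\<lambda>m. m) (lmul u)"
proof -
  have XC: "f \<in> C" if "f \<in> X" for f using right_idealD(2)[OF X] that by blast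
  have k: "cls u \<otimes>\<^bsub>A\<^esub> cls f = cls 0 \<longleftrightarrow> f \<in> Y" if "f \<in> X" for f
    using ker[OF that] mult_A[OF u XC[OF that]] by (simp add: cls_eq_iff)
  then have "cls ` Y = a_kernel (module_of X) (module_of (gen q)) (lmul u)"
    using YX unfolding a_kernel_def' module_of_simps by auto
  moreover have "(\<lambda>m. m) \<in> module_hom A (module_of Y) (module_of X)"
    using YX unfolding module_hom_def module_of_simps by auto
  moreover have "inj_on (\<lambda>m. m) (carrier (module_of Y))"
    "(\<lambda>m. m) ` carrier (module_of Y) = cls ` Y" by (simp_all add: module_of_simps)
  moreover have "lmul u ` carrier (module_of X) = carrier (module_of (gen q))"
    unfolding module_of_simps using left_mult_image[OF X u uX q] .
  ultimately show ?thesis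
    unfolding short_exact_def using left_mult_hom[OF X right_ideal_gen[OF q(1)] u uX] by metis
qed

end

section \<open>The discrete plane carrying the tiling\<close>

text \<open>\<open>x^3 + x^2 + x - 1\<close> is the characteristic polynomial of
  \<open>Rauzy_matrix\<close>. An interval of length 0.0001 around its root is narrow enough for
  linear arithmetic to settle the later comparisons of heights.\<close>

lemma ex_alpha: "\<exists>a::real. 0.5436 < a \<and> a < 0.5437 \<and> a ^ 3 + a ^ 2 + a = 1"
proof -
  have "\<exists>x\<ge>0.5436. x \<le> (0.5437::real) \<and> x ^ 3 + x ^ 2 + x = 1"
    by (rule IVT') (auto simp: power3_eq_cube power2_eq_square intro!: continuous_intros)
  then obtain x :: real where x: "x \<ge> 0.5436" "x \<le> 0.5437" "x ^ 3 + x ^ 2 + x = 1" by blast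
  have "(0.5436::real) ^ 3 + 0.5436 ^ 2 + 0.5436 \<noteq> 1" "(0.5437::real) ^ 3 + 0.5437 ^ 2 + 0.5437 \<noteq> 1"
    by (simp_all add: power3_eq_cube power2_eq_square)
  then have "x \<noteq> 0.5436" "x \<noteq> 0.5437" using x(3) by metis+
  with x show ?thesis by (intro exI[of _ x]) auto
qed

definition alpha :: real where
  "alpha = (SOME a. 0.5436 < a \<and> a < 0.5437 \<and> a ^ 3 + a ^ 2 + a = 1)"

lemma alpha_bounds: "0.5436 < alpha" "alpha < 0.5437"
  and alpha_cubed: "alpha ^ 3 = 1 - alpha - alpha\<^sup>2"
  using someI_ex[OF ex_alpha] unfolding alpha_def[symmetric] by auto

lemma alpha_sq_bounds: "0.2955 < alpha\<^sup>2" "alpha\<^sup>2 < 0.2957"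
proof -
  have "0.5436\<^sup>2 < alpha\<^sup>2" "alpha\<^sup>2 < 0.5437\<^sup>2"
    using alpha_bounds by (auto intro!: power_strict_mono)
  then show "0.2955 < alpha\<^sup>2" "alpha\<^sup>2 < 0.2957" by (auto simp: power2_eq_square)
qed

definition len :: "3 \<Rightarrow> real" where
  "len a = (if a = 1 then 1 else if a = 2 then alpha + alpha\<^sup>2 else alpha)"

lemma len_simps [simp]: "len 1 = 1" "len 2 = alpha + alpha\<^sup>2" "len 3 = alpha"
  by (auto simp: len_def)

lemma len_pos: "0 < len a"
  using alpha_bounds alpha_sq_bounds exhaust_3[of a] by auto

definition ht :: "int^3 \<Rightarrow> real" where
  "ht w = of_int (w $ 1) * len 1 + of_int (w $ 2) * len 2 + of_int (w $ 3) * len 3"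

definition surface :: "((int^3) \<times> 3) set" where
  "surface = {(w, k). 0 \<le> ht w \<and> ht w < len k}"

lemma ht_add: "ht (v + w) = ht v + ht w" and ht_diff: "ht (v - w) = ht v - ht w"
  by (auto simp: ht_def algebra_simps)

lemma Rauzy_matrix_mult: "Rauzy_matrix *v w = vector [w $ 2, w $ 3, w $ 1 - w $ 2 - w $ 3]"
  by (simp add: Rauzy_matrix_def matrix_vector_mult_def vec_eq_iff forall_3 sum_3)

lemma Rauzy_matrix_column:
  "column 2 Rauzy_matrix = vector [1, 0, -1]" "column 3 Rauzy_matrix = vector [0, 1, -1]"
  by (simp_all add: Rauzy_matrix_def column_def vec_eq_iff forall_3)

text \<open>The cube of \<open>alpha\<close> arises only from the second coordinate and is removed
  by the cubic equation.\<close>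

lemma ht_Rauzy_matrix: "ht (Rauzy_matrix *v w) = alpha * ht w"
proof -
  have "alpha * (alpha * alpha) = 1 - alpha - alpha * alpha"
    using alpha_cubed by (simp add: power3_eq_cube power2_eq_square)
  then have "of_int (w $ 2) * (alpha * (alpha * alpha)) = of_int (w $ 2) * (1 - alpha - alpha * alpha)"
    by simp
  then show ?thesis
    unfolding ht_def Rauzy_matrix_mult by (simp add: power2_eq_square algebra_simps)
qed

lemma inflate_cases:
  assumes "(w', k') \<in> inflate (w, k)"
  obtains "k = 1" "k' = 3" "w' = Rauzy_matrix *v w"
  | "k = 1" "k' = 1" "w' = Rauzy_matrix *v w + vector [1, 0, -1]"
  | "k = 1" "k' = 2" "w' = Rauzy_matrix *v w + vector [0, 1, -1]"
  | "k = 2" "k' = 1" "w' = Rauzy_matrix *v w"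
  | "k = 3" "k' = 2" "w' = Rauzy_matrix *v w"
  using assms exhaust_3[of k]
  by (auto simp: inflate_def Let_def Rauzy_matrix_column split: if_splits)

lemma inflate_intros:
  "(Rauzy_matrix *v w, 3) \<in> inflate (w, 1)"
  "(Rauzy_matrix *v w + vector [1, 0, -1], 1) \<in> inflate (w, 1)"
  "(Rauzy_matrix *v w + vector [0, 1, -1], 2) \<in> inflate (w, 1)"
  "(Rauzy_matrix *v w, 1) \<in> inflate (w, 2)"
  "(Rauzy_matrix *v w, 2) \<in> inflate (w, 3)"
  by (auto simp: inflate_def Let_def Rauzy_matrix_column)

text \<open>The bounds \<open>alpha\<close>, \<open>1 - alpha\<close> and \<open>alpha^2\<close> are
  \<open>alpha\<close> times the lengths of types 1, 2 and 3, hence the ends of the scaled height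
  intervals of parents.\<close>

lemma alpha_times:
  "alpha * x < alpha \<longleftrightarrow> x < 1"
  "alpha * x < 1 - alpha \<longleftrightarrow> x < alpha + alpha\<^sup>2"
  "alpha * x < alpha\<^sup>2 \<longleftrightarrow> x < alpha"
  "0 \<le> alpha * x \<longleftrightarrow> 0 \<le> x"
proof -
  have p: "alpha > 0" using alpha_bounds by auto
  have e: "1 - alpha = alpha * (alpha + alpha\<^sup>2)" "alpha\<^sup>2 = alpha * alpha"
    using alpha_cubed by (simp_all add: power3_eq_cube power2_eq_square algebra_simps)
  show "alpha * x < alpha \<longleftrightarrow> x < 1"
    "alpha * x < alpha\<^sup>2 \<longleftrightarrow> x < alpha"
    "0 \<le> alpha * x \<longleftrightarrow> 0 \<le> x"
    using p unfolding e(2) by (auto simp: mult_less_cancel_left zero_le_mult_iff)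
  show "alpha * x < 1 - alpha \<longleftrightarrow> x < alpha + alpha\<^sup>2"
    using p unfolding e(1) by (auto simp: mult_less_cancel_left)
qed

lemma ht_offsets: "ht (vector [1, 0, -1]) = 1 - alpha" "ht (vector [0, 1, -1]) = alpha\<^sup>2"
  by (auto simp: ht_def)

lemma inflate_surface:
  assumes "t \<in> surface" "t' \<in> inflate t" shows "t' \<in> surface"
proof -
  obtain w k w' k' where [simp]: "t = (w, k)" "t' = (w', k')" by fastforce
  have "(w', k') \<in> inflate (w, k)" using assms by simp
  then show ?thesis using assms(1) alpha_times[of "ht w"] alpha_bounds alpha_sq_bounds
    by (cases rule: inflate_cases) (auto simp: surface_def ht_add ht_offsets ht_Rauzy_matrix)
qed

text \<open>The matrix has determinant 1; the witness is its integral inverse applied to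
  \<open>w\<close>.\<close>

lemma Rauzy_matrix_surj: "\<exists>v. w = Rauzy_matrix *v v"
proof
  show "w = Rauzy_matrix *v vector [w $ 1 + w $ 2 + w $ 3, w $ 1, w $ 2]"
    by (simp add: Rauzy_matrix_mult vec_eq_iff forall_3)
qed

text \<open>The scaled intervals of the parents, shifted by the heights of the offsets, partition
  the interval of each type. Type 1 splits at \<open>1 - alpha\<close> into children of types 2 and
  1, type 2 splits at \<open>alpha^2\<close> into children of types 3 and 1, and type 3 consists of
  children of type 1.\<close>

lemma surface_parent:
  assumes "t \<in> surface" shows "\<exists>t0 \<in> surface. t \<in> inflate t0"
proof -
  obtain w k where t: "t = (w, k)" by fastforce
  obtain v where v: "w = Rauzy_matrix *v v" using Rauzy_matrix_surj by blast
  obtain v1 where v1: "w - vector [1, 0, -1] = Rauzy_matrix *v v1" using Rauzy_matrix_surj by blast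
  obtain v2 where v2: "w - vector [0, 1, -1] = Rauzy_matrix *v v2" using Rauzy_matrix_surj by blast
  have w1: "w = Rauzy_matrix *v v1 + vector [1, 0, -1]" and w2: "w = Rauzy_matrix *v v2 + vector [0, 1, -1]"
    using v1 v2 by (simp_all add: algebra_simps)
  have h: "ht w = alpha * ht v" "ht w = alpha * ht v1 + (1 - alpha)" "ht w = alpha * ht v2 + alpha\<^sup>2"
    using v arg_cong[OF w1, of ht] arg_cong[OF w2, of ht]
    by (simp_all add: ht_add ht_Rauzy_matrix ht_offsets del: vector_add_component)
  have r: "0 \<le> ht w" "ht w < len k" using assms t by (auto simp: surface_def)
  consider "k = 1" "ht w < 1 - alpha" | "k = 1" "ht w \<ge> 1 - alpha" | "k = 2" "ht w < alpha\<^sup>2"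
    | "k = 2" "ht w \<ge> alpha\<^sup>2" | "k = 3" using exhaust_3[of k] by fastforce
  then show ?thesis
  proof cases
    case 1 then show ?thesis using r h(1) alpha_times[of "ht v"] inflate_intros(4)[of v]
      by (intro bexI[of _ "(v, 2)"]) (auto simp: surface_def t v)
  next
    case 2
    then have "ht w < 1" using r by simp
    then have "0 \<le> ht v1 \<and> ht v1 < 1"
      using 2(2) h(2) alpha_times(1,4)[of "ht v1"] by linarith
    then show ?thesis using 2 inflate_intros(2)[of v1] w1
      by (intro bexI[of _ "(v1, 1)"]) (auto simp: surface_def t)
  next
    case 3 then show ?thesis using r h(1) alpha_times[of "ht v"] inflate_intros(5)[of v]
      by (intro bexI[of _ "(v, 3)"]) (auto simp: surface_def t v)
  next
    case 4
    then have "ht w < alpha + alpha\<^sup>2" using r by simp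
    then have "0 \<le> ht v2 \<and> ht v2 < 1"
      using 4(2) h(3) alpha_times(1,4)[of "ht v2"] by linarith
    then show ?thesis using 4 inflate_intros(3)[of v2] w2
      by (intro bexI[of _ "(v2, 1)"]) (auto simp: surface_def t)
  next
    case 5
    then have "ht w < alpha" using r by simp
    then have "0 \<le> ht v \<and> ht v < 1"
      using r h(1) alpha_times(1,4)[of "ht v"] by linarith
    then show ?thesis using 5 inflate_intros(1)[of v]
      by (intro bexI[of _ "(v, 1)"]) (auto simp: surface_def t v)
  qed
qed

lemma patch_surface: "patch i \<subseteq> surface"
proof (induction i)
  case 0 show ?case using len_pos by (auto simp: surface_def ht_def simp del: len_simps)
next
  case (Suc i) then show ?case using inflate_surface by fastforce
qed

text \<open>Either the two tiles share a corner, or they are of type 1 and in one of the two further relative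
  positions that occur for the parents of tiles sharing a corner.\<close>

definition near :: "(int^3) \<times> 3 \<Rightarrow> (int^3) \<times> 3 \<Rightarrow> bool" where
  "near = (\<lambda>(w, k) (w', k').
     let d = w' - w in
     (\<forall>a. \<bar>d $ a\<bar> \<le> 1) \<and>
     (d $ k \<le> 0 \<and> 0 \<le> d $ k' \<or>
      k = 1 \<and> k' = 1 \<and> (d = vector [1, -1, 1] \<or> d = vector [-1, 1, -1])))"

lemma near_components:
  "near (w, k) (w', k') \<longleftrightarrow>
     (w' - w) $ 1 \<in> {-1, 0, 1} \<and> (w' - w) $ 2 \<in> {-1, 0, 1} \<and> (w' - w) $ 3 \<in> {-1, 0, 1} \<and>
     ((w' - w) $ k \<le> 0 \<and> 0 \<le> (w' - w) $ k' \<or>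
      k = 1 \<and> k' = 1 \<and> ((w' - w) $ 1 = 1 \<and> (w' - w) $ 2 = -1 \<and> (w' - w) $ 3 = 1 \<or>
        (w' - w) $ 1 = -1 \<and> (w' - w) $ 2 = 1 \<and> (w' - w) $ 3 = -1))"
proof -
  have *: "\<bar>x\<bar> \<le> 1 \<longleftrightarrow> x \<in> {-1, 0, 1}" for x :: int by auto
  show ?thesis unfolding near_def Let_def split * forall_3 vec_eq_iff by simp
qed

text \<open>The quintuples consist of the type of a tile, the type of one of the tiles replacing it, and the offset of
  the latter; \<open>(X, Y, Z)\<close> is the relative position of two such tiles and \<open>(x, y, z)\<close> that of their parents.\<close>

lemma near_parent_aux:
  fixes X Y Z x y z e1 e2 e3 f1 f2 f3 :: int and k l k' l' :: 3
  assumes "(k, l, e1, e2, e3) \<in> {(1, 3, 0, 0, 0), (1, 1, 1, 0, -1), (1, 2, 0, 1, -1), (2, 1, 0, 0, 0), (3, 2, 0, 0, 0)}"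
    and "(k', l', f1, f2, f3) \<in> {(1, 3, 0, 0, 0), (1, 1, 1, 0, -1), (1, 2, 0, 1, -1), (2, 1, 0, 0, 0), (3, 2, 0, 0, 0)}"
    and "Y \<in> {-1, 0, 1}" "Z \<in> {-1, 0, 1}" "X \<in> {-1, 0, 1}"
    and "(if l = 1 then X else if l = 2 then Y else Z) \<le> 0 \<and> 0 \<le> (if l' = 1 then X else if l' = 2 then Y else Z) \<or>
         l = 1 \<and> l' = 1 \<and> (X = 1 \<and> Y = -1 \<and> Z = 1 \<or> X = -1 \<and> Y = 1 \<and> Z = -1)"
    and "x = X + Y + Z + e1 + e2 + e3 - f1 - f2 - f3" "y = X + e1 - f1" "z = Y + e2 - f2"
    and "- len k < of_int x + of_int y * (alpha + alpha\<^sup>2) + of_int z * alpha"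
      "of_int x + of_int y * (alpha + alpha\<^sup>2) + of_int z * alpha < len k'"
  shows "x \<in> {-1, 0, 1} \<and> y \<in> {-1, 0, 1} \<and> z \<in> {-1, 0, 1} \<and>
    ((if k = 1 then x else if k = 2 then y else z) \<le> 0 \<and> 0 \<le> (if k' = 1 then x else if k' = 2 then y else z) \<or>
      k = 1 \<and> k' = 1 \<and> (x = 1 \<and> y = -1 \<and> z = 1 \<or> x = -1 \<and> y = 1 \<and> z = -1))"
proof -
  note b = alpha_bounds alpha_sq_bounds
  have "k = 1 \<and> l = 3 \<and> e1 = 0 \<and> e2 = 0 \<and> e3 = 0 \<or>
      k = 1 \<and> l = 1 \<and> e1 = 1 \<and> e2 = 0 \<and> e3 = -1 \<or>
      k = 1 \<and> l = 2 \<and> e1 = 0 \<and> e2 = 1 \<and> e3 = -1 \<or>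
      k = 2 \<and> l = 1 \<and> e1 = 0 \<and> e2 = 0 \<and> e3 = 0 \<or>
      k = 3 \<and> l = 2 \<and> e1 = 0 \<and> e2 = 0 \<and> e3 = 0"
    using assms(1) by simp
  moreover have "k' = 1 \<and> l' = 3 \<and> f1 = 0 \<and> f2 = 0 \<and> f3 = 0 \<or>
      k' = 1 \<and> l' = 1 \<and> f1 = 1 \<and> f2 = 0 \<and> f3 = -1 \<or>
      k' = 1 \<and> l' = 2 \<and> f1 = 0 \<and> f2 = 1 \<and> f3 = -1 \<or>
      k' = 2 \<and> l' = 1 \<and> f1 = 0 \<and> f2 = 0 \<and> f3 = 0 \<or>
      k' = 3 \<and> l' = 2 \<and> f1 = 0 \<and> f2 = 0 \<and> f3 = 0"
    using assms(2) by simp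
  ultimately show ?thesis
    \<comment> \<open>In each of the 25 * 27 cases either the nearness condition fails, or the
      conclusion can be read off, or the height bounds for the parents are contradictory.\<close>
    using assms(3-5)
    by (elim disjE conjE insertE emptyE; hypsubst)
      (use assms(6-9) in \<open>simp; fail\<close> | rule FalseE, use assms(7-11) b in \<open>simp; linarith\<close>)+
qed

lemma near_parent:
  assumes "(w, k) \<in> surface" "(w', k') \<in> surface"
    and "(v, l) \<in> inflate (w, k)" "(v', l') \<in> inflate (w', k')" "near (v, l) (v', l')"
  shows "near (w, k) (w', k')"
proof -
  define x y z where "x = (w' - w) $ 1" and "y = (w' - w) $ 2" and "z = (w' - w) $ 3"
  have h: "ht w' = ht w + (of_int x + of_int y * (alpha + alpha\<^sup>2) + of_int z * alpha)"
    unfolding x_def y_def z_def by (simp add: ht_def algebra_simps)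
  have r: "0 \<le> ht w" "ht w < len k" "0 \<le> ht w'" "ht w' < len k'"
    using assms by (auto simp: surface_def)
  note b = alpha_bounds alpha_sq_bounds
  have d1: "(Rauzy_matrix *v w') $ 1 - (Rauzy_matrix *v w) $ 1 = y"
    and d2: "(Rauzy_matrix *v w') $ 2 - (Rauzy_matrix *v w) $ 2 = z"
    and d3: "(Rauzy_matrix *v w') $ 3 - (Rauzy_matrix *v w) $ 3 = x - y - z"
    by (simp_all add: Rauzy_matrix_mult x_def y_def z_def)
  have P: "(k, l, (v - Rauzy_matrix *v w) $ 1, (v - Rauzy_matrix *v w) $ 2, (v - Rauzy_matrix *v w) $ 3)
      \<in> {(1, 3, 0, 0, 0), (1, 1, 1, 0, -1), (1, 2, 0, 1, -1), (2, 1, 0, 0, 0), (3, 2, 0, 0, 0)}"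
    if "(v, l) \<in> inflate (w, k)" for v l w k
    using that by (cases rule: inflate_cases) auto
  obtain e1 e2 e3 where e: "(v - Rauzy_matrix *v w) $ 1 = e1" "(v - Rauzy_matrix *v w) $ 2 = e2"
    "(v - Rauzy_matrix *v w) $ 3 = e3" by blast
  obtain f1 f2 f3 where f: "(v' - Rauzy_matrix *v w') $ 1 = f1" "(v' - Rauzy_matrix *v w') $ 2 = f2"
    "(v' - Rauzy_matrix *v w') $ 3 = f3" by blast
  have pe: "(k, l, e1, e2, e3) \<in> {(1, 3, 0, 0, 0), (1, 1, 1, 0, -1), (1, 2, 0, 1, -1), (2, 1, 0, 0, 0), (3, 2, 0, 0, 0)}"
    using P[OF assms(3)] unfolding e .
  have pf: "(k', l', f1, f2, f3) \<in> {(1, 3, 0, 0, 0), (1, 1, 1, 0, -1), (1, 2, 0, 1, -1), (2, 1, 0, 0, 0), (3, 2, 0, 0, 0)}"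
    using P[OF assms(4)] unfolding f .
  have g: "(v' - v) $ 1 = y + f1 - e1" "(v' - v) $ 2 = z + f2 - e2" "(v' - v) $ 3 = x - y - z + f3 - e3"
    using e f d1 d2 d3 by simp_all
  have ne: "near (v, l) (v', l')" by fact
  have xl: "(w' - w) $ l = (if l = 1 then x else if l = 2 then y else z)" for l
    using exhaust_3[of l] by (auto simp: x_def y_def z_def)
  \<comment> \<open>The inverse of the Rauzy matrix expresses the offset of the parents through that
    of the children.\<close>
  have i: "x = (v' - v) $ 1 + (v' - v) $ 2 + (v' - v) $ 3 + e1 + e2 + e3 - f1 - f2 - f3"
    "y = (v' - v) $ 1 + e1 - f1" "z = (v' - v) $ 2 + e2 - f2"
    unfolding g by simp_all
  have vl: "(v' - v) $ l = (if l = 1 then (v' - v) $ 1 else if l = 2 then (v' - v) $ 2 else (v' - v) $ 3)" for l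
    using exhaust_3[of l] by auto
  have lo: "- len k < of_int x + of_int y * (alpha + alpha\<^sup>2) + of_int z * alpha"
      "of_int x + of_int y * (alpha + alpha\<^sup>2) + of_int z * alpha < len k'"
    using h r by linarith+
  note n = ne[unfolded near_components vl[of l] vl[of l']]
  show ?thesis
    unfolding near_components xl[of k] xl[of k'] x_def[symmetric] y_def[symmetric] z_def[symmetric]
    by (rule near_parent_aux[OF pe pf _ _ _ _ i lo]) (use n in blast)+
qed


lemma inflate_Rauzy_tiles:
  assumes "t \<in> Rauzy_tiles" "t' \<in> inflate t" shows "t' \<in> Rauzy_tiles"
proof -
  obtain i where "t \<in> patch i" using assms(1) by (auto simp: Rauzy_tiles_def)
  then have "t' \<in> patch (Suc i)" using assms(2) by auto
  then show ?thesis unfolding Rauzy_tiles_def by blast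
qed

lemma Rauzy_tiles_surface: "Rauzy_tiles \<subseteq> surface"
  using patch_surface by (auto simp: Rauzy_tiles_def)

text \<open>Finitely many relative positions remain. Those compatible with the height bounds are
  reached from the three initial tiles within four inflations.\<close>

lemma near_origin:
  assumes "near (0, l) (w, k)" "(w, k) \<in> surface" shows "(w, k) \<in> Rauzy_tiles"
proof -
  have v: "w = vector [x, y, z] \<longleftrightarrow> w $ 1 = x \<and> w $ 2 = y \<and> w $ 3 = z" for x y z
    by (simp add: vec_eq_iff forall_3)
  have z: "(0 :: int^3) = vector [0, 0, 0]" by (simp add: vec_eq_iff forall_3)
  have *: "(vector [y, z, x - y - z], 3) \<in> Rauzy_tiles"
    "(vector [y + 1, z, x - y - z - 1], 1) \<in> Rauzy_tiles"
    "(vector [y, z + 1, x - y - z - 1], 2) \<in> Rauzy_tiles"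
    if "(vector [x, y, z], 1) \<in> Rauzy_tiles" for x y z :: int
  proof -
    have "vector [y, z, x - y - z] + vector [1, 0, - 1] = (vector [y + 1, z, x - y - z - 1] :: int^3)"
      "vector [y, z, x - y - z] + vector [0, 1, - 1] = (vector [y, z + 1, x - y - z - 1] :: int^3)"
      by (simp_all add: vec_eq_iff forall_3)
    then show "(vector [y, z, x - y - z], 3) \<in> Rauzy_tiles"
      "(vector [y + 1, z, x - y - z - 1], 1) \<in> Rauzy_tiles"
      "(vector [y, z + 1, x - y - z - 1], 2) \<in> Rauzy_tiles"
      using that[THEN inflate_Rauzy_tiles, OF inflate_intros(1)]
        that[THEN inflate_Rauzy_tiles, OF inflate_intros(2)]
        that[THEN inflate_Rauzy_tiles, OF inflate_intros(3)]
      by (simp_all add: Rauzy_matrix_mult)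
  qed
  have **: "(vector [y, z, x - y - z], 1) \<in> Rauzy_tiles"
    if "(vector [x, y, z], 2) \<in> Rauzy_tiles" for x y z :: int
    using inflate_Rauzy_tiles[OF that inflate_intros(4)] by (simp add: Rauzy_matrix_mult)
  have "\<And>k. k \<in> {1, 2, 3} \<Longrightarrow> (0, k) \<in> patch 0" by auto
  then have t0: "(vector [0, 0, 0], 1) \<in> Rauzy_tiles" "(vector [0, 0, 0], 2) \<in> Rauzy_tiles"
    "(vector [0, 0, 0], 3) \<in> Rauzy_tiles"
    unfolding Rauzy_tiles_def z[symmetric] by (metis UNIV_I UN_I insertCI)+
  have t1: "(vector [1, 0, -1], 1) \<in> Rauzy_tiles" "(vector [0, 1, -1], 2) \<in> Rauzy_tiles"
    using *[OF t0(1)] by simp_all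
  have t2: "(vector [1, -1, 1], 1) \<in> Rauzy_tiles" "(vector [0, 0, 1], 2) \<in> Rauzy_tiles"
    using *[OF t1(1)] by simp_all
  have t3: "(vector [1, -1, 0], 1) \<in> Rauzy_tiles" "(vector [0, 1, -1], 1) \<in> Rauzy_tiles"
    using **[OF t1(2)] **[OF t2(2)] by simp_all
  have t4: "(vector [0, 1, 0], 1) \<in> Rauzy_tiles" "(vector [-1, 1, 1], 3) \<in> Rauzy_tiles"
    using *[OF t2(1)] by simp_all
  have t5: "(vector [0, 0, 1], 1) \<in> Rauzy_tiles" "(vector [-1, 1, 1], 2) \<in> Rauzy_tiles"
    using *[OF t3(1)] by simp_all
  have t6: "(vector [1, -1, 0], 3) \<in> Rauzy_tiles" "(vector [1, 0, -1], 2) \<in> Rauzy_tiles"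
    using *[OF t3(2)] by simp_all
  have r: "0 \<le> of_int (w $ 1) + of_int (w $ 2) * (alpha + alpha\<^sup>2) + of_int (w $ 3) * alpha"
    "of_int (w $ 1) + of_int (w $ 2) * (alpha + alpha\<^sup>2) + of_int (w $ 3) * alpha < len k"
    using assms(2) by (auto simp: surface_def ht_def)
  note b = alpha_bounds alpha_sq_bounds
  note n = assms(1)[unfolded near_components diff_zero]
  have d: "w $ 1 \<in> {-1, 0, 1}" "w $ 2 \<in> {-1, 0, 1}" "w $ 3 \<in> {-1, 0, 1}" using n by simp_all
  have "0 \<le> w $ k \<or> k = 1 \<and> (w = vector [1, -1, 1] \<or> w = vector [-1, 1, -1])"
    using n unfolding v by auto
  then consider "0 \<le> w $ k" | "k = 1" "w = vector [1, -1, 1]"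
    | "k = 1" "w $ 1 = -1" "w $ 2 = 1" "w $ 3 = -1"
    by fastforce
  then show ?thesis
  proof cases
    case 1
    have "w = vector [w $ 1, w $ 2, w $ 3]" by (simp add: vec_eq_iff forall_3)
    moreover have "k = 1 \<or> k = 2 \<or> k = 3" by (rule exhaust_3)
    ultimately show ?thesis using d
      by (elim insertE emptyE disjE; hypsubst)
       (simp, (use t0 t1 t2 t3 t4 t5 t6 in metis)?,
        (rule FalseE, use r b 1 in \<open>simp; linarith\<close>)?)+
  next
    case 2 then show ?thesis using t2 by simp
  next
    \<comment> \<open>This position has height \<open>alpha^2 - 1\<close>, which is
      negative.\<close>
    case 3 then show ?thesis using r b by simp
  qed
qed

text \<open>Tracing both tiles back through their parents keeps them near each other until the first
  one reaches the initial patch, where \<open>near_origin\<close> applies; inflating again recovers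
  the second.\<close>

lemma near_Rauzy_tiles:
  assumes "t \<in> Rauzy_tiles" "t' \<in> surface" "near t t'" shows "t' \<in> Rauzy_tiles"
proof -
  have "t' \<in> Rauzy_tiles" if "t \<in> patch i" "t' \<in> surface" "near t t'" for i t t'
    using that
  proof (induction i arbitrary: t t')
    case 0
    then show ?case using near_origin by (cases t') auto
  next
    case (Suc i)
    obtain t0 where t0: "t0 \<in> patch i" "t \<in> inflate t0" using Suc.prems by auto
    obtain t0' where t0': "t0' \<in> surface" "t' \<in> inflate t0'" using surface_parent Suc.prems by blast
    have "near t0 t0'"
      using near_parent[of "fst t0" "snd t0" "fst t0'" "snd t0'" "fst t" "snd t" "fst t'" "snd t'"]
        t0 t0' patch_surface Suc.prems by auto
    then show ?case using Suc.IH[OF t0(1) t0'(1)] inflate_Rauzy_tiles t0'(2) by blast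
  qed
  moreover obtain i where "t \<in> patch i" using assms(1) unfolding Rauzy_tiles_def by blast
  ultimately show ?thesis using assms(2,3) by blast
qed

section \<open>Tiles around a vertex\<close>

declare len_simps [simp del]

abbreviation total_len :: real where "total_len \<equiv> len 1 + len 2 + len 3"

abbreviation dir3 :: "3 \<Rightarrow> real^2" where "dir3 a \<equiv> proj (unit3 a)"

lemma distinct3_cases:
  assumes "{i, j, k} = (UNIV :: 3 set)"
  shows "i \<noteq> j" "j \<noteq> k" "i \<noteq> k" "\<And>a. a = i \<or> a = j \<or> a = k"
proof -
  have *: "card {i, j, k} = 3" using assms by simp
  show "i \<noteq> j" "j \<noteq> k" "i \<noteq> k" using * by (auto simp: card_insert_if split: if_splits)
  show "a = i \<or> a = j \<or> a = k" for a using assms by blast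
qed

lemma distinct3_UNIV:
  assumes "i \<noteq> j" "j \<noteq> k" "i \<noteq> k" shows "{i, j, k} = (UNIV :: 3 set)"
  using assms by (intro card_subset_eq) auto

lemma third_axis:
  assumes "a \<noteq> (b :: 3)" obtains c where "c \<noteq> a" "c \<noteq> b" "{a, b, c} = UNIV"
proof -
  have "card {a, b} < card (UNIV :: 3 set)" using assms by simp
  then have "{a, b} \<noteq> UNIV" by (metis less_irrefl)
  then obtain c where "c \<notin> {a, b}" by blast
  then show thesis using that[of c] assms distinct3_UNIV[of a b c] by auto
qed

lemma total_len_distinct:
  assumes "{i, j, k} = (UNIV :: 3 set)" shows "len i + len j + len k = total_len"
proof -
  have "total_len = sum len UNIV" by (simp add: sum_3)
  also have "\<dots> = sum len {i, j, k}" using assms by simp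
  also have "\<dots> = len i + len j + len k" using distinct3_cases[OF assms] by simp
  finally show ?thesis by simp
qed

lemma proj_add: "proj (v + w) = proj v + proj w"
  and proj_diff: "proj (v - w) = proj v - proj w"
  by (simp_all add: proj_def algebra_simps)

lemma proj_zero [simp]: "proj 0 = 0" by (simp add: proj_def)

text \<open>The kernel of \<open>proj\<close> consists of the multiples of (1,1,1): the first
  coordinate of the image determines one difference of entries, and the second coordinate then the
  other.\<close>

lemma proj_eq_iff:
  "proj v = proj w \<longleftrightarrow> v $ 2 - v $ 1 = w $ 2 - w $ 1 \<and> v $ 3 - v $ 1 = w $ 3 - w $ 1"
proof -
  have c: "proj u $ 1 = (sqrt 3 / 2) * of_int (u $ 2 - u $ 1)"
    "proj u $ 2 = of_int (2 * (u $ 3 - u $ 1) - (u $ 2 - u $ 1)) / 2" for u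
    by (simp_all add: proj_def algebra_simps add_divide_distrib diff_divide_distrib)
  show ?thesis
    unfolding vec_eq_iff forall_2 c by (simp only: mult_cancel_left divide_cancel_right of_int_eq_iff) auto
qed

text \<open>Adding \<open>m\<close> times (1,1,1) changes the height by
  \<open>m * total_len\<close>, so a half-open window of that length contains at most one
  lift.\<close>

lemma proj_inj:
  assumes "proj v = proj w" "0 \<le> ht v" "ht v < total_len" "0 \<le> ht w" "ht w < total_len"
  shows "v = w"
proof -
  define m where "m = v $ 1 - w $ 1"
  have m: "v $ 1 = w $ 1 + m" "v $ 2 = w $ 2 + m" "v $ 3 = w $ 3 + m"
    using assms(1) by (auto simp: proj_eq_iff m_def)
  define T where "T = total_len"
  have L: "T > 0" using len_pos unfolding T_def by (simp add: add_pos_pos)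
  have "ht v = ht w + of_int m * T" unfolding ht_def m T_def by (simp add: algebra_simps)
  then have "of_int m * T < 1 * T" "(-1) * T < of_int m * T"
    using assms unfolding T_def[symmetric] by linarith+
  then have "of_int m < (1::real)" "(-1::real) < of_int m"
    using L by (simp_all only: mult_less_cancel_right_pos)
  then have "m = 0" by linarith
  then show ?thesis using m by (simp add: vec_eq_iff forall_3)
qed

text \<open>The window is chosen because corners of tiles of the discrete plane have their heights
  in it, see \<open>corner_ht\<close>.\<close>

definition lift :: "real^2 \<Rightarrow> int^3" where
  "lift z = (SOME w. proj w = z \<and> 0 \<le> ht w \<and> ht w < total_len)"

definition height :: "real^2 \<Rightarrow> real" where
  "height z = ht (lift z)"

lemma lift_proj:
  assumes "0 \<le> ht w" "ht w < total_len" shows "lift (proj w) = w"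
proof -
  have "proj (lift (proj w)) = proj w \<and> 0 \<le> ht (lift (proj w)) \<and> ht (lift (proj w)) < total_len"
    unfolding lift_def by (rule someI[of _ w]) (use assms in auto)
  then show ?thesis using proj_inj assms by blast
qed

definition corner :: "int^3 \<Rightarrow> (int^3) \<times> 3 \<Rightarrow> bool" where
  "corner c t \<longleftrightarrow> (\<forall>a. (c - fst t) $ a \<in> {0, 1}) \<and> (c - fst t) $ snd t = 0"

text \<open>The offset of the tiles is a difference of two 0-1 vectors, the first vanishing at
  \<open>k\<close> and the second at \<open>k'\<close>.\<close>

lemma corner_near:
  assumes "corner c (w, k)" "corner c (w', k')" shows "near (w, k) (w', k')"
proof -
  have 1: "(c - w) $ a \<in> {0, 1}" "(c - w') $ a \<in> {0, 1}" for a
    using assms by (auto simp: corner_def)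
  have 2: "(c - w) $ k = 0" "(c - w') $ k' = 0" using assms by (auto simp: corner_def)
  have 3: "(w' - w) $ a = (c - w) $ a - (c - w') $ a" for a by simp
  have "\<bar>(w' - w) $ a\<bar> \<le> 1" for a using 1[of a] unfolding 3 by auto
  moreover have "(w' - w) $ k \<le> 0" "0 \<le> (w' - w) $ k'" using 1[of k] 1[of k'] 2 unfolding 3 by auto
  ultimately show ?thesis unfolding near_def Let_def split by blast
qed

lemma ht_unit3: "ht (unit3 a) = len a"
  using exhaust_3[of a] by (auto simp: ht_def axis_def)

lemma corners:
  assumes "{i, j, k} = UNIV"
  shows "corner w (w, k)" "corner (w + unit3 i) (w, k)" "corner (w + unit3 i + unit3 j) (w, k)"
    "corner (w + unit3 j) (w, k)"
  using distinct3_cases[OF assms] by (auto simp: corner_def axis_def)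

lemma corner_obtain:
  assumes "corner c (w, k)" "{i, j, k} = UNIV"
  shows "c \<in> {w, w + unit3 i, w + unit3 i + unit3 j, w + unit3 j}"
proof -
  have 1: "(c - w) $ a \<in> {0, 1}" for a using assms by (auto simp: corner_def)
  have 2: "(c - w) $ k = 0" using assms by (auto simp: corner_def)
  note d = distinct3_cases[OF assms(2)]
  have e: "c = w + v" if "(c - w) $ i = v $ i" "(c - w) $ j = v $ j" "v $ k = 0" for v
    unfolding vec_eq_iff
  proof
    fix a show "c $ a = (w + v) $ a" using d(4)[of a] that 2 by auto
  qed
  show ?thesis using 1[of i] 1[of j] d(1-3) e[of 0] e[of "unit3 i"] e[of "unit3 j"] e[of "unit3 i + unit3 j"]
    by (auto simp: axis_def add.assoc)
qed

lemma corner_ht: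
  assumes "(w, k) \<in> surface" "corner c (w, k)" shows "0 \<le> ht c" "ht c < total_len"
proof -
  obtain a :: 3 where "a \<noteq> k" by (metis exhaust_3 one_neq_zero zero_neq_one num1_eq1 zero_neq_numeral rel_simps(76))
  then obtain b where b: "{a, k, b} = UNIV" using third_axis by metis
  then have ab: "{a, b, k} = UNIV" by (simp add: insert_commute)
  have r: "0 \<le> ht w" "ht w < len k" using assms by (auto simp: surface_def)
  show "0 \<le> ht c" "ht c < total_len"
    using corner_obtain[OF assms(2) ab] r len_pos[of a] len_pos[of b] len_pos[of k] total_len_distinct[OF ab]
    by (auto simp: ht_add ht_unit3)
qed

lemma Rauzy_tiles_corner:
  assumes "t \<in> Rauzy_tiles" "corner c t" "t' \<in> surface" "corner c t'" shows "t' \<in> Rauzy_tiles"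
  using near_Rauzy_tiles[OF assms(1,3)] corner_near assms(2,4)
  by (metis prod.collapse)

section \<open>Tiles at a vertex in terms of its height\<close>

lemma rotate4_disj:
  "rotate r [p, q, s, t] \<in> {[p, q, s, t], [q, s, t, p], [s, t, p, q], [t, p, q, s]}"
proof -
  have e: "rotate r [p, q, s, t] = rotate (r mod 4) [p, q, s, t]"
    using rotate_conv_mod[of r "[p, q, s, t]"] by simp
  have "r mod 4 < 4" by simp
  then have "r mod 4 = 0 \<or> r mod 4 = 1 \<or> r mod 4 = 2 \<or> r mod 4 = 3" by linarith
  then show ?thesis
    unfolding e by (elim disjE) (simp_all add: numeral_2_eq_2 numeral_3_eq_3)
qed

lemma rotate4:
  obtains "rotate r [p, q, s, t] = [p, q, s, t]" | "rotate r [p, q, s, t] = [q, s, t, p]"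
  | "rotate r [p, q, s, t] = [s, t, p, q]" | "rotate r [p, q, s, t] = [t, p, q, s]"
  using rotate4_disj[of r p q s t] unfolding insert_iff empty_iff by blast

lemma vertices_lift:
  assumes "z \<in> vertices"
  shows "proj (lift z) = z" "0 \<le> height z" "height z < total_len"
    "\<exists>t \<in> Rauzy_tiles. corner (lift z) t"
proof -
  obtain b c d where "tile_corners z b c d" using assms by (auto simp: vertices_def)
  then obtain w k i j r where t: "(w, k) \<in> Rauzy_tiles" "{i, j, k} = UNIV"
    "[z, b, c, d] = rotate r [proj w, proj (w + unit3 i), proj (w + unit3 i + unit3 j), proj (w + unit3 j)]"
    unfolding tile_corners_def by blast
  have "(w, k) \<in> surface" using t Rauzy_tiles_surface by auto
  note c = corners[OF t(2), of w]
  have "\<exists>v. z = proj v \<and> corner v (w, k)"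
    using t(3) c by (cases rule: rotate4[of r "proj w" "proj (w + unit3 i)" "proj (w + unit3 i + unit3 j)"
          "proj (w + unit3 j)"]) auto
  then obtain v where v: "z = proj v" "corner v (w, k)" by blast
  note h = corner_ht[OF \<open>(w, k) \<in> surface\<close> v(2)]
  have l: "lift z = v" using lift_proj h v by simp
  show "proj (lift z) = z" "0 \<le> height z" "height z < total_len"
    "\<exists>t \<in> Rauzy_tiles. corner (lift z) t"
    unfolding height_def l using h v t(1) by blast+
qed

text \<open>The drop in height from a vertex to the lower end of its edge in direction
  \<open>d e_a\<close>.\<close>

definition below :: "int \<Rightarrow> 3 \<Rightarrow> real" where
  "below d a = (if d = 1 then 0 else len a)"

text \<open>\<open>tile_at z a d b e\<close> describes the tile at \<open>z\<close> with sides \<open>d e\<^sub>a\<close> and \<open>e e\<^sub>b\<close>: the height of its lowest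
  corner lies between \<open>0\<close> and the length of the third axis.\<close>

definition tile_at :: "real^2 \<Rightarrow> 3 \<Rightarrow> int \<Rightarrow> 3 \<Rightarrow> int \<Rightarrow> bool" where
  "tile_at z a d b e \<longleftrightarrow> z \<in> vertices \<and> a \<noteq> b \<and> d \<in> {1, -1} \<and> e \<in> {1, -1} \<and>
     0 \<le> height z - below d a - below e b \<and>
     height z - below d a - below e b < total_len - len a - len b"

abbreviation step :: "real^2 \<Rightarrow> 3 \<Rightarrow> int \<Rightarrow> real^2" where
  "step z a d \<equiv> z + of_int d *\<^sub>R dir3 a"

lemma height_proj:
  assumes "0 \<le> ht w" "ht w < total_len" shows "height (proj w) = ht w"
  using lift_proj[OF assms] by (simp add: height_def)

lemma tile_corners_vertex: "tile_corners z x y x' \<Longrightarrow> z \<in> vertices"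
  by (auto simp: vertices_def)

lemma tile_corners_imp_tile_at:
  assumes "tile_corners z x y x'"
  shows "\<exists>a b d e. tile_at z a d b e \<and> x = step z a d \<and> y = step (step z a d) b e \<and> x' = step z b e"
proof -
  obtain w k i j r where t: "(w, k) \<in> Rauzy_tiles" "{i, j, k} = UNIV"
    "[z, x, y, x'] = rotate r [proj w, proj (w + unit3 i), proj (w + unit3 i + unit3 j), proj (w + unit3 j)]"
    using assms unfolding tile_corners_def by blast
  have s: "(w, k) \<in> surface" using t Rauzy_tiles_surface by auto
  note h = corners[OF t(2), THEN corner_ht(1)[OF s]] corners[OF t(2), THEN corner_ht(2)[OF s]]
  note d = distinct3_cases[OF t(2)]
  have r: "0 \<le> ht w" "ht w < len k" using s by (auto simp: surface_def)
  have L: "total_len - len i - len j = len k" "total_len - len j - len i = len k"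
    using total_len_distinct[OF t(2)] by linarith+
  have v: "z \<in> vertices" using assms by (rule tile_corners_vertex)
  show ?thesis
  proof (cases rule: rotate4[of r "proj w" "proj (w + unit3 i)" "proj (w + unit3 i + unit3 j)"
          "proj (w + unit3 j)"])
    case 1
    then have e: "z = proj w" "x = proj (w + unit3 i)" "y = proj (w + unit3 i + unit3 j)" "x' = proj (w + unit3 j)"
      using t(3) by simp_all
    have "height z = ht w" using e h by (simp add: height_proj)
    then have "tile_at z i 1 j 1" using v d r L by (auto simp: tile_at_def below_def)
    then show ?thesis using e
      by (intro exI[of _ i] exI[of _ j] exI[of _ 1]) (auto simp: proj_add)
  next
    case 2
    then have e: "x' = proj w" "z = proj (w + unit3 i)" "x = proj (w + unit3 i + unit3 j)" "y = proj (w + unit3 j)"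
      using t(3) by simp_all
    have "height z = ht w + len i" using e h by (simp add: height_proj ht_add ht_unit3)
    then have "tile_at z j 1 i (-1)" using v d r L by (auto simp: tile_at_def below_def)
    then show ?thesis using e
      by (intro exI[of _ j] exI[of _ i] exI[of _ 1] exI[of _ "-1"]) (auto simp: proj_add)
  next
    case 3
    then have e: "y = proj w" "x' = proj (w + unit3 i)" "z = proj (w + unit3 i + unit3 j)" "x = proj (w + unit3 j)"
      using t(3) by simp_all
    have "height z = ht w + len i + len j" using e h by (simp add: height_proj ht_add ht_unit3)
    then have "tile_at z i (-1) j (-1)" using v d r L by (auto simp: tile_at_def below_def)
    then show ?thesis using e
      by (intro exI[of _ i] exI[of _ j] exI[of _ "-1"]) (auto simp: proj_add)
  next
    case 4
    then have e: "x = proj w" "y = proj (w + unit3 i)" "x' = proj (w + unit3 i + unit3 j)" "z = proj (w + unit3 j)"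
      using t(3) by simp_all
    have "height z = ht w + len j" using e h by (simp add: height_proj ht_add ht_unit3)
    then have "tile_at z j (-1) i 1" using v d r L by (auto simp: tile_at_def below_def)
    then show ?thesis using e
      by (intro exI[of _ j] exI[of _ i] exI[of _ "-1"] exI[of _ 1]) (auto simp: proj_add)
  qed
qed

text \<open>The height condition puts the tile with lowest corner \<open>w\<close> into the discrete
  plane. It shares the corner \<open>z\<close> with a Rauzy tile and is therefore a Rauzy tile
  itself.\<close>

lemma tile_at_imp_tile_corners:
  assumes "tile_at z a d b e"
  shows "tile_corners z (step z a d) (step (step z a d) b e) (step z b e)"
proof -
  have z: "z \<in> vertices" "a \<noteq> b" "d \<in> {1, -1}" "e \<in> {1, -1}"
    using assms unfolding tile_at_def by blast+
  obtain k where k: "{a, b, k} = UNIV" using third_axis[OF z(2)] by metis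
  then have k': "{b, a, k} = UNIV" by (simp add: insert_commute)
  note dk = distinct3_cases[OF k]
  define c where "c = lift z"
  have c: "z = proj c" using vertices_lift[OF z(1)] by (simp add: c_def)
  define w where "w = c - (if d = 1 then 0 else unit3 a) - (if e = 1 then 0 else unit3 b)"
  have "ht w = height z - below d a - below e b"
    by (simp add: w_def ht_diff ht_unit3 below_def c_def height_def ht_def[of 0])
  then have "0 \<le> ht w" "ht w < len k"
    using assms total_len_distinct[OF k] by (auto simp: tile_at_def)
  then have s: "(w, k) \<in> surface" by (simp add: surface_def)
  have cc: "corner c (w, k)" using z dk by (auto simp: corner_def w_def axis_def)
  have t: "(w, k) \<in> Rauzy_tiles"
    using vertices_lift(4)[OF z(1)] Rauzy_tiles_corner[OF _ _ s cc] by (auto simp: c_def)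
  have r: "rotate 0 [p, q, s, t] = [p, q, s, t]" "rotate 1 [p, q, s, t] = [q, s, t, p]"
    "rotate 2 [p, q, s, t] = [s, t, p, q]" "rotate 3 [p, q, s, t] = [t, p, q, s]" for p q s t :: "real^2"
    by (simp_all add: numeral_2_eq_2 numeral_3_eq_3)
  consider "d = 1" "e = 1" | "d = 1" "e = -1" | "d = -1" "e = 1" | "d = -1" "e = -1" using z by blast
  then show ?thesis
  proof cases
    case 1
    then have "c = w" by (simp add: w_def)
    then show ?thesis unfolding tile_corners_def using t k 1 c
      by (intro exI[of _ w] exI[of _ k] exI[of _ a] exI[of _ b] exI[of _ 0]) (simp add: proj_add)
  next
    \<comment> \<open>Exchanging the two sides reverses the orientation, after which a rotation
      brings \<open>z\<close> to the front.\<close>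
    case 2
    then have "c = w + unit3 b" by (simp add: w_def)
    then show ?thesis unfolding tile_corners_def using t k' 2 c
      by (intro exI[of _ w] exI[of _ k] exI[of _ b] exI[of _ a] exI[of _ 1]) (simp add: r(2) proj_add del: One_nat_def)
  next
    case 3
    then have "c = w + unit3 a" by (simp add: w_def)
    then show ?thesis unfolding tile_corners_def using t k' 3 c
      by (intro exI[of _ w] exI[of _ k] exI[of _ b] exI[of _ a] exI[of _ 3]) (simp add: r(4) proj_add)
  next
    case 4
    then have "c = w + unit3 a + unit3 b" by (simp add: w_def)
    then have p: "z = proj (w + unit3 a + unit3 b)" "z + of_int d *\<^sub>R dir3 a = proj (w + unit3 b)"
      "z + of_int d *\<^sub>R dir3 a + of_int e *\<^sub>R dir3 b = proj w" "z + of_int e *\<^sub>R dir3 b = proj (w + unit3 a)"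
      unfolding c 4 by (simp_all add: proj_add)
    have "tile_corners (proj (w + unit3 a + unit3 b)) (proj (w + unit3 b)) (proj w) (proj (w + unit3 a))"
      unfolding tile_corners_def using t k
      by (intro exI[of _ w] exI[of _ k] exI[of _ a] exI[of _ b] exI[of _ 2]) (simp only: r(3) simp_thms)
    then show ?thesis unfolding p[symmetric] .
  qed
qed

lemma tile_corners_rotate:
  assumes "tile_corners a b c d" shows "tile_corners b c d a"
proof -
  obtain w k i j r where t: "(w, k) \<in> Rauzy_tiles" "{i, j, k} = UNIV"
    "[a, b, c, d] = rotate r [proj w, proj (w + unit3 i), proj (w + unit3 i + unit3 j), proj (w + unit3 j)]"
    using assms unfolding tile_corners_def by blast
  have "[b, c, d, a] = rotate 1 [a, b, c, d]" by simp
  also have "\<dots> = rotate (1 + r) [proj w, proj (w + unit3 i), proj (w + unit3 i + unit3 j), proj (w + unit3 j)]"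
    unfolding t(3) by (simp only: rotate_rotate)
  finally show ?thesis unfolding tile_corners_def using t(1,2) by metis
qed

lemma tile_at_commute:
  assumes "tile_at z a d b e" shows "tile_at z b e a d"
  using assms unfolding tile_at_def
  by (elim conjE, intro conjI) (assumption | erule not_sym | linarith)+

lemma tile_corners_reflect:
  assumes "tile_corners a b c d" shows "tile_corners a d c b"
proof -
  obtain i j d' e' where t: "tile_at a i d' j e'" "b = step a i d'" "c = step (step a i d') j e'" "d = step a j e'"
    using tile_corners_imp_tile_at[OF assms] by blast
  have "step (step a i d') j e' = step (step a j e') i d'" by simp
  then show ?thesis using tile_at_imp_tile_corners[OF tile_at_commute[OF t(1)]] t by metis
qed

lemma of_int_dir3: "of_int d *\<^sub>R dir3 a = proj (axis a d)"
  using exhaust_3[of a] by (auto simp: proj_def axis_def)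

lemma step_inj:
  assumes "d \<in> {1, -1}" "d' \<in> {1, -1}" "step z a d = step z a' d'"
  shows "a = a'" "d = d'"
proof -
  have "proj (axis a d) = proj (axis a' d')" using assms by (simp add: of_int_dir3)
  then show "a = a'" "d = d'"
    using exhaust_3[of a] exhaust_3[of a'] assms(1,2) by (auto simp: proj_eq_iff axis_def)
qed

lemma axis_nth_if: "axis a x $ b = (if b = a then x else 0)"
  by (simp add: axis_def)

text \<open>The difference of the two displacements is a multiple of (1,1,1). Comparing its entries
  at \<open>a\<close> and \<open>b\<close> with that at the third axis leaves only the two orders of
  the same pair of steps.\<close>

lemma proj_axis2_inj:
  fixes d e d' e' :: int
  assumes "d \<in> {1, -1}" "d' \<in> {1, -1}" "e \<in> {1, -1}" "e' \<in> {1, -1}" "a \<noteq> b" "a' \<noteq> b'"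
    and "proj (axis a d + axis b e) = proj (axis a' d' + axis b' e')"
  shows "a = a' \<and> d = d' \<and> b = b' \<and> e = e' \<or> a = b' \<and> d = e' \<and> b = a' \<and> e = d'"
proof -
  obtain c where c: "{a, b, c} = UNIV" using third_axis[OF assms(5)] by metis
  note dc = distinct3_cases[OF c]
  define f where "f x = (axis a d + axis b e - axis a' d' - axis b' e') $ x" for x
  have eq: "f 2 = f 1" "f 3 = f 1"
    using assms(7) unfolding proj_eq_iff f_def vector_add_component vector_minus_component
    by linarith+
  then have f: "f x = f 1" for x using exhaust_3[of x] by auto
  have fa: "f a = d - axis a' d' $ a - axis b' e' $ a" and fb: "f b = e - axis a' d' $ b - axis b' e' $ b"
    and fc: "f c = - axis a' d' $ c - axis b' e' $ c"
    using dc by (auto simp: f_def axis_def)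
  have "f a = f c" "f b = f c" using f by metis+
  then have "d - axis a' d' $ a - axis b' e' $ a = - axis a' d' $ c - axis b' e' $ c"
    "e - axis a' d' $ b - axis b' e' $ b = - axis a' d' $ c - axis b' e' $ c"
    unfolding fa fb fc by blast+
  then show ?thesis
    using dc(1-3) dc(4)[of a'] dc(4)[of b'] assms(1-6) unfolding axis_nth_if
    by (elim disjE) auto
qed

lemma step2_inj:
  assumes "d \<in> {1, -1}" "d' \<in> {1, -1}" "e \<in> {1, -1}" "e' \<in> {1, -1}" "a \<noteq> b" "a' \<noteq> b'"
    and "step (step z a d) b e = step (step z a' d') b' e'"
  shows "a = a' \<and> d = d' \<and> b = b' \<and> e = e' \<or> a = b' \<and> d = e' \<and> b = a' \<and> e = d'"
  using assms(7) by (intro proj_axis2_inj[OF assms(1-6)]) (simp add: of_int_dir3 proj_add)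

lemma step2_back:
  assumes "d \<in> {1, -1}" "e \<in> {1, -1}" "step (step z a d) b e = z" shows "b = a \<and> e = - d"
proof -
  have "z + of_int e *\<^sub>R dir3 b = step z a (- d)" using assms(3) by (simp add: algebra_simps add_eq_0_iff)
  then show ?thesis using step_inj[of e "- d" z b a] assms(1,2) by auto
qed

text \<open>Going straight on twice never leads to the opposite corner of a tile, whose displacement
  uses two different axes.\<close>

lemma step2_straight:
  assumes "d \<in> {1, -1}" "d' \<in> {1, -1}" "e' \<in> {1, -1}" "a' \<noteq> b'"
  shows "step (step z a d) a d \<noteq> step (step z a' d') b' e'"
proof
  assume "step (step z a d) a d = step (step z a' d') b' e'"
  then have "proj (axis a d + axis a d) = proj (axis a' d' + axis b' e')"
    unfolding of_int_dir3 proj_add add.assoc add_left_cancel .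
  then show False using exhaust_3[of a] exhaust_3[of a'] exhaust_3[of b'] assms
    by (elim disjE) (auto simp: proj_eq_iff axis_def)
qed

text \<open>The lower end of the edge has its height in \<open>[0, total_len - len a)\<close>, the
  range in which the edge bounds a tile of the discrete plane.\<close>

definition edge_at :: "real^2 \<Rightarrow> 3 \<Rightarrow> int \<Rightarrow> bool" where
  "edge_at z a d \<longleftrightarrow> z \<in> vertices \<and> d \<in> {1, -1} \<and>
     0 \<le> height z - below d a \<and> height z - below d a < total_len - len a"

lemma tile_at_edge_at: assumes "tile_at z a d b e" shows "edge_at z a d" "edge_at z b e"
  using assms len_pos[of a] len_pos[of b] unfolding tile_at_def edge_at_def below_def
  by (auto split: if_splits)

text \<open>The lifted step stays in the window \<open>[0, total_len)\<close>, so it is the chosen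
  lift of the endpoint.\<close>

lemma edge_at_height:
  assumes "edge_at z a d" shows "height (step z a d) = height z + of_int d * len a"
proof -
  have z: "z \<in> vertices" using assms by (simp add: edge_at_def)
  have e: "step z a d = proj (lift z + axis a d)" using vertices_lift(1)[OF z] by (simp add: proj_add of_int_dir3)
  have "ht (axis a d) = of_int d * len a"
    using exhaust_3[of a] by (auto simp: ht_def axis_def)
  then have h: "ht (lift z + axis a d) = height z + of_int d * len a" by (simp add: ht_add height_def)
  have "0 \<le> height z" "height z < total_len" using vertices_lift[OF z] by auto
  then have "0 \<le> ht (lift z + axis a d)" "ht (lift z + axis a d) < total_len"
    using assms len_pos[of a] unfolding h edge_at_def below_def by (auto split: if_splits)
  then show ?thesis unfolding e h[symmetric] by (rule height_proj)
qed

text \<open>The directions \<open>b\<close> and \<open>- c\<close> lie on the same side of an edge in direction \<open>a\<close>.\<close>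

lemma tile_at_sides:
  assumes "edge_at z a d" "{a, b, c} = UNIV"
  shows "tile_at z a d c (-1) \<longleftrightarrow> \<not> tile_at z a d b 1"
proof -
  note dc = distinct3_cases[OF assms(2)]
  have "total_len - len a - len b = len c" "total_len - len a - len c = len b" "total_len - len a = len b + len c"
    using total_len_distinct[OF assms(2)] by linarith+
  then show ?thesis using assms(1) dc unfolding tile_at_def edge_at_def
    by (auto simp: below_def)
qed

lemma edge_at_tile:
  assumes "edge_at z a d" obtains b e where "tile_at z a d b e"
proof -
  obtain b c where "{a, b, c} = UNIV"
    by (metis third_axis distinct3_cases(1) exhaust_3 one_neq_zero)
  then show thesis using tile_at_sides[OF assms] that by blast
qed

lemma edge_iff: "edge z x \<longleftrightarrow> (\<exists>a d. edge_at z a d \<and> x = step z a d)"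
proof
  assume "edge z x"
  then obtain y w where "tile_corners z x y w" by (auto simp: edge_def)
  then show "\<exists>a d. edge_at z a d \<and> x = step z a d"
    using tile_corners_imp_tile_at tile_at_edge_at by blast
next
  assume "\<exists>a d. edge_at z a d \<and> x = step z a d"
  then obtain a d where "edge_at z a d" "x = step z a d" by blast
  then show "edge z x" using edge_at_tile tile_at_imp_tile_corners unfolding edge_def by metis
qed

lemma edge_at_edge: "edge_at z a d \<Longrightarrow> edge z (step z a d)" by (auto simp: edge_iff)

lemma edge_vertices: "edge z x \<Longrightarrow> z \<in> vertices" "edge z x \<Longrightarrow> x \<in> vertices"
  by (auto simp: edge_def vertices_def dest: tile_corners_rotate)

lemma edge_sym: "edge z x \<Longrightarrow> edge x z"
  unfolding edge_def by (meson tile_corners_rotate tile_corners_reflect)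

section \<open>Neighbours that share a tile at a vertex\<close>

definition adjacent :: "real^2 \<Rightarrow> real^2 \<Rightarrow> real^2 \<Rightarrow> bool" where
  "adjacent z x w \<longleftrightarrow> (\<exists>y. tile_corners z x y w)"

lemma tile_corners_step:
  assumes "tile_corners z (step z a d) y (step z b e)" "d \<in> {1, -1}" "e \<in> {1, -1}"
  shows "tile_at z a d b e \<and> y = step (step z a d) b e"
proof -
  obtain a' b' d' e' where t: "tile_at z a' d' b' e'" "step z a d = step z a' d'"
    "y = step (step z a' d') b' e'" "step z b e = step z b' e'"
    using tile_corners_imp_tile_at[OF assms(1)] by blast
  have "d' \<in> {1, -1}" "e' \<in> {1, -1}" using t(1) by (auto simp: tile_at_def)
  then show ?thesis using step_inj[OF assms(2) _ t(2)] step_inj[OF assms(3) _ t(4)] t by auto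
qed

lemma adjacent_step:
  assumes "d \<in> {1, -1}" "e \<in> {1, -1}"
  shows "adjacent z (step z a d) (step z b e) \<longleftrightarrow> tile_at z a d b e"
  unfolding adjacent_def using tile_corners_step[OF _ assms] tile_at_imp_tile_corners by blast

lemma adjacentE:
  assumes "adjacent z x w"
  obtains a d b e where "tile_at z a d b e" "x = step z a d" "w = step z b e"
  using assms tile_corners_imp_tile_at unfolding adjacent_def by metis

lemma adjacent_sym: "adjacent z x w \<longleftrightarrow> adjacent z w x"
  unfolding adjacent_def by (meson tile_corners_reflect)

lemma tile_at_neq: "tile_at z a d b e \<Longrightarrow> a \<noteq> b" by (simp add: tile_at_def)

lemma tile_at_signs: "tile_at z a d b e \<Longrightarrow> d \<in> {1, -1}" "tile_at z a d b e \<Longrightarrow> e \<in> {1, -1}"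
  by (simp_all add: tile_at_def)

lemma adjacent_neq: "adjacent z x w \<Longrightarrow> x \<noteq> w"
  by (metis adjacentE step_inj(1) tile_at_neq tile_at_signs)

lemma two_adjacent:
  assumes "edge z x"
  obtains u u' where "u \<noteq> u'" "\<And>w. adjacent z x w \<longleftrightarrow> w = u \<or> w = u'"
proof -
  obtain a d where ad: "edge_at z a d" "x = step z a d" using assms edge_iff by blast
  have d: "d \<in> {1, -1}" using ad by (simp add: edge_at_def)
  obtain b c where abc: "{a, b, c} = UNIV"
    by (metis third_axis distinct3_cases(1) exhaust_3 one_neq_zero)
  then have acb: "{a, c, b} = UNIV" by (simp add: insert_commute)
  note dc = distinct3_cases[OF abc]
  note s = tile_at_sides[OF ad(1) abc] tile_at_sides[OF ad(1) acb]
  \<comment> \<open>By \<open>tile_at_sides\<close>, exactly one of the directions \<open>b\<close>,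
    \<open>- c\<close> gives a tile on one side, and exactly one of \<open>c\<close>,
    \<open>- b\<close> on the other.\<close>
  define u where "u = (if tile_at z a d b 1 then step z b 1 else step z c (-1))"
  define u' where "u' = (if tile_at z a d c 1 then step z c 1 else step z b (-1))"
  have iff: "adjacent z x w \<longleftrightarrow> w = u \<or> w = u'" for w
  proof
    assume a: "adjacent z x w"
    then obtain b' e where w: "w = step z b' e" "e \<in> {1, -1}"
      by (metis adjacentE tile_at_signs(2))
    have t: "tile_at z a d b' e" using a adjacent_step[OF d w(2)] unfolding ad w by simp
    then have "b' = b \<or> b' = c" using dc(4) tile_at_neq by metis
    then show "w = u \<or> w = u'" using t w s unfolding u_def u'_def by auto
  next
    have "adjacent z x u" "adjacent z x u'"
      using adjacent_step[OF d, of 1 z a] adjacent_step[OF d, of "-1" z a] s unfolding u_def u'_def ad by auto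
    then show "w = u \<or> w = u' \<Longrightarrow> adjacent z x w" by blast
  qed
  have "u \<noteq> u'"
    using step_inj[of 1 1 z b c] step_inj[of 1 "-1" z b b] step_inj[of "-1" 1 z c c] step_inj[of "-1" "-1" z c b] dc
    unfolding u_def u'_def by auto
  then show thesis using iff that by blast
qed

lemma tile_corners_adjacent: "tile_corners z x y w \<Longrightarrow> adjacent z x w"
  "tile_corners z x y w \<Longrightarrow> adjacent x z y" "tile_corners z x y w \<Longrightarrow> adjacent y x w"
  "tile_corners z x y w \<Longrightarrow> adjacent w z y"
  unfolding adjacent_def by (meson tile_corners_rotate tile_corners_reflect)+

lemma tile_corners_fourth:
  assumes "tile_corners z x y w" shows "y = x + w - z"
  using tile_corners_imp_tile_at[OF assms] by auto

text \<open>A displacement along two different axes determines the pair of steps, by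
  \<open>step2_inj\<close>, so two opposite corners determine the tile.\<close>

lemma tile_corners_opposite:
  assumes "tile_corners z x y w" "tile_corners z x' y w'"
  shows "x' = x \<and> w' = w \<or> x' = w \<and> w' = x"
proof -
  obtain a b d e where t: "tile_at z a d b e" "x = step z a d" "y = step (step z a d) b e" "w = step z b e"
    using tile_corners_imp_tile_at[OF assms(1)] by blast
  obtain a' b' d' e' where t': "tile_at z a' d' b' e'" "x' = step z a' d'" "y = step (step z a' d') b' e'" "w' = step z b' e'"
    using tile_corners_imp_tile_at[OF assms(2)] by blast
  note sg = tile_at_signs(1)[OF t(1)] tile_at_signs(1)[OF t'(1)] tile_at_signs(2)[OF t(1)] tile_at_signs(2)[OF t'(1)]
  have "step (step z a d) b e = step (step z a' d') b' e'" using t(3) t'(3) by simp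
  from step2_inj[OF sg tile_at_neq[OF t(1)] tile_at_neq[OF t'(1)] this]
  show ?thesis using t t' by auto
qed

lemma tile_corners_neq:
  assumes "tile_corners z x y w" shows "z \<noteq> y" "z \<noteq> x" "x \<noteq> w" "x \<noteq> y" "y \<noteq> w" "z \<noteq> w"
proof -
  have "x \<noteq> w" if "tile_corners z x y w" for z x y w
    using adjacent_neq[OF tile_corners_adjacent(1)[OF that]] .
  moreover have "z \<noteq> x" if T: "tile_corners z x y w" for z x y w
  proof
    assume "z = x"
    obtain a b d e where t: "tile_at z a d b e" "x = step z a d"
      using tile_corners_imp_tile_at[OF T] by blast
    then have "of_int d *\<^sub>R dir3 a = 0" using \<open>z = x\<close> by (metis add_cancel_left_right)
    then have "step z a d = step z a (- d)" by (simp only: of_int_minus scaleR_minus_left minus_zero)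
    then show False using step_inj[of d "- d" z a a] tile_at_signs[OF t(1)] by auto
  qed
  moreover have r: "tile_corners x y w z" "tile_corners y w z x" "tile_corners w z x y"
    using assms tile_corners_rotate by blast+
  ultimately show "z \<noteq> y" "z \<noteq> x" "x \<noteq> w" "x \<noteq> y" "y \<noteq> w" "z \<noteq> w"
    using assms by blast+
qed

text \<open>If \<open>v\<close>, \<open>u\<close>, \<open>w\<close> are pairwise adjacent around \<open>y\<close>, then \<open>y\<close> is a 3-vertex and the angle
  at \<open>u\<close> between the two outer tiles is not filled by a single tile.\<close>

lemma three_around:
  assumes "adjacent y u v" "adjacent y u w" "adjacent y v w"
  shows "\<not> adjacent u (u + v - y) (u + w - y)"
proof -
  obtain a d b e where t: "tile_at y a d b e" "u = step y a d" "v = step y b e"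
    using assms(1) by (rule adjacentE)
  obtain c f where w: "w = step y c f" "f \<in> {1, -1}"
    using assms(2) by (metis adjacentE tile_at_signs(2))
  have de: "d \<in> {1, -1}" "e \<in> {1, -1}" using tile_at_signs[OF t(1)] .
  have t2: "tile_at y a d c f" using assms(2) adjacent_step[OF de(1) w(2)] unfolding t w by simp
  have t3: "tile_at y b e c f" using assms(3) adjacent_step[OF de(2) w(2)] unfolding t w by simp
  have abc: "{a, b, c} = UNIV"
    using t(1) t2 t3 by (intro distinct3_UNIV) (auto simp: tile_at_def)
  have L: "total_len = len a + len b + len c" using total_len_distinct[OF abc] by simp
  have h: "height (step y a d) = height y + of_int d * len a"
    using edge_at_height tile_at_edge_at t(1) by blast
  \<comment> \<open>Moving from \<open>y\<close> to \<open>u\<close> changes the height by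
    \<open>len a\<close>, the full width of the interval allowed for a tile with sides along
    \<open>b\<close> and \<open>c\<close>. The tile at \<open>y\<close> with these sides rules out
    its translate at \<open>u\<close>.\<close>
  have "\<not> tile_at (step y a d) b e c f"
    using t(1) t2 t3 de w(2) len_pos[of a] len_pos[of b] len_pos[of c] unfolding tile_at_def h L below_def
    by (auto split: if_splits)
  moreover have "u + v - y = step u b e" "u + w - y = step u c f" unfolding t w by simp_all
  ultimately show ?thesis using adjacent_step[OF de(2) w(2), of u b c] t(2) by metis
qed

section \<open>Counterclockwise labellings\<close>

text \<open>The six directions are numbered counterclockwise by integers modulo 6, starting with
  \<open>- e\<^sub>1\<close> at an angle of \<open>\<pi>/6\<close>.\<close>

definition sector_axis :: "int \<Rightarrow> 3" where
  "sector_axis m = (if m mod 3 = 0 then 1 else if m mod 3 = 1 then 3 else 2)"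

definition sector_dir :: "int \<Rightarrow> int" where
  "sector_dir m = (if even m then - 1 else 1)"

abbreviation sector_step :: "real^2 \<Rightarrow> int \<Rightarrow> real^2" where
  "sector_step z m \<equiv> step z (sector_axis m) (sector_dir m)"

abbreviation sector_edge :: "real^2 \<Rightarrow> int \<Rightarrow> bool" where
  "sector_edge z m \<equiv> edge_at z (sector_axis m) (sector_dir m)"

definition sector_angle :: "int \<Rightarrow> real" where
  "sector_angle m = pi / 6 + of_int m * (pi / 3)"

lemma dir3_simps: "dir3 1 = vector [- sqrt 3 / 2, - 1 / 2]" "dir3 2 = vector [sqrt 3 / 2, - 1 / 2]"
  "dir3 3 = vector [0, 1]"
  by (simp_all add: proj_def axis_def)

lemma sector_dir_pm: "sector_dir m \<in> {1, -1}" by (simp add: sector_dir_def)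

text \<open>Three sectors make a half turn, which negates the vector; the values at 30, 90 and 150
  degrees remain.\<close>

lemma sector_unit:
  "of_int (sector_dir m) *\<^sub>R dir3 (sector_axis m) = vector [cos (sector_angle m), sin (sector_angle m)]"
proof -
  define q r where "q = m div 3" and "r = m mod 3"
  have m: "m = 3 * q + r" by (simp add: q_def r_def)
  have ang: "sector_angle m = sector_angle r + pi * of_int q"
    by (simp add: sector_angle_def m algebra_simps)
  have cs: "cos (sector_angle m) = (if even q then 1 else -1) * cos (sector_angle r)"
    "sin (sector_angle m) = (if even q then 1 else -1) * sin (sector_angle r)"
    unfolding ang by (simp_all add: cos_add sin_add)
  have a2: "pi / 6 + 2 * (pi / 3) = pi - pi / 6" "pi / 6 + pi / 3 = pi / 2" by simp_all
  have r: "cos (sector_angle 0) = sqrt 3 / 2" "sin (sector_angle 0) = 1 / 2"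
    "cos (sector_angle 1) = 0" "sin (sector_angle 1) = 1"
    "cos (sector_angle 2) = - sqrt 3 / 2" "sin (sector_angle 2) = 1 / 2"
    unfolding sector_angle_def of_int_numeral of_int_1 of_int_0 mult_1 mult_zero_left add_0_right a2
    unfolding cos_pi_minus sin_pi_minus by (simp_all add: cos_30 sin_30)
  have mm: "m mod 3 = r" "even m \<longleftrightarrow> even (q + r)" by (simp add: r_def) (simp add: m)
  have "r = 0 \<or> r = 1 \<or> r = 2" using pos_mod_bound[of 3 m] pos_mod_sign[of 3 m] unfolding r_def by linarith
  then show ?thesis
    unfolding cs sector_dir_def sector_axis_def mm
    by (elim disjE) (auto simp: r dir3_simps vec_eq_iff forall_2)
qed

lemma sector_step_eq: "sector_step z m = z + vector [cos (sector_angle m), sin (sector_angle m)]"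
  by (simp add: sector_unit)

lemma ex_sector:
  assumes "d \<in> {1, -1}" shows "\<exists>m. sector_axis m = a \<and> sector_dir m = d"
proof -
  have "(sector_axis 0, sector_dir 0) = (1, -1)" "(sector_axis 1, sector_dir 1) = (3, 1)"
    "(sector_axis 2, sector_dir 2) = (2, -1)" "(sector_axis 3, sector_dir 3) = (1, 1)"
    "(sector_axis 4, sector_dir 4) = (3, -1)" "(sector_axis 5, sector_dir 5) = (2, 1)"
    by (simp_all add: sector_axis_def sector_dir_def)
  then show ?thesis using assms exhaust_3[of a] by (metis insertE singletonD prod.inject)
qed

text \<open>The axis determines the residue modulo 3 and the direction the parity.\<close>

lemma sector_cong:
  assumes "sector_axis m = sector_axis m'" "sector_dir m = sector_dir m'" shows "6 dvd m - m'"
proof -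
  have "m mod 3 = m' mod 3"
    using assms(1) pos_mod_bound[of 3 m] pos_mod_sign[of 3 m] pos_mod_bound[of 3 m'] pos_mod_sign[of 3 m']
    unfolding sector_axis_def by (auto split: if_splits)
  moreover have "m mod 2 = m' mod 2"
    using assms(2) unfolding sector_dir_def by (auto split: if_splits simp: parity_cases) presburger+
  ultimately show ?thesis by presburger
qed

lemma sector_angle_mono: "sector_angle m < sector_angle m' \<longleftrightarrow> m < m'"
  by (simp add: sector_angle_def)

lemma sector_periodic: "sector_axis (m + 6) = sector_axis m" "sector_dir (m + 6) = sector_dir m"
proof -
  have "(m + 6) mod 3 = m mod 3" by presburger
  then show "sector_axis (m + 6) = sector_axis m" "sector_dir (m + 6) = sector_dir m"
    by (simp_all add: sector_axis_def sector_dir_def)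
qed

lemma sector_step_inj:
  assumes "sector_step z m = sector_step z m'" shows "6 dvd m - m'"
  using sector_cong step_inj[OF sector_dir_pm sector_dir_pm assms] by blast

lemma len_order: "len 3 < len 2" "len 2 < len 1"
  using alpha_bounds alpha_sq_bounds by (simp_all add: len_simps)

text \<open>Below height \<open>len 2\<close> the downward edges along axes 1 and 2 are both
  missing, and from height \<open>total_len - len 2\<close> on the upward ones are; either way at
  most four edges remain.\<close>

lemma height_five:
  assumes "n_vertex n z" "n \<ge> 5"
  shows "len 2 \<le> height z" "height z < total_len - len 2"
proof -
  have c: "card {y. edge z y} \<ge> 5" using assms by (simp add: n_vertex_def)
  have no: False if "{y. edge z y} \<subseteq> {p, q, r, t}" for p q r t
  proof -
    have "card {y. edge z y} \<le> card {p, q, r, t}" using that by (intro card_mono) auto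
    also have "\<dots> \<le> 4" by (simp add: card_insert_if)
    finally show False using c by simp
  qed
  show "len 2 \<le> height z"
  proof (rule ccontr)
    assume "\<not> len 2 \<le> height z"
    then have "\<not> edge_at z 2 (-1)" "\<not> edge_at z 1 (-1)"
      using len_order by (auto simp: edge_at_def below_def)
    then have "{y. edge z y} \<subseteq> {step z 1 1, step z 2 1, step z 3 1, step z 3 (-1)}"
      using exhaust_3 unfolding edge_iff edge_at_def by (smt (verit) insertCI insertE mem_Collect_eq singletonD subsetI)
    then show False by (rule no)
  qed
  show "height z < total_len - len 2"
  proof (rule ccontr)
    assume "\<not> height z < total_len - len 2"
    then have "\<not> edge_at z 2 1" "\<not> edge_at z 1 1"
      using len_order by (auto simp: edge_at_def below_def)
    then have "{y. edge z y} \<subseteq> {step z 1 (-1), step z 2 (-1), step z 3 1, step z 3 (-1)}"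
      using exhaust_3 unfolding edge_iff edge_at_def by (smt (verit) insertCI insertE mem_Collect_eq singletonD subsetI)
    then show False by (rule no)
  qed
qed

text \<open>With one step up and one down, the lower bound for the tile is that of the downward edge
  and the upper bound that of the upward edge.\<close>

lemma tile_at_opposite_dirs:
  assumes "edge_at z a d" "edge_at z b e" "a \<noteq> b" "d \<noteq> e" shows "tile_at z a d b e"
  using assms unfolding edge_at_def tile_at_def below_def by auto

text \<open>Under the height bounds all edges along axes 2 and 3 exist, so at most one sector is
  skipped between consecutive edges. Neighbouring sectors have opposite signs, which gives the tile
  directly.\<close>

lemma next_sector_tile:
  assumes h: "len 2 \<le> height z" "height z < total_len - len 2"
    and e: "sector_edge z m" "sector_edge z m'" and m: "m < m'"
    and gap: "\<And>i. m < i \<Longrightarrow> i < m' \<Longrightarrow> \<not> sector_edge z i"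
  shows "tile_at z (sector_axis m) (sector_dir m) (sector_axis m') (sector_dir m')"
proof -
  have z: "z \<in> vertices" using e by (simp add: edge_at_def)
  have pr: "sector_edge z i" if "i mod 3 \<noteq> 0" for i
  proof -
    have "sector_axis i = 2 \<or> sector_axis i = 3" using that by (auto simp: sector_axis_def)
    then show ?thesis
      using h len_order len_pos[of 2] z vertices_lift(2,3)[OF z] sector_dir_pm[of i]
      unfolding edge_at_def below_def by auto
  qed
  have "m' \<le> m + 2"
  proof (rule ccontr)
    assume "\<not> m' \<le> m + 2"
    then have "\<not> sector_edge z (m + 1)" "\<not> sector_edge z (m + 2)" using gap by simp_all
    then have "(m + 1) mod 3 = 0" "(m + 2) mod 3 = 0" using pr by blast+
    then show False by presburger
  qed
  then consider "m' = m + 1" | "m' = m + 2" using m by linarith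
  then show ?thesis
  proof cases
    case 1
    have "sector_axis m \<noteq> sector_axis m'" "sector_dir m \<noteq> sector_dir m'"
      unfolding 1 sector_axis_def sector_dir_def by (auto split: if_splits) presburger+
    then show ?thesis using tile_at_opposite_dirs e by blast
  next
    \<comment> \<open>The missing edge lies along axis 1. Its absence supplies the one remaining
      bound for the tile with sides along axes 2 and 3.\<close>
    case 2
    then have n: "\<not> sector_edge z (m + 1)" using gap by simp
    then have m1: "(m + 1) mod 3 = 0" using pr by blast
    then have mm: "m mod 3 = 2" "m' mod 3 = 1" unfolding 2 by presburger+
    have ax: "sector_axis m = 2" "sector_axis m' = 3" "sector_axis (m + 1) = 1" "sector_dir m' = sector_dir m"
      "sector_dir (m + 1) = - sector_dir m"
      using mm m1 2 by (simp_all add: sector_axis_def sector_dir_def)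
    have d: "sector_dir m \<in> {1, -1}" by (rule sector_dir_pm)
    have "0 \<le> height z" "height z < total_len" using vertices_lift[OF z] by auto
    then show ?thesis using n d z unfolding ax edge_at_def tile_at_def below_def by auto
  qed
qed

text \<open>The sectors are integers, not residues modulo 6, chosen such that
  \<open>sector_angle (M j)\<close> is \<open>t j\<close>. The order and the window of length 2 pi
  then carry over to \<open>M\<close>.\<close>

lemma ccw_sectors:
  assumes "ccw_labelling z n x"
  obtains M where "\<And>j. j \<in> {1..n} \<Longrightarrow> sector_edge z (M j) \<and> x j = sector_step z (M j)"
    "\<And>i j. i \<in> {1..n} \<Longrightarrow> j \<in> {1..n} \<Longrightarrow> i < j \<Longrightarrow> M i < M j"
    "\<And>i j. i \<in> {1..n} \<Longrightarrow> j \<in> {1..n} \<Longrightarrow> M j < M i + 6"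
proof -
  obtain \<theta> t where t: "strict_mono_on {1..n} t" "\<And>j. j \<in> {1..n} \<Longrightarrow> t j \<in> {\<theta>..<\<theta> + 2 * pi}"
    "\<And>j. j \<in> {1..n} \<Longrightarrow> x j - z = norm (x j - z) *\<^sub>R vector [cos (t j), sin (t j)]"
    and bij: "bij_betw x {1..n} {y. edge z y}"
    using assms unfolding ccw_labelling_def by blast
  have "\<exists>m. sector_edge z m \<and> x j = sector_step z m \<and> t j = sector_angle m" if j: "j \<in> {1..n}" for j
  proof -
    have "edge z (x j)" using bij_betwE[OF bij] j by blast
    then obtain a d where ad: "edge_at z a d" "x j = step z a d" using edge_iff by blast
    then obtain m where m: "sector_axis m = a" "sector_dir m = d"
      using ex_sector[of d a] by (auto simp: edge_at_def)
    have xm: "x j - z = vector [cos (sector_angle m), sin (sector_angle m)]"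
      using ad m sector_step_eq[of z m] by simp
    have "norm (x j - z) = 1"
      unfolding xm norm_vec_def L2_set_def by (simp add: sum_2)
    then have "vector [cos (sector_angle m), sin (sector_angle m)] = (vector [cos (t j), sin (t j)] :: real^2)"
      using t(3)[OF j] xm by simp
    then have "cos (t j) = cos (sector_angle m)" "sin (t j) = sin (sector_angle m)"
      by (simp_all add: vec_eq_iff forall_2)
    then obtain k :: int where k: "t j = sector_angle m + 2 * pi * of_int k"
      using sin_cos_eq_iff[of "t j" "sector_angle m"] by blast
    have p: "sector_axis (m + 6 * k) = sector_axis m" "sector_dir (m + 6 * k) = sector_dir m"
      by (simp_all add: sector_axis_def sector_dir_def) presburger+
    have "t j = sector_angle (m + 6 * k)" unfolding k sector_angle_def by (simp add: algebra_simps)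
    then show ?thesis using ad m p by metis
  qed
  then obtain M where M: "\<And>j. j \<in> {1..n} \<Longrightarrow> sector_edge z (M j) \<and> x j = sector_step z (M j) \<and> t j = sector_angle (M j)"
    by metis
  show thesis
  proof (rule that)
    show "sector_edge z (M j) \<and> x j = sector_step z (M j)" if "j \<in> {1..n}" for j using M[OF that] by blast
    show "M i < M j" if "i \<in> {1..n}" "j \<in> {1..n}" "i < j" for i j
      using strict_mono_onD[OF t(1) that] M that sector_angle_mono by metis
    show "M j < M i + 6" if "i \<in> {1..n}" "j \<in> {1..n}" for i j
    proof -
      have "t j < t i + 2 * pi" using t(2)[OF that(1)] t(2)[OF that(2)] by auto
      moreover have "sector_angle (M i + 6) = sector_angle (M i) + 2 * pi" by (simp add: sector_angle_def algebra_simps)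
      ultimately have "sector_angle (M j) < sector_angle (M i + 6)" using M that by metis
      then show ?thesis by (simp only: sector_angle_mono)
    qed
  qed
qed

lemma ccw_adjacent:
  assumes "n_vertex n z" "n \<ge> 5" "ccw_labelling z n x"
  shows "j \<in> {1..<n} \<Longrightarrow> adjacent z (x j) (x (Suc j))" "adjacent z (x n) (x 1)"
proof -
  obtain M where M: "\<And>j. j \<in> {1..n} \<Longrightarrow> sector_edge z (M j) \<and> x j = sector_step z (M j)"
    and mono: "\<And>i j. i \<in> {1..n} \<Longrightarrow> j \<in> {1..n} \<Longrightarrow> i < j \<Longrightarrow> M i < M j"
    and win: "\<And>i j. i \<in> {1..n} \<Longrightarrow> j \<in> {1..n} \<Longrightarrow> M j < M i + 6"
    using ccw_sectors[OF assms(3)] by blast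
  note h = height_five[OF assms(1,2)]
  have one: "(1::nat) \<in> {1..n}" and nn: "n \<in> {1..n}" using assms(2) by auto
  have first: "M 1 \<le> M i" if "i \<in> {1..n}" for i using mono[OF one that] that by (cases "i = 1") auto
  \<comment> \<open>Every edge within one turn from sector \<open>M 1\<close> on is labelled, so no
    edge lies strictly between consecutive labels.\<close>
  have found: "\<exists>i\<in>{1..n}. m = M i" if m: "sector_edge z m" "M 1 \<le> m" "m < M 1 + 6" for m
  proof -
    have "edge z (sector_step z m)" using m(1) by (rule edge_at_edge)
    then obtain i where i: "i \<in> {1..n}" "x i = sector_step z m"
      using assms(3) unfolding ccw_labelling_def bij_betw_def by (metis (mono_tags) imageE mem_Collect_eq)
    then have "6 dvd m - M i" using sector_step_inj[of z m "M i"] M by metis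
    moreover have "M i < M 1 + 6" "M 1 \<le> M i" using win[OF one i(1)] first[OF i(1)] by auto
    ultimately have "m = M i" using m(2,3) by presburger
    then show ?thesis using i by blast
  qed
  show "adjacent z (x j) (x (Suc j))" if j: "j \<in> {1..<n}"
  proof -
    have j2: "j \<in> {1..n}" "Suc j \<in> {1..n}" using j by auto
    have "tile_at z (sector_axis (M j)) (sector_dir (M j)) (sector_axis (M (Suc j))) (sector_dir (M (Suc j)))"
    proof (rule next_sector_tile[OF h])
      fix m assume m: "M j < m" "m < M (Suc j)"
      show "\<not> sector_edge z m"
      proof
        assume "sector_edge z m"
        then obtain i where i: "i \<in> {1..n}" "m = M i"
          using found[of m] m first[OF j2(1)] win[OF one j2(2)] by auto
        show False using m mono[OF i(1) j2(1)] mono[OF j2(2) i(1)] i by (cases "i < j"; cases "i = j"; cases "i = Suc j") auto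
      qed
    qed (use M j2 mono in auto)
    then show ?thesis using adjacent_step[OF sector_dir_pm sector_dir_pm] M j2 by metis
  qed
  \<comment> \<open>The last and the first neighbour are consecutive once the first sector is
    advanced by a full turn.\<close>
  have "tile_at z (sector_axis (M n)) (sector_dir (M n)) (sector_axis (M 1 + 6)) (sector_dir (M 1 + 6))"
  proof (rule next_sector_tile[OF h])
    show "sector_edge z (M 1 + 6)" using M[OF one] by (simp add: sector_periodic)
    show "sector_edge z (M n)" "M n < M 1 + 6" using M[OF nn] win[OF one nn] by auto
    fix m assume m: "M n < m" "m < M 1 + 6"
    show "\<not> sector_edge z m"
    proof
      assume "sector_edge z m"
      then obtain i where i: "i \<in> {1..n}" "m = M i"
        using found[of m] m first[OF nn] by auto
      show False using m mono[OF i(1) nn] i by (cases "i = n") auto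
    qed
  qed
  then show "adjacent z (x n) (x 1)"
    using adjacent_step[OF sector_dir_pm sector_dir_pm] M one nn unfolding sector_periodic by metis
qed

section \<open>Coefficients of the socle functional\<close>

definition edge_axis :: "real^2 \<Rightarrow> real^2 \<Rightarrow> 3" where
  "edge_axis z x = (THE a. \<exists>d. d \<in> {1, -1} \<and> x = step z a d)"

definition edge_dir :: "real^2 \<Rightarrow> real^2 \<Rightarrow> int" where
  "edge_dir z x = (THE d. d \<in> {1, -1} \<and> (\<exists>a. x = step z a d))"

lemma edge_axis_step:
  assumes "d \<in> {1, -1}" shows "edge_axis z (step z a d) = a"
  unfolding edge_axis_def
proof (rule the_equality)
  show "\<exists>e. e \<in> {1, -1} \<and> step z a d = step z a e" using assms by blast
next
  fix b assume "\<exists>e. e \<in> {1, -1} \<and> step z a d = step z b e"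
  then show "b = a" using step_inj(1)[OF assms] by metis
qed

lemma edge_dir_step:
  assumes "d \<in> {1, -1}" shows "edge_dir z (step z a d) = d"
  unfolding edge_dir_def
proof (rule the_equality)
  show "d \<in> {1, -1} \<and> (\<exists>b. step z a d = step z b d)" using assms by blast
next
  fix e assume "e \<in> {1, -1} \<and> (\<exists>b. step z a d = step z b e)"
  then show "e = d" using step_inj(2)[OF assms] by metis
qed

text \<open>For any axis \<open>b\<close> other than that of the edge, this is \<open>\<plusminus>1\<close> or \<open>0\<close> according to which of the directions
  \<open>\<plusminus>b\<close> bound a tile with the edge; see \<open>turn_eq\<close>.\<close>

definition turn :: "real^2 \<Rightarrow> real^2 \<Rightarrow> int" where
  "turn z x = int (card {b. tile_at z (edge_axis z x) (edge_dir z x) b 1}) - 1"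

text \<open>The direction \<open>- b\<close> bounds a tile exactly when \<open>c\<close> does not.
  The difference is therefore the number of axes whose positive direction bounds a tile, minus 1,
  whichever axis is taken as \<open>b\<close>.\<close>

lemma turn_eq:
  assumes "edge_at z a d" "b \<noteq> a"
  shows "of_bool (tile_at z a d b 1) - of_bool (tile_at z a d b (-1)) = turn z (step z a d)"
proof -
  have d: "d \<in> {1, -1}" using assms by (simp add: edge_at_def)
  obtain c where "{a, b, c} = UNIV" using third_axis[of a b] assms(2) by metis
  then have acb: "{a, c, b} = UNIV" by (simp add: insert_commute)
  note dc = distinct3_cases[OF acb]
  have s: "tile_at z a d b (-1) \<longleftrightarrow> \<not> tile_at z a d c 1" using tile_at_sides[OF assms(1) acb] .
  have "{b'. tile_at z a d b' 1} = (if tile_at z a d b 1 then {b} else {}) \<union> (if tile_at z a d c 1 then {c} else {})"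
  proof (rule Set.set_eqI)
    fix b' show "b' \<in> {b'. tile_at z a d b' 1} \<longleftrightarrow>
        b' \<in> (if tile_at z a d b 1 then {b} else {}) \<union> (if tile_at z a d c 1 then {c} else {})"
      using dc(4)[of b'] tile_at_neq[of z a d b' 1] by auto
  qed
  then have "int (card {b'. tile_at z a d b' 1}) = of_bool (tile_at z a d b 1) + of_bool (tile_at z a d c 1)"
    using dc by auto
  then show ?thesis unfolding turn_def edge_axis_step[OF d] edge_dir_step[OF d] s by auto
qed

context
  fixes s :: "3 \<Rightarrow> real^2 \<Rightarrow> int"
begin

definition edge_sign :: "real^2 \<Rightarrow> real^2 \<Rightarrow> int" where
  "edge_sign z x = s (edge_axis z x) z"

text \<open>The value of the functional on the loop \<open>z, x, y, w, z\<close>. Up to a scalar for each \<open>z\<close>, it is forced by the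
  relations; the scalar is chosen such that a loop around a rhombus gets the value \<open>- s\<^sub>a(z) s\<^sub>b(z)\<close>.\<close>

definition socle_coeff :: "real^2 \<Rightarrow> real^2 \<Rightarrow> real^2 \<Rightarrow> real^2 \<Rightarrow> int" where
  "socle_coeff z x y w =
     (if y = z then
        if x = w then - edge_dir z x * turn z x
        else if adjacent z x w then - edge_sign z x * edge_sign z w else 0
      else if \<exists>v. tile_corners z x y v \<and> (w = x \<or> w = v) then - edge_sign z x * edge_sign z (z + y - x)
      else 0)"

lemma socle_coeff_zero:
  assumes "y \<noteq> z" "\<not> (\<exists>v. tile_corners z x y v \<and> (w = x \<or> w = v))"
  shows "socle_coeff z x y w = 0"
  unfolding socle_coeff_def using assms by (simp only: if_False)

lemma socle_coeff_tile:
  assumes "tile_corners z x y v"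
  shows "socle_coeff z x y x = - edge_sign z x * edge_sign z v"
    "socle_coeff z x y v = - edge_sign z x * edge_sign z v"
proof -
  have "z + y - x = v" "y \<noteq> z" using tile_corners_fourth[OF assms] tile_corners_neq[OF assms] by auto
  then show "socle_coeff z x y x = - edge_sign z x * edge_sign z v"
    "socle_coeff z x y v = - edge_sign z x * edge_sign z v"
    using assms unfolding socle_coeff_def by auto
qed

lemma socle_coeff_back:
  assumes "adjacent z x w" shows "socle_coeff z x z w = - edge_sign z x * edge_sign z w"
  using assms adjacent_neq[OF assms] by (simp add: socle_coeff_def)

text \<open>Reversing a loop does not change its value, so statements about the start of a loop
  yield statements about its end.\<close>

lemma socle_coeff_commute: "socle_coeff z x y w = socle_coeff z w y x"
proof (cases "y = z")
  case True
  then show ?thesis by (auto simp: socle_coeff_def adjacent_sym)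
next
  case False
  show ?thesis
  proof (cases "\<exists>v. tile_corners z x y v \<and> (w = x \<or> w = v)")
    case True
    then show ?thesis
      using socle_coeff_tile tile_corners_reflect by (metis mult.commute mult_minus_left)
  next
    case F: False
    have "\<not> (\<exists>v. tile_corners z w y v \<and> (x = w \<or> x = v))"
      using F tile_corners_reflect by blast
    then show ?thesis using F False socle_coeff_zero by metis
  qed
qed

text \<open>The first kind of relations, placed at the start, at the end and in the middle of a loop
  of length four.\<close>

lemma socle_coeff_nonadjacent:
  assumes "\<not> adjacent y x w" "x \<noteq> w"
  shows "socle_coeff x y w v = 0" "socle_coeff w v x y = 0" "socle_coeff z x y w = 0"
proof -
  have a: "\<not> adjacent y w x" using assms(1) adjacent_sym by blast
  have 1: "socle_coeff x y w v = 0" if "\<not> adjacent y x w" "x \<noteq> w" for x w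
    using that tile_corners_adjacent(2) unfolding socle_coeff_def by auto
  show "socle_coeff x y w v = 0" using 1 assms .
  show "socle_coeff w v x y = 0" using 1[OF a] assms(2) socle_coeff_commute by metis
  show "socle_coeff z x y w = 0"
    using assms tile_corners_adjacent(3) unfolding socle_coeff_def by auto
qed

text \<open>The second kind of relations in the same three positions.\<close>

lemma socle_coeff_rhombus:
  assumes "tile_corners x u y v"
  shows "socle_coeff x u y w = socle_coeff x v y w" "socle_coeff y w x u = socle_coeff y w x v"
    "socle_coeff z x u y = socle_coeff z x v y"
proof -
  have 1: "socle_coeff x u y w = socle_coeff x v y w" if "tile_corners x u y v" for x u y v
  proof -
    have t: "tile_corners x v y u" using tile_corners_reflect[OF that] .
    show ?thesis
    proof (cases "w = u \<or> w = v")
      case True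
      then show ?thesis using socle_coeff_tile[OF that] socle_coeff_tile[OF t] by auto
    next
      case False
      then have "\<not> (\<exists>v'. tile_corners x u y v' \<and> (w = u \<or> w = v'))" "\<not> (\<exists>v'. tile_corners x v y v' \<and> (w = v \<or> w = v'))"
        using tile_corners_opposite[OF that] tile_corners_opposite[OF t] by blast+
      then show ?thesis using tile_corners_neq(1)[OF that] by (auto simp: socle_coeff_def)
    qed
  qed
  show "socle_coeff x u y w = socle_coeff x v y w" using 1[OF assms] .
  have "tile_corners y u x v" using assms by (meson tile_corners_rotate tile_corners_reflect)
  from 1[OF this] show "socle_coeff y w x u = socle_coeff y w x v" using socle_coeff_commute by metis
  have 2: "socle_coeff u x u y = socle_coeff u x v y" if "tile_corners x u y v" for x u y v
  proof -
    have t: "tile_corners u x v y" using that by (meson tile_corners_rotate tile_corners_reflect)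
    show ?thesis using socle_coeff_tile(2)[OF t] socle_coeff_back[OF tile_corners_adjacent(1)[OF t]] by simp
  qed
  \<comment> \<open>A tile containing the whole loop would force \<open>z = v\<close>, so both sides
    vanish for a base other than \<open>u\<close> and \<open>v\<close>.\<close>
  have 3: "socle_coeff z x u y = 0" if "tile_corners x u y v" "z \<noteq> u" "z \<noteq> v" for u v
  proof -
    have "\<not> (\<exists>v'. tile_corners z x u v' \<and> (y = x \<or> y = v'))"
    proof
      assume "\<exists>v'. tile_corners z x u v' \<and> (y = x \<or> y = v')"
      then have "tile_corners z x u y" using tile_corners_neq(1)[OF that(1)] by auto
      then have "u = x + y - z" by (rule tile_corners_fourth)
      moreover have "y = u + v - x" using that(1) by (rule tile_corners_fourth)
      ultimately show False using that(3) by simp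
    qed
    then show ?thesis using that(2) socle_coeff_zero by metis
  qed
  show "socle_coeff z x u y = socle_coeff z x v y"
    using 2[OF assms] 2[OF tile_corners_reflect[OF assms]] 3[OF assms] 3[OF tile_corners_reflect[OF assms]]
    by metis
qed

text \<open>The value of the functional when \<open>signed_loops s a z\<close> is inserted into a
  path, \<open>F y\<close> being the value with the loop through \<open>y\<close>; see
  \<open>sandwich_signed_loops\<close>.\<close>

definition axis_sum :: "3 \<Rightarrow> real^2 \<Rightarrow> (real^2 \<Rightarrow> int) \<Rightarrow> int" where
  "axis_sum a z F = s a z * ((if edge z (step z a 1) then F (step z a 1) else 0)
     - (if edge z (step z a (-1)) then F (step z a (-1)) else 0))"

lemma axis_sum_own:
  assumes "d \<in> {1, -1}" "edge z (step z a d)" "\<And>e. e \<in> {1, -1} \<Longrightarrow> e \<noteq> d \<Longrightarrow> F (step z a e) = 0"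
  shows "axis_sum a z F = s a z * d * F (step z a d)"
proof (cases "d = 1")
  case True then show ?thesis using assms(2) assms(3)[of "-1"] unfolding axis_sum_def by auto
next
  case False
  then have d: "d = -1" using assms(1) by simp
  show ?thesis using assms(2) assms(3)[of 1] unfolding axis_sum_def d by simp
qed

context
  assumes sc: "sign_choice s"
begin

lemma sign_square: "z \<in> vertices \<Longrightarrow> s a z * s a z = 1"
  using sc unfolding sign_choice_def by (metis insertE mult_1 mult_minus1 minus_minus singletonD)

lemma sign_step:
  assumes "edge z (step z a d)" "d \<in> {1, -1}"
  shows "s a (step z a d) = - s a z" "c \<noteq> a \<Longrightarrow> s c (step z a d) = s c z"
proof -
  have "step z a d = z + proj (unit3 a) \<or> step z a d = z - proj (unit3 a)" using assms(2) by auto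
  then show "s a (step z a d) = - s a z" "c \<noteq> a \<Longrightarrow> s c (step z a d) = s c z"
    using sc assms(1) unfolding sign_choice_def by blast+
qed

text \<open>The right-hand side is free of \<open>a\<close>, as the third kind of relations
  requires. Along the axis of the edge only \<open>x\<close> itself contributes; along another axis
  a step contributes when it bounds a tile with the edge, and \<open>turn_eq\<close> gives the
  difference.\<close>

lemma axis_sum_base:
  assumes "edge z x"
  shows "axis_sum a z (\<lambda>y. socle_coeff z y z x) = - edge_sign z x * turn z x"
proof -
  obtain b e where x: "edge_at z b e" "x = step z b e" using assms edge_iff by blast
  have e: "e \<in> {1, -1}" and z: "z \<in> vertices" using x(1) by (auto simp: edge_at_def)
  have sx: "edge_sign z x = s b z" unfolding edge_sign_def x edge_axis_step[OF e] ..
  show ?thesis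
  proof (cases "a = b")
    case True
    have 0: "socle_coeff z (step z b d) z x = 0" if d: "d \<in> {1, -1}" "d \<noteq> e" for d
    proof -
      have "step z b d \<noteq> x" using step_inj(2)[OF d(1) e] d(2) unfolding x by blast
      moreover have "\<not> adjacent z (step z b d) x"
        using adjacent_step[OF d(1) e] tile_at_neq unfolding x by blast
      ultimately show ?thesis by (simp add: socle_coeff_def)
    qed
    have "axis_sum b z (\<lambda>y. socle_coeff z y z x) = s b z * e * socle_coeff z x z x"
      using axis_sum_own[of e z b "\<lambda>y. socle_coeff z y z x"] e 0 assms unfolding x by blast
    also have "\<dots> = s b z * (- (e * e) * turn z x)"
      unfolding socle_coeff_def x by (simp add: edge_dir_step[OF e])
    also have "e * e = 1" using e by auto
    finally show ?thesis using sx True by simp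
  next
    case False
    have 1: "(if edge z (step z a d) then socle_coeff z (step z a d) z x else 0)
        = - s a z * s b z * of_bool (tile_at z b e a d)" if d: "d \<in> {1, -1}" for d
    proof (cases "tile_at z b e a d")
      case True
      then have "edge z (step z a d)" "adjacent z (step z a d) x"
        using tile_at_edge_at(2) edge_at_edge adjacent_step[OF d e] tile_at_commute unfolding x by blast+
      moreover have "edge_sign z (step z a d) = s a z" unfolding edge_sign_def edge_axis_step[OF d] ..
      ultimately show ?thesis using True socle_coeff_back sx by simp
    next
      case F: False
      have "step z a d \<noteq> x" using step_inj(1)[OF d e] False unfolding x by blast
      moreover have "\<not> adjacent z (step z a d) x"
        using adjacent_step[OF d e] tile_at_commute F unfolding x by blast
      ultimately show ?thesis using F by (simp add: socle_coeff_def)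
    qed
    have "axis_sum a z (\<lambda>y. socle_coeff z y z x)
        = - (s a z * s a z) * s b z * (of_bool (tile_at z b e a 1) - of_bool (tile_at z b e a (-1)))"
      unfolding axis_sum_def using 1[of 1] 1[of "-1"] by (simp add: algebra_simps)
    also have "\<dots> = - s b z * turn z x"
      using turn_eq[OF x(1) False] sign_square[OF z] x(2) by simp
    finally show ?thesis using sx by simp
  qed
qed

text \<open>Inserting the loops at the far vertex \<open>x\<close> gives the same value, because the
  tiles beside the edge at \<open>x\<close> are those beside it at \<open>z\<close>.\<close>

lemma axis_sum_middle:
  assumes "edge z x"
  shows "axis_sum a x (\<lambda>y. socle_coeff z x y x) = - edge_sign z x * turn z x"
proof -
  obtain b e where x: "edge_at z b e" "x = step z b e" using assms edge_iff by blast
  have e: "e \<in> {1, -1}" and z: "z \<in> vertices" using x(1) by (auto simp: edge_at_def)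
  have sx: "edge_sign z x = s b z" unfolding edge_sign_def x edge_axis_step[OF e] ..
  have ee: "edge z (step z b e)" using assms x by simp
  show ?thesis
  proof (cases "a = b")
    case True
    have bk: "step x b (- e) = z" unfolding x by simp
    have me: "- e \<in> {1, -1}" using e by auto
    have 0: "socle_coeff z x (step x b d) x = 0" if d: "d \<in> {1, -1}" "d \<noteq> - e" for d
    proof -
      have d': "d = e" using d e by auto
      have "\<not> tile_corners z x (step (step z b e) b e) v" for v
        using tile_corners_imp_tile_at[of z x "step (step z b e) b e" v] step2_straight[OF e] tile_at_neq tile_at_signs
        by metis
      moreover have "step (step z b e) b e \<noteq> z" using step2_back[OF e e, of z b b] e by auto
      ultimately show ?thesis unfolding d' by (simp add: socle_coeff_def x)
    qed
    have "axis_sum b x (\<lambda>y. socle_coeff z x y x) = s b x * (- e) * socle_coeff z x z x"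
      using axis_sum_own[of "- e" x b "\<lambda>y. socle_coeff z x y x", unfolded bk, OF me edge_sym[OF assms]] 0 by blast
    \<comment> \<open>Seen from \<open>x\<close> the edge has the opposite direction and the
      opposite sign, and the two changes cancel.\<close>
    also have "s b x = - s b z" using sign_step(1)[OF ee e] x by simp
    also have "- s b z * - e * socle_coeff z x z x = s b z * (- (e * e) * turn z x)"
      unfolding socle_coeff_def x by (simp add: edge_dir_step[OF e])
    also have "e * e = 1" using e by auto
    finally show ?thesis using sx True by simp
  next
    case False
    have sa: "s a x = s a z" using sign_step(2)[OF ee e False] x by simp
    have 1: "(if edge x (step x a d) then socle_coeff z x (step x a d) x else 0)
        = - s a z * s b z * of_bool (tile_at z b e a d)" if d: "d \<in> {1, -1}" for d
    proof (cases "tile_at z b e a d")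
      case True
      then have t: "tile_corners z x (step x a d) (step z a d)" unfolding x by (rule tile_at_imp_tile_corners)
      then have "edge x (step x a d)" unfolding edge_def using tile_corners_rotate by blast
      then show ?thesis using True socle_coeff_tile(1)[OF t] sx
        unfolding edge_sign_def[of z "step z a d"] edge_axis_step[OF d] by simp
    next
      case F: False
      have "step x a d \<noteq> z" using step2_back[OF e d] False unfolding x by blast
      moreover have "\<not> tile_corners z x (step x a d) v" for v
      proof
        assume t: "tile_corners z x (step x a d) v"
        then have "v = step z a d" using tile_corners_fourth[OF t] unfolding x by (simp add: algebra_simps)
        then show False using tile_corners_step[OF _ e d] t F unfolding x by blast
      qed
      ultimately show ?thesis using F by (simp add: socle_coeff_def)
    qed
    have "axis_sum a x (\<lambda>y. socle_coeff z x y x)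
        = - (s a z * s a z) * s b z * (of_bool (tile_at z b e a 1) - of_bool (tile_at z b e a (-1)))"
      unfolding axis_sum_def using 1[of 1] 1[of "-1"] sa by (simp add: algebra_simps)
    also have "\<dots> = - s b z * turn z x"
      using turn_eq[OF x(1) False] sign_square[OF z] x(2) by simp
    finally show ?thesis using sx by simp
  qed
qed

end
end

section \<open>Generated ideals and functionals\<close>

lemma two_sided_idealI:
  assumes "J \<subseteq> path_span V E" "0 \<in> J" "\<And>f g. f \<in> J \<Longrightarrow> g \<in> J \<Longrightarrow> f + g \<in> J" "\<And>f. f \<in> J \<Longrightarrow> - f \<in> J"
    and "\<And>f a. f \<in> J \<Longrightarrow> a \<in> path_span V E \<Longrightarrow> path_mult a f \<in> J \<and> path_mult f a \<in> J"
  shows "two_sided_ideal (path_algebra V E) J"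
proof -
  have "subgroup J (add_monoid (path_algebra V E))"
  proof (rule subgroup.intro)
    show "inv\<^bsub>add_monoid (path_algebra V E)\<^esub> x \<in> J" if "x \<in> J" for x
      using assms(1,4) that path_algebra_a_inv[of x V E] by (auto simp: a_inv_def)
  qed (use assms in \<open>auto simp: path_algebra_simps\<close>)
  then show ?thesis unfolding two_sided_ideal_def additive_subgroup_def path_algebra_simps using assms(5) by blast
qed

lemma generated_ideal_path:
  assumes "S \<subseteq> path_span V E"
  shows "two_sided_ideal (path_algebra V E) (generated_ideal (path_algebra V E) S)"
    and "S \<subseteq> generated_ideal (path_algebra V E) S"
proof -
  have c: "two_sided_ideal (path_algebra V E) (path_span V E)"
    by (rule two_sided_idealI) (auto simp: path_span_add path_span_minus path_span_mult)
  have J: "path_algebra_quotient V E J" if "two_sided_ideal (path_algebra V E) J" for J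
    using that by (rule path_algebra_quotient.intro)
  show "S \<subseteq> generated_ideal (path_algebra V E) S" unfolding generated_ideal_def by blast
  show "two_sided_ideal (path_algebra V E) (generated_ideal (path_algebra V E) S)"
  proof (rule two_sided_idealI)
    show "generated_ideal (path_algebra V E) S \<subseteq> path_span V E"
      unfolding generated_ideal_def using c assms by blast
    show "0 \<in> generated_ideal (path_algebra V E) S"
      unfolding generated_ideal_def using path_algebra_quotient.I_zero[OF J] by blast
    show "f + g \<in> generated_ideal (path_algebra V E) S"
      if "f \<in> generated_ideal (path_algebra V E) S" "g \<in> generated_ideal (path_algebra V E) S" for f g
      using that unfolding generated_ideal_def using path_algebra_quotient.I_add[OF J] by blast
    show "- f \<in> generated_ideal (path_algebra V E) S" if "f \<in> generated_ideal (path_algebra V E) S" for f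
      using that unfolding generated_ideal_def using path_algebra_quotient.I_minus[OF J] by blast
    show "path_mult a f \<in> generated_ideal (path_algebra V E) S \<and> path_mult f a \<in> generated_ideal (path_algebra V E) S"
      if "f \<in> generated_ideal (path_algebra V E) S" "a \<in> path_span V E" for f a
      using that unfolding generated_ideal_def using path_algebra_quotient.I_mult[OF J] by blast
  qed
qed

section \<open>Linear functionals on a path algebra\<close>

definition path_functional :: "('v list \<Rightarrow> 'k) \<Rightarrow> ('v list \<Rightarrow>\<^sub>0 'k::field) \<Rightarrow> 'k" where
  "path_functional w f = (\<Sum>q\<in>Poly_Mapping.keys f. Poly_Mapping.lookup f q * w q)"

lemma path_functional_superset:
  assumes "finite Q" "Poly_Mapping.keys f \<subseteq> Q"
  shows "path_functional w f = (\<Sum>q\<in>Q. Poly_Mapping.lookup f q * w q)"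
  unfolding path_functional_def using assms by (intro sum.mono_neutral_left) (auto simp: in_keys_iff)

lemma path_functional_add: "path_functional w (f + g) = path_functional w f + path_functional w g"
proof -
  let ?Q = "Poly_Mapping.keys f \<union> Poly_Mapping.keys g"
  have k: "finite ?Q" "Poly_Mapping.keys (f + g) \<subseteq> ?Q" using Poly_Mapping.keys_add[of f g] by auto
  show ?thesis
    unfolding path_functional_superset[OF k] path_functional_superset[OF k(1) Un_upper1]
      path_functional_superset[OF k(1) Un_upper2]
    by (simp add: lookup_add distrib_right sum.distrib)
qed

lemma path_functional_zero [simp]: "path_functional w 0 = 0"
  by (simp add: path_functional_def)

lemma path_functional_single [simp]: "path_functional w (Poly_Mapping.single q c) = c * w q"
  by (subst path_functional_superset[of "{q}"]) (auto simp: Poly_Mapping.keys_single)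

lemma path_functional_minus: "path_functional w (- f) = - path_functional w f"
  using path_functional_add[of w f "- f"] by (simp add: eq_neg_iff_add_eq_0 add.commute)

lemma path_functional_diff: "path_functional w (f - g) = path_functional w f - path_functional w g"
  using path_functional_add[of w f "- g"] by (simp add: path_functional_minus)

text \<open>The elements all of whose two-sided multiples are killed form an ideal. It contains the
  generators, by reduction of both factors to single paths.\<close>

lemma path_functional_ideal:
  fixes S :: "('v list \<Rightarrow>\<^sub>0 'k::field) set"
  assumes S: "S \<subseteq> path_span V E"
    and van: "\<And>r p q c d. r \<in> S \<Longrightarrow> p \<in> quiver_paths V E \<Longrightarrow> q \<in> quiver_paths V E \<Longrightarrow>
      path_functional w (path_mult (path_mult (Poly_Mapping.single p c) r) (Poly_Mapping.single q d)) = 0"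
    and f: "f \<in> generated_ideal (path_algebra V E) S" and a: "a \<in> path_span V E" and b: "b \<in> path_span V E"
  shows "path_functional w (path_mult (path_mult a f) b) = 0"
proof -
  define J where "J = {f \<in> path_span V E. \<forall>a\<in>path_span V E. \<forall>b\<in>path_span V E.
    path_functional w (path_mult (path_mult a f) b) = 0}"
  have "two_sided_ideal (path_algebra V E) J"
  proof (rule two_sided_idealI)
    fix f c :: "'v list \<Rightarrow>\<^sub>0 'k" assume f: "f \<in> J" and c: "c \<in> path_span V E"
    have fC: "f \<in> path_span V E" using f by (simp add: J_def)
    have fJ: "path_functional w (path_mult (path_mult a f) b) = 0"
      if "a \<in> path_span V E" "b \<in> path_span V E" for a b using f that by (simp add: J_def)
    have "path_functional w (path_mult (path_mult a (path_mult c f)) b) = 0"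
      if "a \<in> path_span V E" "b \<in> path_span V E" for a b
      using fJ[OF path_span_mult[OF that(1) c] that(2)] unfolding path_mult_assoc[OF that(1) c fC] .
    moreover have "path_functional w (path_mult (path_mult a (path_mult f c)) b) = 0"
      if ab: "a \<in> path_span V E" "b \<in> path_span V E" for a b
    proof -
      have "path_mult (path_mult a (path_mult f c)) b = path_mult (path_mult a f) (path_mult c b)"
        using path_mult_assoc[OF ab(1) fC c] path_mult_assoc[OF path_span_mult[OF ab(1) fC] c ab(2)] by simp
      then show ?thesis using fJ[OF ab(1) path_span_mult[OF c ab(2)]] by simp
    qed
    ultimately show "path_mult c f \<in> J \<and> path_mult f c \<in> J"
      using path_span_mult[OF c fC] path_span_mult[OF fC c] by (simp add: J_def)
  qed (auto simp: J_def path_span_add path_span_minus path_mult_add_left path_mult_add_right path_mult_minus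
        path_functional_add path_functional_minus)
  moreover have "S \<subseteq> J"
  proof
    fix r assume r: "r \<in> S"
    have "path_functional w (path_mult (path_mult a r) b) = 0"
      if "a \<in> path_span V E" "b \<in> path_span V E" for a b
      using that(1)
    proof (induction rule: path_span_induct)
      case (single p c)
      then have p: "p \<in> quiver_paths V E" .
      show ?case using that(2)
      proof (induction rule: path_span_induct)
        case (single q d) show ?case using van[OF r p single] .
      qed (simp_all add: path_mult_add_right path_functional_add)
    qed (simp_all add: path_mult_add_left path_functional_add)
    then show "r \<in> J" using r S by (auto simp: J_def)
  qed
  ultimately have "generated_ideal (path_algebra V E) S \<subseteq> J" unfolding generated_ideal_def by blast
  then show ?thesis using f a b by (auto simp: J_def)
qed

section \<open>The socle functional\<close>

abbreviation rauzy_paths :: "(real^2) list set" where "rauzy_paths \<equiv> quiver_paths vertices edge"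

abbreviation rauzy_span :: "((real^2) list \<Rightarrow>\<^sub>0 'k::field) set" where "rauzy_span \<equiv> path_span vertices edge"

lemma rauzy_paths_simps:
  "[a] \<in> rauzy_paths \<longleftrightarrow> a \<in> vertices"
  "a # b # q \<in> rauzy_paths \<longleftrightarrow> edge a b \<and> b # q \<in> rauzy_paths"
  using edge_vertices by (auto simp: quiver_paths_def)

lemma tile_edges:
  assumes "tile_corners a b c d"
  shows "edge a b" "edge b c" "edge c d" "edge d a" "edge b a" "edge c b" "edge d c" "edge a d"
proof -
  have "tile_corners b c d a" "tile_corners c d a b" "tile_corners d a b c" using assms tile_corners_rotate by blast+
  then show "edge a b" "edge b c" "edge c d" "edge d a" using assms unfolding edge_def by blast+
  then show "edge b a" "edge c b" "edge d c" "edge a d" using edge_sym by blast+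
qed

lemma tile_vertices:
  assumes "tile_corners a b c d" shows "a \<in> vertices" "b \<in> vertices" "c \<in> vertices" "d \<in> vertices"
  using tile_edges[OF assms] edge_vertices by blast+

definition socle_weight :: "(3 \<Rightarrow> real^2 \<Rightarrow> int) \<Rightarrow> (real^2) list \<Rightarrow> 'k::field" where
  "socle_weight s q =
     (case q of [z, x, y, w, z'] \<Rightarrow> if z' = z then of_int (socle_coeff s z x y w) else 0 | _ \<Rightarrow> 0)"

lemma socle_weight_simps [simp]:
  "socle_weight s [z, x, y, w, z'] = (if z' = z then of_int (socle_coeff s z x y w) else 0)"
  by (simp add: socle_weight_def)

lemma socle_weight_length: "length q \<noteq> 5 \<Longrightarrow> socle_weight s q = 0"
  by (auto simp: socle_weight_def split: list.splits)

text \<open>Only closed paths of length four have nonzero weight, so a path of length two can sit at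
  their start (\<open>right\<close>), end (\<open>left\<close>) or middle (\<open>both\<close>). Its
  inner vertex \<open>y\<close> stays variable in order to compare the terms of one
  relation.\<close>

lemma middle_cases:
  assumes "p \<in> rauzy_paths" "q \<in> rauzy_paths" "last p = x" "hd q = w"
  obtains (zero) "\<And>y. socle_weight s (p @ [y, w] @ tl q) = (0 :: 'k::field)"
  | (right) v where "edge w v" "edge v x"
      "\<And>y. socle_weight s (p @ [y, w] @ tl q) = (of_int (socle_coeff s x y w v) :: 'k)"
  | (left) v where "edge w v" "edge v x"
      "\<And>y. socle_weight s (p @ [y, w] @ tl q) = (of_int (socle_coeff s w v x y) :: 'k)"
  | (both) z where "edge z x" "edge w z"
      "\<And>y. socle_weight s (p @ [y, w] @ tl q) = (of_int (socle_coeff s z x y w) :: 'k)"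
proof -
  have ne: "p \<noteq> []" "q \<noteq> []" using assms by (auto simp: quiver_paths_def)
  then have "length p > 0" "length q > 0" by simp_all
  then have "length p + length q \<noteq> 4 \<or> length p = 1 \<and> length q = 3 \<or> length p = 2 \<and> length q = 2 \<or>
      length p = 3 \<and> length q = 1" by arith
  then consider "length p + length q \<noteq> 4" | "length p = 1" "length q = 3" | "length p = 2" "length q = 2"
    | "length p = 3" "length q = 1" by blast
  then show thesis
  proof cases
    case 1
    then have "length (p @ [y, w] @ tl q) \<noteq> 5" for y using ne by auto
    then show thesis using zero socle_weight_length by blast
  next
    case 2
    then obtain v x' where pq: "p = [x]" "q = [w, v, x']"
      using assms(3,4) by (auto simp: length_Suc_conv numeral_3_eq_3)
    have "edge w v" "edge v x'" using assms(2) unfolding pq rauzy_paths_simps by blast+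
    then show thesis using zero right[of v] unfolding pq by (cases "x' = x") auto
  next
    case 3
    then obtain z z' where pq: "p = [z, x]" "q = [w, z']"
      using assms(3,4) by (auto simp: length_Suc_conv numeral_2_eq_2)
    have "edge z x" "edge w z'" using assms(1,2) unfolding pq rauzy_paths_simps by blast+
    then show thesis using zero both[of z] unfolding pq by (cases "z' = z") auto
  next
    case 4
    then obtain w' v where pq: "p = [w', v, x]" "q = [w]"
      using assms(3,4) by (auto simp: length_Suc_conv numeral_3_eq_3)
    have "edge w' v" "edge v x" using assms(1) unfolding pq rauzy_paths_simps by blast+
    then show thesis using zero left[of v] unfolding pq by (cases "w = w'") auto
  qed
qed

lemma sandwich_single:
  assumes "p \<noteq> []"
  shows "path_mult (path_mult (Poly_Mapping.single p c) (Poly_Mapping.single [x, y, w] e)) (Poly_Mapping.single q d) =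
    (if last p = x \<and> w = hd q then Poly_Mapping.single (p @ [y, w] @ tl q) (c * e * d) else 0)"
  by (simp add: path_mult_single)

lemma loop_span: "loop z x \<in> rauzy_span"
  unfolding loop_def by (auto intro!: path_span_single simp: rauzy_paths_simps edge_sym edge_vertices)

lemma signed_loops_span: "signed_loops s a z \<in> rauzy_span"
  unfolding signed_loops_def Let_def by (simp add: loop_span path_span_diff path_span_minus)

lemma relations_span: "relations s \<subseteq> rauzy_span"
proof
  fix r assume "r \<in> relations s"
  then consider x y w where "r = path_elem [x, y, w]" "edge x y" "edge y w"
    | x u y v where "r = path_elem [x, u, y] - path_elem [x, v, y]" "tile_corners x u y v"
    | a c z where "r = signed_loops s a z - signed_loops s c z"
    unfolding relations_def by blast
  then show "r \<in> rauzy_span"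
  proof cases
    case 1 then show ?thesis by (auto intro!: path_span_single simp: rauzy_paths_simps edge_vertices)
  next
    case 2
    show ?thesis unfolding 2(1)
      by (intro path_span_diff path_span_single) (use tile_edges[OF 2(2)] tile_vertices[OF 2(2)] in \<open>auto simp: rauzy_paths_simps\<close>)
  next
    case 3 then show ?thesis by (simp add: signed_loops_span path_span_diff)
  qed
qed

lemma not_adjacent_iff: "(\<nexists>d. tile_corners x y w d) \<longleftrightarrow> \<not> adjacent y x w"
  unfolding adjacent_def by (meson tile_corners_rotate tile_corners_reflect)

lemma sandwich_loop:
  assumes "p \<noteq> []"
  shows "path_functional W (path_mult (path_mult (Poly_Mapping.single p c) (loop z x)) (Poly_Mapping.single q d)) =
    (if last p = z \<and> z = hd q then c * d * (if edge z x then W (p @ [x, z] @ tl q) else 0) else 0)"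
  using assms by (simp add: loop_def sandwich_single)

lemma sandwich_signed_loops:
  assumes "p \<noteq> []" "last p = z" "hd q = z" "sign_choice s" "z \<in> vertices"
    and W: "\<And>y. W (p @ [y, z] @ tl q) = of_int (F y)"
  shows "path_functional W (path_mult (path_mult (Poly_Mapping.single p c) (signed_loops s a z)) (Poly_Mapping.single q d)) =
    c * d * of_int (axis_sum s a z F)"
proof -
  have "s a z = 1 \<or> s a z = -1" using assms(4,5) by (auto simp: sign_choice_def)
  then show ?thesis
    unfolding signed_loops_def Let_def axis_sum_def
    using W by (auto simp: assms(1-3) path_mult_minus path_mult_diff path_functional_minus path_functional_diff
        sandwich_loop algebra_simps)
qed

lemma socle_functional_relations:
  fixes r :: "(real^2) list \<Rightarrow>\<^sub>0 'k::field"
  assumes sc: "sign_choice s" and r: "r \<in> relations s" and p: "p \<in> rauzy_paths" and q: "q \<in> rauzy_paths"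
  shows "path_functional (socle_weight s) (path_mult (path_mult (Poly_Mapping.single p c) r) (Poly_Mapping.single q d)) = 0"
proof -
  have pn: "p \<noteq> []" using p by (simp add: quiver_paths_def)
  consider x y w where "r = path_elem [x, y, w]" "edge x y" "edge y w" "x \<noteq> w" "\<not> adjacent y x w"
    | x u y v where "r = path_elem [x, u, y] - path_elem [x, v, y]" "tile_corners x u y v"
    | a c z where "r = signed_loops s a z - signed_loops s c z" "z \<in> vertices"
    using r unfolding relations_def not_adjacent_iff by blast
  then show ?thesis
  proof cases
    case 1
    have "socle_weight s (p @ [y, w] @ tl q) = (0 :: 'k)" if "last p = x" "hd q = w"
      using p q that
      by (cases rule: middle_cases[where s = s and 'k = 'k]) (use socle_coeff_nonadjacent[OF 1(5,4)] in auto)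
    then show ?thesis unfolding 1(1) sandwich_single[OF pn] by auto
  next
    case 2
    have "socle_weight s (p @ [u, y] @ tl q) = (socle_weight s (p @ [v, y] @ tl q) :: 'k)" if "last p = x" "hd q = y"
      using p q that
      by (cases rule: middle_cases[where s = s and 'k = 'k]) (use socle_coeff_rhombus[OF 2(2)] in auto)
    then show ?thesis
      unfolding 2(1) path_mult_diff path_functional_diff sandwich_single[OF pn] by auto
  next
    case (3 a e z)
    show ?thesis
    proof (cases "last p = z \<and> hd q = z")
      case True
      then have l: "last p = z" "hd q = z" by auto
      note sl = sandwich_signed_loops[where W = "socle_weight s", OF pn l sc 3(2)]
      show ?thesis
        using p q l
      proof (cases rule: middle_cases[where s = s and 'k = 'k])
        case zero
        then have "\<And>y. socle_weight s (p @ [y, z] @ tl q) = (of_int ((\<lambda>_. 0) y) :: 'k)" by simp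
        from sl[OF this] show ?thesis
          unfolding 3(1) path_mult_diff path_functional_diff by (simp add: axis_sum_def)
      next
        case (right v)
        then show ?thesis
          unfolding 3(1) path_mult_diff path_functional_diff
          using sl[OF right(3)] axis_sum_base[OF sc right(1)] by simp
      next
        case (left v)
        then show ?thesis
          unfolding 3(1) path_mult_diff path_functional_diff
          using sl[OF left(3)[unfolded socle_coeff_commute[of s z v]]] axis_sum_base[OF sc left(1)] by simp
      next
        case (both v)
        then show ?thesis
          unfolding 3(1) path_mult_diff path_functional_diff
          using sl[OF both(3)] axis_sum_middle[OF sc both(1)] by simp
      qed
    next
      case False
      then show ?thesis
        unfolding 3(1) signed_loops_def Let_def
        by (auto simp: path_mult_minus path_mult_diff path_functional_minus path_functional_diff sandwich_loop[OF pn])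
    qed
  qed
qed

lemma socle_functional_ideal:
  assumes "sign_choice s" "f \<in> Rauzy_ideal s" "a \<in> rauzy_span" "b \<in> rauzy_span"
  shows "path_functional (socle_weight s) (path_mult (path_mult a f) b) = 0"
  using path_functional_ideal[OF relations_span socle_functional_relations[OF assms(1)]] assms(2-4)
  unfolding Rauzy_ideal_def Rauzy_path_algebra_def by blast

section \<open>Spanning sets of arrow modules\<close>

text \<open>\<open>field_type\<close> names the coefficient field, a type that the sign choice does
  not determine.\<close>

locale rauzy =
  fixes s :: "3 \<Rightarrow> real^2 \<Rightarrow> int" and field_type :: "'k::field itself"
  assumes sc: "sign_choice s"
begin

abbreviation I :: "((real^2) list \<Rightarrow>\<^sub>0 'k) set" where "I \<equiv> Rauzy_ideal s"

abbreviation S :: "(real^2) list \<Rightarrow> 'k \<Rightarrow> (real^2) list \<Rightarrow>\<^sub>0 'k" where "S \<equiv> Poly_Mapping.single"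

abbreviation P :: "(real^2) list \<Rightarrow> (real^2) list \<Rightarrow>\<^sub>0 'k" where "P q \<equiv> path_elem q"

lemma Rauzy_ideal_two_sided: "two_sided_ideal (path_algebra vertices edge) I"
  and relations_in_I: "relations s \<subseteq> I"
  using generated_ideal_path[OF relations_span] unfolding Rauzy_ideal_def Rauzy_path_algebra_def by blast+

sublocale path_algebra_quotient vertices edge I
  by (rule path_algebra_quotient.intro) (rule Rauzy_ideal_two_sided)

text \<open>With all scalar multiples included, linear combinations can be treated term by term. The
  scalars come from the trivial path at the end, see \<open>zero_inI\<close>.\<close>

definition zero_in :: "((real^2) list \<Rightarrow>\<^sub>0 'k) set \<Rightarrow> (real^2) list \<Rightarrow> bool" where
  "zero_in X q \<longleftrightarrow> (\<forall>c. S q c \<in> X)"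

definition congruent_in :: "((real^2) list \<Rightarrow>\<^sub>0 'k) set \<Rightarrow> (real^2) list \<Rightarrow> (real^2) list \<Rightarrow> bool" where
  "congruent_in X p q \<longleftrightarrow> (\<forall>c. S p c - S q c \<in> X)"

lemma scale_right: "path_mult (S q c) (S [last q] d) = S q (c * d)"
  by (simp add: path_mult_single)

lemma zero_inI:
  assumes "right_ideal X" "path_elem q \<in> X" "last q \<in> vertices" shows "zero_in X q"
  unfolding zero_in_def
proof
  fix c
  have "path_mult (S q 1) (S [last q] c) \<in> X"
    using assms by (intro right_idealD(5) path_span_single) (auto simp: rauzy_paths_simps)
  then show "S q c \<in> X" unfolding scale_right by simp
qed

lemma congruent_inI:
  assumes "right_ideal X" "path_elem p - path_elem q \<in> X" "last p \<in> vertices" "last q = last p" shows "congruent_in X p q"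
  unfolding congruent_in_def
proof
  fix c
  have "path_mult (S p 1 - S q 1) (S [last p] c) \<in> X"
    using assms by (intro right_idealD(5) path_span_single) (auto simp: rauzy_paths_simps)
  then show "S p c - S q c \<in> X"
    unfolding path_mult_diff using scale_right[of p 1 c] scale_right[of q 1 c] assms(4) by simp
qed

lemma zero_in_right:
  assumes "right_ideal X" "zero_in X q" "edge (last q) w" shows "zero_in X (q @ [w])"
  unfolding zero_in_def
proof
  fix c
  have "path_mult (S q c) (S [last q, w] 1) \<in> X"
    using assms edge_vertices[OF assms(3)] unfolding zero_in_def
    by (intro right_idealD(5) path_span_single) (auto simp: rauzy_paths_simps)
  then show "S (q @ [w]) c \<in> X" by (simp add: path_mult_single)
qed

lemma congruent_in_right:
  assumes "right_ideal X" "congruent_in X p q" "last p = last q" "edge (last q) w" shows "congruent_in X (p @ [w]) (q @ [w])"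
  unfolding congruent_in_def
proof
  fix c
  have "path_mult (S p c - S q c) (S [last q, w] 1) \<in> X"
    using assms edge_vertices[OF assms(4)] unfolding congruent_in_def
    by (intro right_idealD(5) path_span_single) (auto simp: rauzy_paths_simps)
  then show "S (p @ [w]) c - S (q @ [w]) c \<in> X" using assms(3) by (simp add: path_mult_single path_mult_diff)
qed

text \<open>Prolonging a path on the left needs the two-sided ideal \<open>I\<close> in place of a
  right ideal \<open>X\<close>.\<close>

lemma zero_in_left:
  assumes "zero_in I q" "q \<noteq> []" "edge v (hd q)" shows "zero_in I (v # q)"
  unfolding zero_in_def
proof
  fix c
  have "path_mult (S [v, hd q] 1) (S q c) \<in> I"
    using assms edge_vertices[OF assms(3)] unfolding zero_in_def
    by (intro I_mult path_span_single) (auto simp: rauzy_paths_simps)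
  then show "S (v # q) c \<in> I" using assms(2) by (simp add: path_mult_single)
qed

lemma congruent_in_left:
  assumes "congruent_in I p q" "p \<noteq> []" "q \<noteq> []" "hd p = hd q" "edge v (hd q)" shows "congruent_in I (v # p) (v # q)"
  unfolding congruent_in_def
proof
  fix c
  have "path_mult (S [v, hd q] 1) (S p c - S q c) \<in> I"
    using assms edge_vertices[OF assms(5)] unfolding congruent_in_def
    by (intro I_mult path_span_single) (auto simp: rauzy_paths_simps)
  moreover have "path_mult (S [v, hd q] 1) (S p c) = S (v # p) c"
    using assms(2,4) by (cases p) (auto simp: path_mult_single)
  moreover have "path_mult (S [v, hd q] 1) (S q c) = S (v # q) c"
    using assms(3) by (cases q) (auto simp: path_mult_single)
  ultimately show "S (v # p) c - S (v # q) c \<in> I" by (simp add: path_mult_diff)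
qed

lemma zero_in_mono: "zero_in I q \<Longrightarrow> right_ideal X \<Longrightarrow> zero_in X q"
  unfolding zero_in_def using right_idealD(1) by blast

lemma congruent_in_mono: "congruent_in I p q \<Longrightarrow> right_ideal X \<Longrightarrow> congruent_in X p q"
  unfolding congruent_in_def using right_idealD(1) by blast

lemma congruent_in_holds:
  assumes "right_ideal X" "congruent_in X p q" "zero_in X q" shows "zero_in X p"
  unfolding zero_in_def
proof
  fix c show "S p c \<in> X"
    using right_idealD(3)[OF assms(1), of "S p c - S q c" "S q c"] assms(2,3)
    unfolding congruent_in_def zero_in_def by simp
qed

lemma congruent_in_trans:
  assumes "right_ideal X" "congruent_in X p q" "congruent_in X q r" shows "congruent_in X p r"
  unfolding congruent_in_def
proof
  fix c show "S p c - S r c \<in> X"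
    using right_idealD(3)[OF assms(1), of "S p c - S q c" "S q c - S r c"] assms(2,3)
    unfolding congruent_in_def by simp
qed

lemma zero_path2:
  assumes "edge x y" "edge y w" "x \<noteq> w" "\<not> adjacent y x w" shows "zero_in I [x, y, w]"
proof (rule zero_inI[OF right_ideal_I])
  have "P [x, y, w] \<in> (relations s :: ((real^2) list \<Rightarrow>\<^sub>0 'k) set)"
    using assms not_adjacent_iff unfolding relations_def by blast
  then show "P [x, y, w] \<in> I" using relations_in_I by blast
  show "last [x, y, w] \<in> vertices" using edge_vertices(2)[OF assms(2)] by simp
qed

lemma rhombus_path2:
  assumes "tile_corners x u y v" shows "congruent_in I [x, u, y] [x, v, y]"
proof (rule congruent_inI[OF right_ideal_I])
  have "P [x, u, y] - P [x, v, y] \<in> (relations s :: ((real^2) list \<Rightarrow>\<^sub>0 'k) set)"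
    using assms unfolding relations_def by blast
  then show "P [x, u, y] - P [x, v, y] \<in> I" using relations_in_I by blast
  show "last [x, u, y] \<in> vertices" using tile_vertices[OF assms] by simp
qed simp

lemma adjacent_opposite:
  assumes "adjacent y u w" shows "tile_corners y u (u + w - y) w"
  using assms tile_corners_fourth unfolding adjacent_def by metis

lemma adjacentI: "tile_corners y u d w \<Longrightarrow> adjacent y u w"
  unfolding adjacent_def by blast

text \<open>If \<open>w\<close> is adjacent to both \<open>u\<close> and \<open>v\<close>, move the path across the tile at \<open>u\<close>, \<open>y\<close>, \<open>w\<close> and apply
  \<open>three_around\<close>.\<close>

lemma rhombus_path_exit:
  assumes t: "tile_corners z u y v" and w: "edge y w" "w \<noteq> u" "w \<noteq> v" shows "zero_in I [z, u, y, w]"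
proof -
  note e = tile_edges[OF t]
  have r: "congruent_in I [z, u, y, w] [z, v, y, w]"
    using congruent_in_right[OF right_ideal_I rhombus_path2[OF t], of w] w by simp
  consider "\<not> adjacent y u w" | "\<not> adjacent y v w" | "adjacent y u w" "adjacent y v w" by blast
  then show ?thesis
  proof cases
    case 1
    then have "zero_in I [u, y, w]" using zero_path2 e w by metis
    then show ?thesis using zero_in_left[of "[u, y, w]" z] e by simp
  next
    case 2
    then have "zero_in I [v, y, w]" using zero_path2 e w by metis
    then have "zero_in I [z, v, y, w]" using zero_in_left[of "[v, y, w]" z] e by simp
    then show ?thesis using congruent_in_holds[OF right_ideal_I r] by blast
  next
    case 3
    define d where "d = u + w - y"
    have t': "tile_corners y u z v" using t by (meson tile_corners_rotate tile_corners_reflect)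
    have z: "z = u + v - y" using tile_corners_fourth[OF t'] .
    have td: "tile_corners y u d w" using adjacent_opposite[OF 3(1)] unfolding d_def .
    have td': "tile_corners u y w d" using td by (meson tile_corners_rotate tile_corners_reflect)
    have "\<not> adjacent u z d"
      using three_around[OF adjacentI[OF t'] 3(1) 3(2)] unfolding z d_def .
    moreover have "z \<noteq> d" using w(3) unfolding z d_def by simp
    moreover have "edge u d" using tile_edges[OF td] by blast
    ultimately have "zero_in I [z, u, d]" using zero_path2[of z u d] e by blast
    then have "zero_in I [z, u, d, w]" using zero_in_right[OF right_ideal_I, of "[z, u, d]" w] tile_edges[OF td] by simp
    moreover have "congruent_in I [z, u, y, w] [z, u, d, w]"
      using congruent_in_left[OF rhombus_path2[OF td'], of z] e by simp
    ultimately show ?thesis using congruent_in_holds[OF right_ideal_I] by blast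
  qed
qed

section \<open>Sums of loops along an axis\<close>

definition loop_term :: "(real^2) list \<Rightarrow> real^2 \<Rightarrow> 'k \<Rightarrow> (real^2) list \<Rightarrow>\<^sub>0 'k" where
  "loop_term p w c = (if edge (last p) w then S (p @ [w, last p]) c else 0)"

definition axis_term :: "(real^2) list \<Rightarrow> 3 \<Rightarrow> 'k \<Rightarrow> (real^2) list \<Rightarrow>\<^sub>0 'k" where
  "axis_term p a c = loop_term p (step (last p) a 1) c - loop_term p (step (last p) a (-1)) c"

text \<open>Which alternative arises depends on whether the signs of the two axes agree at the end
  of \<open>p\<close>.\<close>

lemma axis_term_relation:
  assumes p: "p \<in> rauzy_paths"
  shows "axis_term p a c - axis_term p b c \<in> I \<or> axis_term p a c + axis_term p b c \<in> I"
proof -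
  have pn: "p \<noteq> []" and y: "last p \<in> vertices" using p by (auto simp: quiver_paths_def)
  have l: "path_mult (S p c) (loop (last p) w) = loop_term p w c" for w
    by (simp add: loop_term_def loop_def path_mult_single)
  have sl: "path_mult (S p c) (signed_loops s a (last p)) = (if s a (last p) = 1 then axis_term p a c else - axis_term p a c)" for a
    unfolding signed_loops_def Let_def axis_term_def by (simp add: path_mult_diff path_mult_minus l)
  have "signed_loops s a (last p) - signed_loops s b (last p) \<in> I"
    using relations_in_I y unfolding relations_def by blast
  then have "path_mult (S p c) (signed_loops s a (last p) - signed_loops s b (last p)) \<in> I"
    using I_mult(1) path_span_single[OF p] by blast
  then have m: "path_mult (S p c) (signed_loops s a (last p)) - path_mult (S p c) (signed_loops s b (last p)) \<in> I"
    by (simp add: path_mult_diff)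
  show ?thesis using m I_minus[OF m] unfolding sl by (auto split: if_splits simp: algebra_simps)
qed

text \<open>If all loops along one axis lie in \<open>X\<close>, then so do, by the third kind of relations, the signed sums of
  loops along the other axes.\<close>

lemma loops_in:
  assumes X: "right_ideal X" and p: "p \<in> rauzy_paths"
    and b: "\<And>d. d \<in> {1, -1} \<Longrightarrow> edge (last p) (step (last p) b d) \<Longrightarrow> zero_in X (p @ [step (last p) b d, last p])"
    and d: "d \<in> {1, -1}" and e: "edge (last p) (step (last p) a d)"
    and o: "edge (last p) (step (last p) a (- d)) \<Longrightarrow> zero_in X (p @ [step (last p) a (- d), last p])"
  shows "zero_in X (p @ [step (last p) a d, last p])"
  unfolding zero_in_def
proof
  fix c
  have 0: "0 \<in> X" using right_idealD(1)[OF X] I_zero by blast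
  have "loop_term p (step (last p) b d) c \<in> X" if "d \<in> {1, -1}" for d
    using b[OF that] 0 unfolding loop_term_def zero_in_def by auto
  from this[of 1] this[of "-1"] have bX: "axis_term p b c \<in> X"
    unfolding axis_term_def using right_idealD(6)[OF X] by simp
  have "axis_term p a c \<in> X"
    using axis_term_relation[OF p, of a c b]
  proof
    assume "axis_term p a c - axis_term p b c \<in> I"
    then show ?thesis using right_idealD(1)[OF X] right_idealD(3)[OF X _ bX] by force
  next
    assume "axis_term p a c + axis_term p b c \<in> I"
    then show ?thesis using right_idealD(1)[OF X] right_idealD(6)[OF X _ bX] by force
  qed
  then have aX: "axis_term p a c \<in> X" "- axis_term p a c \<in> X" using right_idealD(4)[OF X] by blast+
  have oX: "loop_term p (step (last p) a (- d)) c \<in> X" using o 0 unfolding loop_term_def zero_in_def by auto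
  have "loop_term p (step (last p) a d) c \<in> X"
  proof (cases "d = 1")
    case True
    then show ?thesis using right_idealD(3)[OF X aX(1) oX] unfolding axis_term_def by simp
  next
    case False
    then have "d = -1" using d by simp
    then show ?thesis using right_idealD(3)[OF X aX(2) oX] unfolding axis_term_def by simp
  qed
  then show "S (p @ [step (last p) a d, last p]) c \<in> X" using e by (simp add: loop_term_def)
qed

text \<open>After the path across the tile, every loop at \<open>y\<close> not through
  \<open>u\<close> or \<open>v\<close> vanishes. Those along the third axis are among them, as is
  the one through the step opposite to \<open>u\<close>, so \<open>loops_in\<close> removes the loop
  through \<open>u\<close>.\<close>

lemma rhombus_path_loop:
  assumes t: "tile_corners z u y v" shows "zero_in I [z, u, y, u, y]"
proof -
  have "adjacent y u v" using tile_corners_adjacent(3)[OF t] .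
  then obtain a d b e where ad: "tile_at y a d b e" "u = step y a d" "v = step y b e" by (rule adjacentE)
  have de: "d \<in> {1, -1}" "e \<in> {1, -1}" "a \<noteq> b" using tile_at_signs[OF ad(1)] tile_at_neq[OF ad(1)] by blast+
  obtain f where f: "f \<noteq> a" "f \<noteq> b" using third_axis[OF de(3)] by metis
  have p: "[z, u, y] \<in> rauzy_paths" using tile_edges[OF t] tile_vertices[OF t] by (simp add: rauzy_paths_simps)
  have out: "zero_in I [z, u, y, w, y]" if "edge y w" "w \<noteq> u" "w \<noteq> v" for w
    using zero_in_right[OF right_ideal_I rhombus_path_exit[OF t that]] edge_sym[OF that(1)] by simp
  have "zero_in I ([z, u, y] @ [step (last [z, u, y]) a d, last [z, u, y]])"
  proof (rule loops_in[OF right_ideal_I p, of f])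
    fix g :: int assume g: "g \<in> {1, -1}" and e': "edge (last [z, u, y]) (step (last [z, u, y]) f g)"
    have "step y f g \<noteq> u" "step y f g \<noteq> v"
      using step_inj(1)[OF g de(1), of y f a] step_inj(1)[OF g de(2), of y f b] f unfolding ad by blast+
    then show "zero_in I ([z, u, y] @ [step (last [z, u, y]) f g, last [z, u, y]])" using out e' by simp
  next
    show "d \<in> {1, -1}" by (rule de(1))
    show "edge (last [z, u, y]) (step (last [z, u, y]) a d)" using tile_edges[OF t] ad(2) by simp
    assume e': "edge (last [z, u, y]) (step (last [z, u, y]) a (- d))"
    have md: "- d \<in> {1, -1}" using de(1) by auto
    have "step y a (- d) \<noteq> u" using step_inj(2)[OF md de(1), of y a a] de(1) unfolding ad by fastforce
    moreover have "step y a (- d) \<noteq> v" using step_inj(1)[OF md de(2), of y a b] de(3) unfolding ad by blast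
    ultimately show "zero_in I ([z, u, y] @ [step (last [z, u, y]) a (- d), last [z, u, y]])" using out e' by simp
  qed
  then show ?thesis using ad(2) by simp
qed

text \<open>On both loops the functional is minus a product of two signs; squares of signs are 1, so
  the value is nonzero in every field.\<close>

lemma socle_nonzero:
  assumes "tile_corners a b c d" "S [a, b, c, b, a] k \<in> I \<or> S [a, b, c, d, a] k \<in> I" shows "k = 0"
proof -
  have v: "a \<in> vertices" using tile_vertices[OF assms(1)] by blast
  have sq: "edge_sign s a b * edge_sign s a b = 1" "edge_sign s a d * edge_sign s a d = 1"
    unfolding edge_sign_def using sign_square[OF sc v] by blast+
  then have "of_int (edge_sign s a b) * of_int (edge_sign s a b) = (1 :: 'k)"
    "of_int (edge_sign s a d) * of_int (edge_sign s a d) = (1 :: 'k)"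
    by (metis of_int_1 of_int_mult)+
  then have nz: "of_int (edge_sign s a b) \<noteq> (0 :: 'k)" "of_int (edge_sign s a d) \<noteq> (0 :: 'k)" by auto
  have e: "S [a] 1 \<in> C" using v by (intro path_span_single) (simp add: rauzy_paths_simps)
  have f: "k * socle_weight s [a, b, c, w, a] = 0" if "S [a, b, c, w, a] k \<in> I" for w
    using socle_functional_ideal[OF sc that e e] by (simp add: path_mult_single del: socle_weight_simps)
  show ?thesis
    using assms(2) f[of b] f[of d] socle_coeff_tile[OF assms(1), of s] nz by auto
qed

end

text \<open>An arrow from \<open>z\<close> to \<open>x\<close> with the tiles on both of its sides.
  In the filtration the tile with \<open>u\<close>, \<open>y\<close> is the one towards the previous
  arrow, and \<open>u'\<close> is the next neighbour of \<open>z\<close>.\<close>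

locale rauzy_arrow = rauzy s "field_type :: 'k itself" for s and field_type :: "'k::field itself" +
  fixes z x u y u' y' :: "real^2"
  assumes t: "tile_corners z u y x" and t': "tile_corners z x y' u'" and uu': "u \<noteq> u'"
begin

lemma edge_zx: "edge z x" "edge x z"
  using tile_edges[OF t'] by blast+

lemma yy': "y \<noteq> y'"
proof
  assume "y = y'"
  moreover have "y = u + x - z" "y' = x + u' - z" using tile_corners_fourth[OF t] tile_corners_fourth[OF t'] by simp_all
  ultimately show False using uu' by simp
qed

lemma t_x: "tile_corners x z u y" "tile_corners x y u z" "tile_corners x z u' y'" "tile_corners x y' u' z"
  using t t' by (meson tile_corners_rotate tile_corners_reflect)+

lemma two_only:
  assumes "edge a b" "adjacent a b c" "adjacent a b d" "c \<noteq> d" "adjacent a b e" shows "e = c \<or> e = d"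
proof -
  obtain v w where "\<And>e. adjacent a b e \<longleftrightarrow> e = v \<or> e = w" using two_adjacent[OF assms(1)] by metis
  then show ?thesis using assms by metis
qed

lemma adjacent_x: "adjacent x z w \<longleftrightarrow> w = y \<or> w = y'"
  using two_only[OF edge_zx(2) adjacentI[OF t_x(1)] adjacentI[OF t_x(3)] yy'] adjacentI[OF t_x(1)] adjacentI[OF t_x(3)]
  by blast

lemma adjacent_z: "adjacent z x w \<longleftrightarrow> w = u \<or> w = u'"
  using two_only[OF edge_zx(1) adjacentI[OF tile_corners_reflect[OF t]] adjacentI[OF t'] uu']
    adjacentI[OF tile_corners_reflect[OF t]] adjacentI[OF t'] by blast

abbreviation X :: "((real^2) list \<Rightarrow>\<^sub>0 'k) set" where "X \<equiv> gen (P [z, x, y])"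

lemma path_zxy: "[z, x, y] \<in> rauzy_paths"
  using edge_zx tile_edges[OF t] tile_vertices[OF t] by (simp add: rauzy_paths_simps)

lemma X_ideal: "right_ideal X"
  using path_zxy by (intro right_ideal_gen path_span_single)

lemma X_zxy: "zero_in X [z, x, y]"
proof (rule zero_inI[OF X_ideal])
  have "P [z, x, y] \<star> P [y] \<in> X"
    using path_zxy tile_vertices[OF t] by (intro gen_mult path_span_single) (simp_all add: rauzy_paths_simps)
  then show "P [z, x, y] \<in> X" by (simp add: path_mult_single)
  show "last [z, x, y] \<in> vertices" using tile_vertices[OF t] by simp
qed

text \<open>Modulo \<open>X\<close> the loops at \<open>x\<close> through vertices other than
  \<open>z\<close> and \<open>y'\<close> vanish: the one through \<open>y\<close> by the choice of
  \<open>X\<close>, the rest because they leave the two tiles. Since \<open>z\<close> and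
  \<open>y'\<close> lie on different axes at \<open>x\<close>, \<open>loops_in\<close> applies to
  each.\<close>

lemma X_loops: "zero_in X [z, x, y', x]" "zero_in X [z, x, z, x]"
proof -
  obtain a d b e where ad: "tile_at x a d b e" "z = step x a d" "y = step x b e"
    using adjacentI[OF t_x(1)] by (rule adjacentE)
  obtain b' e' where b': "y' = step x b' e'" "e' \<in> {1, -1}"
    using adjacentI[OF t_x(3)] by (metis adjacentE tile_at_signs(2))
  have de: "d \<in> {1, -1}" "e \<in> {1, -1}" "a \<noteq> b" using tile_at_signs[OF ad(1)] tile_at_neq[OF ad(1)] by blast+
  have "tile_at x a d b' e'" using adjacentI[OF t_x(3)] adjacent_step[OF de(1) b'(2)] unfolding ad b' by simp
  then have ab': "a \<noteq> b'" by (rule tile_at_neq)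
  have md: "- d \<in> {1, -1}" "- e \<in> {1, -1}" "- e' \<in> {1, -1}" using de b' by auto
  have p: "[z, x] \<in> rauzy_paths" using edge_zx tile_vertices[OF t] by (simp add: rauzy_paths_simps)
  have out: "zero_in X [z, x, w, x]" if "edge x w" "w \<noteq> z" "w \<noteq> y'" for w
  proof (cases "w = y")
    case True
    then show ?thesis using zero_in_right[OF X_ideal X_zxy, of x] tile_edges[OF t] by simp
  next
    case False
    have "zero_in I [z, x, w]" using zero_path2[of z x w] edge_zx that False adjacent_x by metis
    then have "zero_in I [z, x, w, x]" using zero_in_right[OF right_ideal_I, of "[z, x, w]" x] edge_sym[OF that(1)] by simp
    then show ?thesis using zero_in_mono X_ideal by blast
  qed
  \<comment> \<open>The axis needed for \<open>loops_in\<close> contains neither \<open>z\<close>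
    nor \<open>y'\<close>: it is the third one if \<open>y\<close> and \<open>y'\<close> lie on the
    same axis at \<open>x\<close>, and the axis of \<open>y\<close> otherwise.\<close>
  have ex: "\<exists>f. \<forall>g\<in>{1, -1}. step x f g \<noteq> z \<and> step x f g \<noteq> y'"
  proof (cases "b = b'")
    case True
    obtain f where f: "f \<noteq> a" "f \<noteq> b'" using third_axis[OF ab'] by metis
    then show ?thesis using step_inj(1)[OF _ de(1)] step_inj(1)[OF _ b'(2)] unfolding ad b' by blast
  next
    case False
    then show ?thesis using de(3) step_inj(1)[OF _ de(1)] step_inj(1)[OF _ b'(2)] unfolding ad b' by metis
  qed
  then obtain f where f: "\<And>g. g \<in> {1, -1} \<Longrightarrow> step x f g \<noteq> z \<and> step x f g \<noteq> y'" by blast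
  have base: "zero_in X ([z, x] @ [step (last [z, x]) f g, last [z, x]])"
    if "g \<in> {1, -1}" "edge (last [z, x]) (step (last [z, x]) f g)" for g
    using out that f[OF that(1)] by simp
  have "zero_in X ([z, x] @ [step (last [z, x]) a d, last [z, x]])"
  proof (rule loops_in[OF X_ideal p base de(1)])
    show "edge (last [z, x]) (step (last [z, x]) a d)" using edge_zx ad by simp
    assume e': "edge (last [z, x]) (step (last [z, x]) a (- d))"
    have "step x a (- d) \<noteq> z" using step_inj(2)[OF md(1) de(1), of x a a] de(1) unfolding ad by fastforce
    moreover have "step x a (- d) \<noteq> y'" using step_inj(1)[OF md(1) b'(2), of x a b'] ab' unfolding b' by blast
    ultimately show "zero_in X ([z, x] @ [step (last [z, x]) a (- d), last [z, x]])" using out e' by simp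
  qed
  then show "zero_in X [z, x, z, x]" unfolding ad(2) by simp
  have "zero_in X ([z, x] @ [step (last [z, x]) b' e', last [z, x]])"
  proof (rule loops_in[OF X_ideal p base b'(2)])
    show "edge (last [z, x]) (step (last [z, x]) b' e')" using tile_edges[OF t'] b' by simp
    assume ed: "edge (last [z, x]) (step (last [z, x]) b' (- e'))"
    have "step x b' (- e') \<noteq> y'" using step_inj(2)[OF md(3) b'(2), of x b' b'] b'(2) unfolding b'(1) by fastforce
    moreover have "step x b' (- e') \<noteq> z" using step_inj(1)[OF md(3) de(1), of x b' a] ab' unfolding ad by blast
    ultimately show "zero_in X ([z, x] @ [step (last [z, x]) b' (- e'), last [z, x]])" using out ed by simp
  qed
  then show "zero_in X [z, x, y', x]" unfolding b'(1) by simp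
qed

text \<open>One path for each corner of the tile \<open>z\<close>, \<open>x\<close>,
  \<open>y'\<close>, \<open>u'\<close>; prefixing \<open>u'\<close> turns them into paths spanning a
  rhombus module.\<close>

abbreviation base_paths :: "(real^2) list set" where
  "base_paths \<equiv> {[z, x], [z, x, y'], [z, x, z], [z, x, z, u']}"

text \<open>Equal endpoints are recorded so that the property survives prolongation by an
  edge.\<close>

definition basic :: "(real^2) list \<Rightarrow> bool" where
  "basic q \<longleftrightarrow> zero_in X q \<or> (\<exists>r \<in> base_paths. congruent_in X q r \<and> last q = last r)"

lemma basicI: "zero_in X q \<Longrightarrow> basic q" "zero_in I q \<Longrightarrow> basic q"
  "r \<in> base_paths \<Longrightarrow> basic r"
  "r \<in> base_paths \<Longrightarrow> congruent_in I q r \<Longrightarrow> last q = last r \<Longrightarrow> basic q"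
proof -
  have "congruent_in X r r" for r
    using right_idealD(1)[OF X_ideal] I_zero unfolding congruent_in_def by auto
  then show "r \<in> base_paths \<Longrightarrow> basic r" unfolding basic_def by blast
qed (use zero_in_mono congruent_in_mono X_ideal in \<open>unfold basic_def, blast+\<close>)

lemma basic_step:
  assumes "r \<in> base_paths" "edge (last r) w" shows "basic (r @ [w])"
proof -
  note e = tile_edges[OF t] tile_edges[OF t']
  consider "r = [z, x]" | "r = [z, x, y']" | "r = [z, x, z]" | "r = [z, x, z, u']" using assms(1) by blast
  then show ?thesis
  proof cases
    case 1
    consider "w = z \<or> w = y'" | "w = y" | "w \<noteq> z" "w \<noteq> y" "w \<noteq> y'" by blast
    then show ?thesis
    proof cases
      case a: 1 then show ?thesis using basicI(3)[of "[z, x, w]"] unfolding 1 by auto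
    next
      case a: 2 then show ?thesis using basicI(1)[OF X_zxy] unfolding 1 by simp
    next
      case a: 3
      then have "zero_in I [z, x, w]" using zero_path2[of z x w] edge_zx assms(2) adjacent_x unfolding 1 by simp
      then show ?thesis using basicI(2) unfolding 1 by simp
    qed
  next
    case 2
    consider "w = x" | "w = u'" | "w \<noteq> x" "w \<noteq> u'" by blast
    then show ?thesis
    proof cases
      case a: 1 then show ?thesis using basicI(1)[OF X_loops(1)] unfolding 2 by simp
    next
      case a: 2
      have "congruent_in I [z, x, y', u'] [z, x, z, u']"
        using congruent_in_left[OF rhombus_path2[OF t_x(4)], of z] edge_zx by simp
      then show ?thesis using basicI(4)[of "[z, x, z, u']" "[z, x, y', u']"] unfolding 2 a by simp
    next
      case a: 3
      then show ?thesis using basicI(2) rhombus_path_exit[OF t', of w] assms(2) unfolding 2 by simp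
    qed
  next
    case 3
    consider "w = x" | "w = u'" | "w = u" | "w \<noteq> x" "w \<noteq> u'" "w \<noteq> u" by blast
    then show ?thesis
    proof cases
      case a: 1 then show ?thesis using basicI(1)[OF X_loops(2)] unfolding 3 by simp
    next
      case a: 2 then show ?thesis using basicI(3)[of "[z, x, z, u']"] unfolding 3 by simp
    next
      case a: 3
      have "congruent_in I [z, x, z, u] [z, x, y, u]"
        using congruent_in_left[OF rhombus_path2[OF t_x(1)], of z] edge_zx by simp
      moreover have "zero_in X [z, x, y, u]" using zero_in_right[OF X_ideal X_zxy, of u] e by simp
      ultimately show ?thesis using basicI(1) congruent_in_holds[OF X_ideal congruent_in_mono[OF _ X_ideal]] unfolding 3 a by simp
    next
      case a: 4
      then have "zero_in I [x, z, w]" using zero_path2[of x z w] edge_zx assms(2) adjacent_z unfolding 3 by simp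
      then show ?thesis using basicI(2) zero_in_left[of "[x, z, w]" z] edge_zx unfolding 3 by simp
    qed
  next
    \<comment> \<open>Every prolongation of this path lies in \<open>X\<close>. Moving it across the
      tile at \<open>x\<close> makes it pass through \<open>y'\<close>, where the known relations
      apply.\<close>
    case 4
    have "congruent_in I [z, x, z, u'] [z, x, y', u']"
      using congruent_in_left[OF rhombus_path2[OF t_x(3)], of z] edge_zx by simp
    then have q: "congruent_in I [z, x, z, u', w] [z, x, y', u', w]"
      using congruent_in_right[OF right_ideal_I, of "[z, x, z, u']" "[z, x, y', u']" w] assms(2) unfolding 4 by simp
    have "zero_in X [z, x, y', u', w]"
    proof -
      consider "w = y'" | "w = z" | "w \<noteq> y'" "w \<noteq> z" by blast
      then show ?thesis
      proof cases
        case a: 1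
        have ty: "tile_corners z u' y' x" using tile_corners_reflect[OF t'] .
        \<comment> \<open>Going round the tile the other way gives the form treated by
          \<open>rhombus_path_loop\<close>.\<close>
        have "congruent_in I [z, x, y', u', y'] [z, u', y', u', y']"
          using congruent_in_right[OF right_ideal_I congruent_in_right[OF right_ideal_I rhombus_path2[OF t'], of u'], of y'] e by simp
        then have "zero_in I [z, x, y', u', y']"
          using congruent_in_holds[OF right_ideal_I _ rhombus_path_loop[OF ty]] by blast
        then show ?thesis using zero_in_mono X_ideal unfolding a by blast
      next
        case a: 2
        have ty: "tile_corners y' u' z x" using t' by (meson tile_corners_rotate tile_corners_reflect)
        have "congruent_in I [z, x, y', u', z] [z, x, y', x, z]"
          \<comment> \<open>Replacing \<open>u'\<close> by \<open>x\<close> exposes a loop at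
            \<open>x\<close> that lies in \<open>X\<close>.\<close>
          using congruent_in_left[OF congruent_in_left[OF rhombus_path2[OF ty], of x], of z] edge_zx e by simp
        moreover have "zero_in X [z, x, y', x, z]" using zero_in_right[OF X_ideal X_loops(1), of z] edge_zx by simp
        ultimately show ?thesis using congruent_in_holds[OF X_ideal congruent_in_mono[OF _ X_ideal]] unfolding a by blast
      next
        case a: 3
        have "zero_in I [x, y', u', w]" using rhombus_path_exit[OF t_x(4), of w] a assms(2) unfolding 4 by simp
        then show ?thesis using zero_in_mono[OF _ X_ideal] zero_in_left[of "[x, y', u', w]" z] edge_zx by simp
      qed
    qed
    then show ?thesis using basicI(1) congruent_in_holds[OF X_ideal congruent_in_mono[OF q X_ideal]] unfolding 4 by simp
  qed
qed

lemma basic_snoc: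
  assumes "basic q" "edge (last q) w" shows "basic (q @ [w])"
proof -
  consider "zero_in X q" | r where "r \<in> base_paths" "congruent_in X q r" "last q = last r"
    using assms(1) unfolding basic_def by blast
  then show ?thesis
  proof cases
    case 1 then show ?thesis using zero_in_right[OF X_ideal _ assms(2)] basicI(1) by blast
  next
    case 2
    have eq: "congruent_in X (q @ [w]) (r @ [w])" using congruent_in_right[OF X_ideal 2(2,3)] assms(2) 2(3) by simp
    have "basic (r @ [w])" using basic_step[OF 2(1)] assms(2) 2(3) by simp
    then show ?thesis
      using congruent_in_holds[OF X_ideal eq] congruent_in_trans[OF X_ideal eq] unfolding basic_def by auto
  qed
qed

lemma basic_path:
  assumes "q \<in> rauzy_paths" "hd q = x" shows "basic ([z, x] @ tl q)"
  using assms
proof (induction q rule: rev_induct)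
  case Nil then show ?case by (simp add: quiver_paths_def)
next
  case (snoc w q)
  show ?case
  proof (cases "q = []")
    case True
    then show ?thesis using basicI(3)[of "[z, x]"] by simp
  next
    case False
    have q: "q \<in> rauzy_paths" "edge (last q) w"
      using snoc.prems(1) False by (auto simp: quiver_paths_def successively_append_iff)
    have h: "hd q = x" using snoc.prems(2) False by simp
    have "last ([z, x] @ tl q) = last q" using False h by (cases q) auto
    then have "basic (([z, x] @ tl q) @ [w])" using basic_snoc[OF snoc.IH[OF q(1) h]] q(2) by simp
    then show ?thesis using False by simp
  qed
qed

section \<open>Linear combinations of the four paths\<close>

definition spanned :: "((real^2) list \<Rightarrow>\<^sub>0 'k) \<Rightarrow> bool" where
  "spanned f \<longleftrightarrow> (\<exists>c0 c1 c2 c3. f - (S [z, x] c0 + S [z, x, y'] c1 + S [z, x, z] c2 + S [z, x, z, u'] c3) \<in> X)"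

lemma basic_spanned:
  assumes "basic q" shows "spanned (S q c)"
proof -
  consider "zero_in X q" | "congruent_in X q [z, x]" | "congruent_in X q [z, x, y']" | "congruent_in X q [z, x, z]"
    | "congruent_in X q [z, x, z, u']"
    using assms unfolding basic_def by blast
  then show ?thesis
  proof cases
    case 1 then show ?thesis unfolding spanned_def zero_in_def
      by (intro exI[of _ 0]) simp
  next
    case 2 then show ?thesis unfolding spanned_def congruent_in_def
      by (intro exI[of _ c] exI[of _ 0]) simp
  next
    case 3 then show ?thesis unfolding spanned_def congruent_in_def
      by (intro exI[of _ 0] exI[of _ c] exI[of _ 0]) simp
  next
    case 4 then show ?thesis unfolding spanned_def congruent_in_def
      by (intro exI[of _ 0] exI[of _ 0] exI[of _ c] exI[of _ 0]) simp
  next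
    case 5 then show ?thesis unfolding spanned_def congruent_in_def
      by (intro exI[of _ 0] exI[of _ 0] exI[of _ 0] exI[of _ c]) simp
  qed
qed

lemma spanned_add:
  assumes "spanned f" "spanned g" shows "spanned (f + g)"
proof -
  obtain a0 a1 a2 a3 b0 b1 b2 b3 where
    "f - (S [z, x] a0 + S [z, x, y'] a1 + S [z, x, z] a2 + S [z, x, z, u'] a3) \<in> X" (is "f - ?F \<in> X")
    "g - (S [z, x] b0 + S [z, x, y'] b1 + S [z, x, z] b2 + S [z, x, z, u'] b3) \<in> X" (is "g - ?G \<in> X")
    using assms unfolding spanned_def by blast
  then have "(f - ?F) + (g - ?G) \<in> X" using right_idealD(3)[OF X_ideal] by blast
  moreover have "(f - ?F) + (g - ?G) = (f + g) - (S [z, x] (a0 + b0) + S [z, x, y'] (a1 + b1) + S [z, x, z] (a2 + b2) + S [z, x, z, u'] (a3 + b3))"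
    by (simp add: single_add algebra_simps)
  ultimately show ?thesis unfolding spanned_def by metis
qed

lemma arrow_spanned:
  assumes "f \<in> gen (P [z, x])" shows "spanned f"
proof -
  have X0: "0 \<in> X" using right_idealD(1)[OF X_ideal] I_zero by blast
  have in_X: "spanned f" if "f \<in> X" for f
    unfolding spanned_def using that by (intro exI[of _ 0]) simp
  obtain a where a: "a \<in> C" "f - P [z, x] \<star> a \<in> I" using assms unfolding gen_def by blast
  have "spanned (P [z, x] \<star> a)"
    using a(1)
  proof (induction rule: path_span_induct)
    case zero show ?case using in_X X0 by simp
  next
    case (single q c)
    show ?case
    proof (cases "hd q = x")
      case True
      then show ?thesis using basic_spanned[OF basic_path[OF single True], of c] by (simp add: path_mult_single)
    next
      case False
      then show ?thesis using in_X[OF X0] by (simp add: path_mult_single)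
    qed
  next
    case (add f g)
    then show ?case using spanned_add by (simp add: path_mult_add_right)
  qed
  moreover have "spanned (f - P [z, x] \<star> a)" using a(2) right_idealD(1)[OF X_ideal] in_X by blast
  ultimately have "spanned ((f - P [z, x] \<star> a) + P [z, x] \<star> a)" by (rule spanned_add[rotated])
  then show ?thesis by simp
qed

lemma tile_u': "tile_corners u' z x y'"
  using t' by (meson tile_corners_rotate tile_corners_reflect)

lemma left_path_mult:
  "P [u', z] \<star> (S (z # q) c) = S (u' # z # q) c"
  by (simp add: path_mult_single)

lemma path_u'z: "P [u', z] \<in> C"
  using tile_edges[OF t'] tile_vertices[OF t'] by (intro path_span_single) (simp add: rauzy_paths_simps)

text \<open>The path \<open>u'\<close>, \<open>z\<close>, \<open>x\<close> crosses the tile, and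
  \<open>y\<close> is neither of its other two corners, so \<open>rhombus_path_exit\<close>
  applies.\<close>

lemma left_X:
  assumes "f \<in> X" shows "P [u', z] \<star> f \<in> I"
proof -
  obtain a where a: "a \<in> C" "f - P [z, x, y] \<star> a \<in> I" using assms unfolding gen_def by blast
  have "y \<noteq> z" using tile_corners_neq[OF t] by blast
  then have "zero_in I [u', z, x, y]" using rhombus_path_exit[OF tile_u', of y] yy' tile_edges[OF t] by simp
  then have "S [u', z, x, y] 1 \<in> I" unfolding zero_in_def by blast
  then have "path_mult (S [u', z, x, y] 1) a \<in> I" using I_mult a(1) by blast
  moreover have "P [u', z] \<star> (P [z, x, y] \<star> a) = path_mult (S [u', z, x, y] 1) a"
    using path_mult_assoc[OF path_u'z path_span_single[OF path_zxy] a(1), of 1] by (simp add: path_mult_single)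
  moreover have "P [u', z] \<star> (f - P [z, x, y] \<star> a) \<in> I" using I_mult path_u'z a(2) by blast
  ultimately have "P [u', z] \<star> (f - P [z, x, y] \<star> a)
      + P [u', z] \<star> (P [z, x, y] \<star> a) \<in> I" by (metis I_add)
  then show ?thesis by (simp add: path_mult_diff)
qed

text \<open>Modulo \<open>X\<close> the element has four coefficients. Multiplying on the right by a
  path from one endpoint back to \<open>u'\<close> makes the other three products zero and turns the
  remaining one into a loop of length four along the sides of the tile, which
  \<open>socle_nonzero\<close> detects.\<close>

lemma left_kernel:
  assumes f: "f \<in> gen (P [z, x])" and k: "P [u', z] \<star> f \<in> I" shows "f \<in> X"
proof -
  obtain c0 c1 c2 c3 where c: "f - (S [z, x] c0 + S [z, x, y'] c1 + S [z, x, z] c2 + S [z, x, z, u'] c3) \<in> X" (is "f - ?F \<in> X")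
    using arrow_spanned[OF f] unfolding spanned_def by blast
  have "P [u', z] \<star> f - P [u', z] \<star> (f - ?F) \<in> I"
    using I_diff[OF k left_X[OF c]] .
  moreover have "P [u', z] \<star> f - P [u', z] \<star> (f - ?F) = P [u', z] \<star> ?F"
    unfolding path_mult_diff by simp
  ultimately have g: "S [u', z, x] c0 + S [u', z, x, y'] c1 + S [u', z, x, z] c2 + S [u', z, x, z, u'] c3 \<in> I" (is "?G \<in> I")
    unfolding path_mult_add_right left_path_mult by (simp only:)
  note n = tile_corners_neq[OF tile_u']
  note e = tile_edges[OF tile_u'] and v = tile_vertices[OF tile_u']
  have m: "path_mult ?G (P q) \<in> I" if "q \<in> rauzy_paths" for q
    using I_mult(2)[OF g path_span_single[OF that]] .
  have ne: "z \<noteq> x" "x \<noteq> z" "z \<noteq> y'" "y' \<noteq> z" "u' \<noteq> z" "z \<noteq> u'" "u' \<noteq> x" "x \<noteq> u'" "u' \<noteq> y'" "y' \<noteq> u'" "x \<noteq> y'" "y' \<noteq> x"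
    using n by auto
  have "c0 = 0"
    using m[of "[x, z, u']"] e v ne socle_nonzero[OF tile_u', of c0]
    by (simp add: path_mult_add_left path_mult_single rauzy_paths_simps)
  moreover have "c1 = 0"
    using m[of "[y', u']"] e v ne socle_nonzero[OF tile_u', of c1]
    by (simp add: path_mult_add_left path_mult_single rauzy_paths_simps)
  moreover have "c2 = 0"
    using m[of "[z, u']"] e v ne socle_nonzero[OF tile_u', of c2]
    by (simp add: path_mult_add_left path_mult_single rauzy_paths_simps)
  moreover have "c3 = 0"
    using m[of "[u']"] e v ne socle_nonzero[OF tile_u', of c3]
    by (simp add: path_mult_add_left path_mult_single rauzy_paths_simps)
  ultimately show ?thesis using c by simp
qed

lemma rhombus_path_nonzero: "P [u', z, x] \<notin> I"
proof
  assume a: "P [u', z, x] \<in> I"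
  note e = tile_edges[OF tile_u'] and v = tile_vertices[OF tile_u']
  have "P [u', z, x] \<star> P [x, z, u'] \<in> I"
    using e v by (intro I_mult(2)[OF a] path_span_single) (simp add: rauzy_paths_simps)
  then have "S [u', z, x, z, u'] 1 \<in> I" by (simp add: path_mult_single)
  then show False using socle_nonzero[OF tile_u', of 1] by simp
qed

end

section \<open>The filtration\<close>

context path_algebra_quotient
begin

lemma plus_set_absorb:
  assumes X: "right_ideal X" and Y: "right_ideal Y" and "X \<subseteq> Y" shows "plus_set X Y = Y"
  using plus_set_upper[OF X Y] right_idealD(3)[OF Y] assms(3) unfolding plus_set_def by blast

lemma cls_image_psubset:
  assumes X: "right_ideal X" and "X \<subseteq> Y" "f \<in> Y" "f \<notin> X" shows "cls ` X \<subset> cls ` Y"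
  using right_ideal_cls_iff[OF X, of f] assms by blast

lemma left_mult_gen:
  assumes u: "u \<in> C" and q: "q \<in> C" and f: "f \<in> gen q" shows "u \<star> f \<in> gen (u \<star> q)"
proof -
  obtain a where a: "f \<in> C" "a \<in> C" "f - q \<star> a \<in> I" using f unfolding gen_def by blast
  have "u \<star> (f - q \<star> a) \<in> I" using I_mult a(3) u by blast
  then have "u \<star> f - (u \<star> q) \<star> a \<in> I" using path_mult_assoc[OF u q a(2)] by (simp add: path_mult_diff)
  then show ?thesis unfolding gen_def using a path_span_mult[OF u] by blast
qed

lemma gen_eq_I:
  assumes "q \<in> I" shows "gen q = I"
  using gen_subset[OF right_ideal_I assms] right_idealD(1)[OF right_ideal_gen] assms I_subset by blast

end

context rauzy
begin

lemma Rauzy_algebra_A: "Rauzy_algebra s = A"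
  by (simp add: Rauzy_algebra_def Rauzy_path_algebra_def)

lemma path_class_cls: "path_class s q = cls (P q)"
  by (simp add: path_class_def Rauzy_path_algebra_def cls_def)

lemma path_elem_C: "q \<in> rauzy_paths \<Longrightarrow> path_elem q \<in> C"
  by (rule path_span_single)

lemma rhombus_moduleI:
  assumes "tile_corners z u y v" "module_isomorphic A N (module_of (gen (P [z, u, y])))"
  shows "rhombus_module s N"
proof -
  have "P [z, u, y] \<in> C"
    using tile_edges[OF assms(1)] tile_vertices[OF assms(1)] by (intro path_elem_C) (simp add: rauzy_paths_simps)
  then show ?thesis
    unfolding rhombus_module_def Let_def Rauzy_algebra_A path_class_cls
    using assms by (metis cls_gen)
qed

lemma gen_prefix:
  assumes "edge z x" "edge x y" shows "P [z, x, y] \<in> gen (P [z, x])"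
proof -
  have "P [z, x] \<star> P [x, y] \<in> gen (P [z, x])"
    using assms edge_vertices by (intro gen_mult path_elem_C) (auto simp: rauzy_paths_simps)
  then show ?thesis by (simp add: path_mult_single)
qed

lemma nonadjacent_kills:
  assumes "edge z w" "edge z x" "w \<noteq> x" "\<not> adjacent z w x" "f \<in> gen (P [z, x])"
  shows "P [w, z] \<star> f \<in> I"
proof -
  have C: "P [w, z] \<in> C" "P [z, x] \<in> C"
    using assms(1,2) edge_sym edge_vertices by (auto intro!: path_elem_C simp: rauzy_paths_simps)
  have "P [w, z] \<star> P [z, x] \<in> I"
    using zero_path2[OF edge_sym[OF assms(1)] assms(2,3,4)] by (simp add: path_mult_single zero_in_def)
  then show ?thesis using left_mult_gen[OF C assms(5)] gen_eq_I by blast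
qed

text \<open>The quotient by zero is treated like the other quotients, left multiplication by the
  trivial path at \<open>z\<close> serving as the identity.\<close>

lemma rhombus_ideal:
  assumes t: "tile_corners z u y v"
  defines "q \<equiv> P [z, u, y]"
  shows "rhombus_module s (quotient_module (module_of (gen q)) (cls ` I))" "cls ` I \<subset> cls ` gen q"
proof -
  have qC: "q \<in> C" and e: "P [z] \<in> C" "P [y] \<in> C"
    unfolding q_def using tile_edges[OF t] tile_vertices[OF t] by (auto intro!: path_elem_C simp: rauzy_paths_simps)
  have zq: "P [z] \<star> q = q" and qy: "path_mult q (P [y]) = q"
    unfolding q_def by (simp_all add: path_mult_single)
  have qg: "q \<in> gen q" using gen_mult[OF qC e(2)] qy by simp
  have zf: "P [z] \<star> f \<in> I \<longleftrightarrow> f \<in> I" if f: "f \<in> gen q" for f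
  proof -
    obtain a where a: "a \<in> C" "f - path_mult q a \<in> I" using f unfolding gen_def by blast
    have "P [z] \<star> (path_mult q a) = path_mult q a"
      using path_mult_assoc[OF e(1) qC a(1)] zq by simp
    then have "P [z] \<star> f - path_mult q a \<in> I"
      using I_mult(1)[OF a(2) e(1)] by (simp add: path_mult_diff)
    then have d: "f - P [z] \<star> f \<in> I" using I_diff[OF a(2)] by force
    show ?thesis using I_add[OF d] I_diff[OF _ d] by force
  qed
  have "module_isomorphic A (quotient_module (module_of (gen q)) (cls ` I)) (module_of (gen q))"
  proof (rule quotient_isomorphic_gen[OF right_ideal_gen[OF qC] e(1) _ qC qg])
    show "P [z] \<star> f \<in> gen q" if "f \<in> gen q" for f
      using left_mult_gen[OF e(1) qC that] zq by simp
    show "q - P [z] \<star> q \<in> I" using zq I_zero by simp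
    show "P [z] \<star> f \<in> I \<longleftrightarrow> f \<in> I" if "f \<in> gen q" for f by (rule zf[OF that])
    show "I \<subseteq> gen q" using right_idealD(1)[OF right_ideal_gen[OF qC]] .
  qed
  then show "rhombus_module s (quotient_module (module_of (gen q)) (cls ` I))"
    using rhombus_moduleI[OF t] unfolding q_def by blast
  have "q \<notin> I"
  proof
    assume "q \<in> I"
    then have "path_mult q (P [y, u, z]) \<in> I"
      using tile_edges[OF t] tile_vertices[OF t] by (intro I_mult path_elem_C) (auto simp: rauzy_paths_simps)
    then have "S [z, u, y, u, z] 1 \<in> I" unfolding q_def by (simp add: path_mult_single)
    then show False using socle_nonzero[OF t, of 1] by simp
  qed
  then show "cls ` I \<subset> cls ` gen q"
    using cls_image_psubset[OF right_ideal_I _ qg] right_idealD(1)[OF right_ideal_gen[OF qC]] by blast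
qed

end

context rauzy_arrow
begin

text \<open>Left multiplication by the arrow from \<open>u'\<close> to \<open>z\<close> kills
  \<open>Y\<close>, and its kernel on the arrow module is generated by a path in \<open>Y\<close>.
  Hence its kernel on the sum is \<open>Y\<close>, and its image is a rhombus module.\<close>

lemma filtration_step:
  assumes Y: "right_ideal Y" and Yz': "\<forall>f\<in>Y. P [u', z] \<star> f \<in> I"
    and XY: "P [z, x, y] \<in> Y"
  defines "W \<equiv> plus_set Y (gen (P [z, x]))"
  shows "rhombus_module s (quotient_module (module_of W) (cls ` Y))" "cls ` Y \<subset> cls ` W"
    "short_exact A (module_of Y) (module_of W) (module_of (gen (P [u', z, x]))) (\<lambda>m. m)
       (lmul (P [u', z]))"
    "right_ideal W"
proof -
  have Yz: "P [u', z] \<star> f \<in> I" if "f \<in> Y" for f using Yz' that by blast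
  note e = tile_edges[OF tile_u'] and v = tile_vertices[OF tile_u']
  have b: "P [z, x] \<in> C" and ex: "P [x] \<in> C" and q: "P [u', z, x] \<in> C"
    using e v by (auto intro!: path_elem_C simp: rauzy_paths_simps)
  have G: "right_ideal (gen (P [z, x]))" using right_ideal_gen[OF b] .
  show W: "right_ideal W" unfolding W_def using right_ideal_plus[OF Y G] .
  have YW: "Y \<subseteq> W" unfolding W_def using plus_set_upper[OF Y G] by blast
  have "P [z, x] \<star> P [x] \<in> gen (P [z, x])" using gen_mult[OF b ex] .
  then have bg: "P [z, x] \<in> gen (P [z, x])" by (simp add: path_mult_single)
  then have bW: "P [z, x] \<in> W" unfolding W_def using plus_set_upper[OF Y G] by blast
  have ub: "P [u', z] \<star> P [z, x] = P [u', z, x]"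
    by (simp add: path_mult_single)
  have Q: "right_ideal (gen (P [u', z, x]))" using right_ideal_gen[OF q] .
  have uW: "P [u', z] \<star> f \<in> gen (P [u', z, x])" if fW: "f \<in> W" for f
  proof -
    obtain g h where f: "f = g + h" "g \<in> Y" "h \<in> gen (P [z, x])" using fW unfolding W_def plus_set_def by blast
    have "P [u', z] \<star> h \<in> gen (P [u', z, x])"
      using left_mult_gen[OF path_u'z b f(3)] ub by simp
    then show ?thesis using right_idealD(1,3)[OF Q] Yz[OF f(2)] unfolding f(1) path_mult_add_right by blast
  qed
  have ker: "P [u', z] \<star> f \<in> I \<longleftrightarrow> f \<in> Y" if fW: "f \<in> W" for f
  proof
    assume k: "P [u', z] \<star> f \<in> I"
    obtain g h where f: "f = g + h" "g \<in> Y" "h \<in> gen (P [z, x])" using fW unfolding W_def plus_set_def by blast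
    have "P [u', z] \<star> f - P [u', z] \<star> g \<in> I" using I_diff[OF k Yz[OF f(2)]] .
    then have "P [u', z] \<star> h \<in> I" unfolding f(1) path_mult_add_right by simp
    then have "h \<in> X" using left_kernel f(3) by blast
    then have "h \<in> Y" using gen_subset[OF Y XY] by blast
    then show "f \<in> Y" using right_idealD(3)[OF Y f(2)] unfolding f(1) by blast
  qed (rule Yz)
  have zero: "P [u', z, x] - P [u', z] \<star> P [z, x] \<in> I" using ub I_zero by simp
  show "rhombus_module s (quotient_module (module_of W) (cls ` Y))"
    using rhombus_moduleI[OF tile_u'] quotient_isomorphic_gen[OF W path_u'z uW q bW zero ker YW] by blast
  show "short_exact A (module_of Y) (module_of W) (module_of (gen (P [u', z, x]))) (\<lambda>m. m)
       (lmul (P [u', z]))"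
    by (rule short_exact_gen[OF W path_u'z uW q bW zero ker YW])
  have "P [z, x] \<notin> Y" using Yz[of "P [z, x]"] rhombus_path_nonzero unfolding ub by blast
  then show "cls ` Y \<subset> cls ` W" using cls_image_psubset[OF Y YW bW] by blast
qed

end

context rauzy
begin

lemma four_step_filtration:
  assumes t0: "tile_corners z x0 y0 x1" and t1: "tile_corners z x1 y1 x2"
    and t2: "tile_corners z x2 y2 x3" and t3: "tile_corners z x3 y3 x4"
    and d: "x0 \<noteq> x2" "x1 \<noteq> x3" "x1 \<noteq> x4" "x2 \<noteq> x4"
    and na: "\<not> adjacent z x3 x1" "\<not> adjacent z x4 x1" "\<not> adjacent z x4 x2"
  defines "N \<equiv> plus_set (gen (P [z, x1])) (gen (P [z, x2]))"
  defines "M \<equiv> plus_set N (gen (P [z, x3]))"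
  shows "has_rhombus_filtration s (module_of M) 4"
    "short_exact A (module_of N) (module_of M) (module_of (gen (P [x4, z, x3]))) (\<lambda>m. m)
       (lmul (P [x4, z]))"
proof -
  note e0 = tile_edges[OF t0] and e1 = tile_edges[OF t1] and e2 = tile_edges[OF t2] and e3 = tile_edges[OF t3]
  interpret A1: rauzy_arrow s field_type z x1 x0 y0 x2 y1 using t0 t1 d by unfold_locales
  interpret A2: rauzy_arrow s field_type z x2 x1 y1 x3 y2 using t1 t2 d by unfold_locales
  interpret A3: rauzy_arrow s field_type z x3 x2 y2 x4 y3 using t2 t3 d by unfold_locales
  \<comment> \<open>After the reflection the bottom rhombus module is generated by a path that
    begins with the arrow to \<open>x1\<close>.\<close>
  have t0': "tile_corners z x1 y0 x0" using tile_corners_reflect[OF t0] .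
  let ?G = "\<lambda>q. gen (P q)"
  have b: "P [z, x1] \<in> C" "P [z, x2] \<in> C"
    using e1 tile_vertices[OF t1] by (auto intro!: path_elem_C simp: rauzy_paths_simps)
  have G1: "right_ideal (?G [z, x1])" and G2: "right_ideal (?G [z, x2])" using right_ideal_gen b by blast+
  have sub: "?G [z, x1, y0] \<subseteq> ?G [z, x1]" using gen_subset[OF G1 gen_prefix] e0 by blast
  \<comment> \<open>In the lowest use of \<open>filtration_step\<close>, \<open>Y\<close> is
    contained in the arrow module, so the sum is the arrow module itself.\<close>
  then have p1: "plus_set (?G [z, x1, y0]) (?G [z, x1]) = ?G [z, x1]"
    using plus_set_absorb[OF A1.X_ideal G1] by blast
  have q0: "P [z, x1, y0] \<in> ?G [z, x1, y0]" using A1.X_zxy unfolding zero_in_def by blast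
  have k1: "\<forall>f\<in>?G [z, x1, y0]. P [x2, z] \<star> f \<in> I" using A1.left_X by blast
  note s1 = A1.filtration_step[OF A1.X_ideal k1 q0, unfolded p1]
  \<comment> \<open>Both ways round the tile between \<open>x1\<close> and \<open>x2\<close> agree,
    so the path through \<open>x2\<close> lies in the module of \<open>x1\<close>.\<close>
  have y1: "P [z, x2, y1] \<in> ?G [z, x1]"
  proof -
    have "P [z, x1, y1] - P [z, x2, y1] \<in> I" using rhombus_path2[OF t1] unfolding congruent_in_def by blast
    moreover have "P [z, x1, y1] \<in> ?G [z, x1]" using gen_prefix e1 by blast
    ultimately show ?thesis using right_idealD(1)[OF G1] right_idealD(6)[OF G1, of "P [z, x1, y1]"
          "P [z, x1, y1] - P [z, x2, y1]"] by auto
  qed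
  have k2: "\<forall>f\<in>?G [z, x1]. P [x3, z] \<star> f \<in> I"
    using nonadjacent_kills[OF e2(8) e1(1) _ na(1)] d by blast
  note s2 = A2.filtration_step[OF G1 k2 y1, folded N_def]
  have N: "right_ideal N" unfolding N_def using right_ideal_plus[OF G1 G2] .
  have kN: "P [x4, z] \<star> f \<in> I" if "f \<in> N" for f
  proof -
    obtain g h where f: "f = g + h" "g \<in> ?G [z, x1]" "h \<in> ?G [z, x2]" using \<open>f \<in> N\<close> unfolding N_def plus_set_def by blast
    have "P [x4, z] \<star> g \<in> I" using nonadjacent_kills[OF e3(8) e1(1) _ na(2) f(2)] d by blast
    moreover have "P [x4, z] \<star> h \<in> I" using nonadjacent_kills[OF e3(8) e2(1) _ na(3) f(3)] d by blast
    ultimately show ?thesis using I_add unfolding f(1) path_mult_add_right by blast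
  qed
  have y2: "P [z, x3, y2] \<in> N"
  proof -
    have "P [z, x2, y2] - P [z, x3, y2] \<in> I" using rhombus_path2[OF t2] unfolding congruent_in_def by blast
    moreover have "P [z, x2, y2] \<in> ?G [z, x2]" using gen_prefix e2 by blast
    moreover have "?G [z, x2] \<subseteq> N" unfolding N_def using plus_set_upper[OF G1 G2] by blast
    ultimately show ?thesis using right_idealD(1)[OF N] right_idealD(6)[OF N, of "P [z, x2, y2]"
          "P [z, x2, y2] - P [z, x3, y2]"] by auto
  qed
  have k3: "\<forall>f\<in>N. P [x4, z] \<star> f \<in> I" using kN by blast
  note s3 = A3.filtration_step[OF N k3 y2, folded M_def]
  note s0 = rhombus_ideal[OF t0']
  show "short_exact A (module_of N) (module_of M) (module_of (?G [x4, z, x3])) (\<lambda>m. m)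
       (lmul (P [x4, z]))" by (rule s3(3))
  \<comment> \<open>The ideal \<open>I\<close> stands for the zero submodule.\<close>
  define Y where "Y = (\<lambda>j. [I, ?G [z, x1, y0], ?G [z, x1], N, M] ! j)"
  have Y: "Y 0 = I" "Y 1 = ?G [z, x1, y0]" "Y 2 = ?G [z, x1]" "Y 3 = N" "Y 4 = M"
    by (simp_all add: Y_def numeral_2_eq_2 numeral_3_eq_3 numeral_eq_Suc)
  have four: "j = 0 \<or> j = 1 \<or> j = 2 \<or> j = 3" if "j < 4" for j :: nat using that by linarith
  have five: "j = 0 \<or> j = 1 \<or> j = 2 \<or> j = 3 \<or> j = 4" if "j \<le> 4" for j :: nat using that by linarith
  have R: "right_ideal (Y j)" if "j \<le> 4" for j
    using five[OF that] right_ideal_I A1.X_ideal G1 N s3(4) Y by metis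
  have st: "rhombus_module s (quotient_module (module_of (Y (Suc j))) (cls ` Y j)) \<and> cls ` Y j \<subset> cls ` Y (Suc j)"
    if "j < 4" for j
  proof -
    have n: "Suc 0 = 1" "Suc 1 = 2" "Suc 2 = 3" "Suc 3 = 4" by simp_all
    show ?thesis using four[OF that] s0 s1(1,2) s2(1,2) s3(1,2) by (elim disjE) (simp_all only: n Y simp_thms)
  qed
  have sub: "cls ` Y j \<subseteq> cls ` M" if "j \<le> 4" for j
  proof -
    have "cls ` Y 0 \<subset> cls ` Y 1" "cls ` Y 1 \<subset> cls ` Y 2" "cls ` Y 2 \<subset> cls ` Y 3" "cls ` Y 3 \<subset> cls ` Y 4"
      using s0(2) s1(2) s2(2) s3(2) unfolding Y .
    then show ?thesis using five[OF that] Y(5) by (elim disjE) auto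
  qed
  have subY: "Y j \<subseteq> M" if "j \<le> 4" for j
    using sub[OF that] right_ideal_cls_iff[OF s3(4)] by blast
  show "has_rhombus_filtration s (module_of M) 4"
    unfolding has_rhombus_filtration_def Rauzy_algebra_A
  proof (intro exI[of _ "\<lambda>j. cls ` Y j"] conjI allI impI)
    show "cls ` Y 0 = {\<zero>\<^bsub>module_of M\<^esub>}"
      unfolding Y module_of_simps using I_zero cls_eq_iff by force
    show "cls ` Y 4 = carrier (module_of M)" by (simp add: Y module_of_simps)
    show "submodule A (cls ` Y j) (module_of M)" if "j \<le> 4" for j
      using submodule_module_of[OF R[OF that] s3(4) subY[OF that]] .
    show "cls ` Y j \<subset> cls ` Y (Suc j)" if "j < 4" for j using st[OF that] by blast
    show "rhombus_module s (quotient_module ((module_of M)\<lparr>carrier := cls ` Y (Suc j)\<rparr>) (cls ` Y j))" if "j < 4" for j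
      using st[OF that] unfolding module_of_simps(5) by blast
  qed
qed

end

theorem lemma5:
  fixes s :: "3 \<Rightarrow> real^2 \<Rightarrow> int"
    and A :: "((real^2) list \<Rightarrow>\<^sub>0 'k::field) set ring"
    and z :: "real^2" and n :: nat and x :: "nat \<Rightarrow> real^2"
    and b bbar :: "nat \<Rightarrow> ((real^2) list \<Rightarrow>\<^sub>0 'k) set"
  assumes "sign_choice s" and "A = Rauzy_algebra s"
    and "n_vertex n z" and "n \<ge> 5" and "ccw_labelling z n x"
    and "\<And>j. j \<in> {1..n} \<Longrightarrow> b j = path_class s [z, x j]"
    and "\<And>j. j \<in> {1..n} \<Longrightarrow> bbar j = path_class s [x j, z]"
    and "N = right_ideal_module A ((b 1 <#\<^bsub>A\<^esub> carrier A) <+>\<^bsub>A\<^esub> (b 2 <#\<^bsub>A\<^esub> carrier A))"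
    and "M = right_ideal_module A
               ((b 1 <#\<^bsub>A\<^esub> carrier A) <+>\<^bsub>A\<^esub> (b 2 <#\<^bsub>A\<^esub> carrier A) <+>\<^bsub>A\<^esub> (b 3 <#\<^bsub>A\<^esub> carrier A))"
    and "K = right_ideal_module A ((bbar 4 \<otimes>\<^bsub>A\<^esub> b 3) <#\<^bsub>A\<^esub> carrier A)"
  shows "has_rhombus_filtration s M 4 \<and> (\<exists>g. short_exact A N M K (\<lambda>m. m) g)"
proof -
  interpret R: rauzy s "TYPE('k)" using assms(1) by unfold_locales
  have A: "A = R.A" unfolding assms(2) by (rule R.Rauzy_algebra_A)
  note adj = ccw_adjacent[OF assms(3-5)]
  have bij: "bij_betw x {1..n} {y. edge z y}" using assms(5) by (simp add: ccw_labelling_def)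
  have inj: "x i \<noteq> x j" if "i \<in> {1..n}" "j \<in> {1..n}" "i \<noteq> j" for i j
    using inj_onD[OF bij_betw_imp_inj_on[OF bij]] that by blast
  have edges: "edge z (x j)" if "j \<in> {1..n}" for j using bij_betwE[OF bij] that by blast
  \<comment> \<open>Cyclically the predecessor of \<open>x 1\<close> is \<open>x n\<close>; this
    pair provides the bottom tile.\<close>
  have a: "adjacent z (x n) (x 1)" "adjacent z (x 1) (x 2)" "adjacent z (x 2) (x 3)" "adjacent z (x 3) (x 4)"
    using adj(2) adj(1)[of 1] adj(1)[of 2] adj(1)[of 3] assms(4) by (simp_all add: numeral_eq_Suc)
  have ne: "x n \<noteq> x 2" "x n \<noteq> x 3" "x n \<noteq> x 4" "x 1 \<noteq> x 3" "x 1 \<noteq> x 4" "x 2 \<noteq> x 4" "x 2 \<noteq> x 3"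
    using inj[of n 2] inj[of n 3] inj[of n 4] inj[of 1 3] inj[of 1 4] inj[of 2 4] inj[of 2 3] assms(4) by simp_all
  have e: "edge z (x 1)" "edge z (x 2)" "edge z (x 3)" "edge z (x 4)" using edges assms(4) by simp_all
  have only: "w = u \<or> w = v" if "edge z y" "adjacent z y u" "adjacent z y v" "u \<noteq> v" "adjacent z y w" for y u v w
    using two_adjacent[OF that(1)] that(2-5) by metis
  \<comment> \<open>At \<open>z\<close>, \<open>x 1\<close> shares tiles only with
    \<open>x n\<close> and \<open>x 2\<close>, and \<open>x 2\<close> only with \<open>x 1\<close>
    and \<open>x 3\<close>; \<open>n >= 5\<close> separates \<open>x 4\<close> from
    \<open>x n\<close>.\<close>
  have na: "\<not> adjacent z (x 3) (x 1)" "\<not> adjacent z (x 4) (x 1)" "\<not> adjacent z (x 4) (x 2)"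
  proof -
    have "adjacent z (x 1) (x n)" "adjacent z (x 2) (x 1)" using a adjacent_sym by blast+
    then show "\<not> adjacent z (x 3) (x 1)" "\<not> adjacent z (x 4) (x 1)" "\<not> adjacent z (x 4) (x 2)"
      using only[OF e(1) _ a(2) ne(1)] only[OF e(2) _ a(3) ne(4)] ne adjacent_sym adjacent_neq[OF a(4)] by metis+
  qed
  obtain y0 y1 y2 y3 where t: "tile_corners z (x n) y0 (x 1)" "tile_corners z (x 1) y1 (x 2)"
    "tile_corners z (x 2) y2 (x 3)" "tile_corners z (x 3) y3 (x 4)"
    using a unfolding adjacent_def by blast
  note F = R.four_step_filtration[OF t ne(1,4,5,6) na]
  have C: "path_elem [z, x j] \<in> R.C" "path_elem [x j, z] \<in> R.C" if "j \<in> {1..n}" for j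
    using edges[OF that] edge_sym edge_vertices by (auto intro!: R.path_elem_C simp: rauzy_paths_simps)
  have bj: "b j = R.cls (path_elem [z, x j])" "bbar j = R.cls (path_elem [x j, z])" if "j \<in> {1..n}" for j
    using assms(6,7)[OF that] by (simp_all add: R.path_class_cls)
  have bA: "b j <#\<^bsub>R.A\<^esub> carrier R.A = R.cls ` R.gen (path_elem [z, x j])" if "j \<in> {1..n}" for j
    using R.cls_gen[OF C(1)[OF that]] bj[OF that] by simp
  have m: "1 \<in> {1..n}" "2 \<in> {1..n}" "3 \<in> {1..n}" "4 \<in> {1..n}" using assms(4) by auto
  have p: "bbar 4 \<otimes>\<^bsub>R.A\<^esub> b 3 = R.cls (path_elem [x 4, z, x 3])"
    using R.mult_A[OF C(2)[OF m(4)] C(1)[OF m(3)]] bj[OF m(4)] bj[OF m(3)] by (simp add: path_mult_single)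
  have pC: "path_elem [x 4, z, x 3] \<in> R.C"
    using e edge_sym edge_vertices by (auto intro!: R.path_elem_C simp: rauzy_paths_simps)
  have "N = R.module_of (R.plus_set (R.gen (path_elem [z, x 1])) (R.gen (path_elem [z, x 2])))"
    unfolding assms(8) A bA[OF m(1)] bA[OF m(2)] R.cls_plus_set ..
  moreover have "M = R.module_of (R.plus_set (R.plus_set (R.gen (path_elem [z, x 1])) (R.gen (path_elem [z, x 2])))
      (R.gen (path_elem [z, x 3])))"
    unfolding assms(9) A bA[OF m(1)] bA[OF m(2)] bA[OF m(3)] R.cls_plus_set ..
  moreover have "K = R.module_of (R.gen (path_elem [x 4, z, x 3]))"
    unfolding assms(10) A p R.cls_gen[OF pC] ..
  ultimately show ?thesis using F unfolding A by blast
qed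

end
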